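(* Let $d\in\mathbb{N}$, $\mu\in\mathbb{R}$ and $r\in[1,2)$ be such that $\alpha=\alpha(r,\mu)<1$. Then there is a constant $C>0$, independent of time and of the initial data, such that the following holds. Let $(v_0,v_1)\in\Sigma^{r}$ and let $v$ be the solution of $$\partial_t^2 v-\Delta v+\frac{\mu}{(1+t)^2}v=0\ \text{ in }(0,\infty)\times\mathbb{R}^d,\qquad (v(0),\partial_t v(0))=(v_0,v_1).$$ Then there exists $\overrightarrow{v_+}\in\dot H^1(\mathbb{R}^d)\times L^2(\mathbb{R}^d)$ such that for all $t\ge 0$ $$\|\overrightarrow{v}(t)-\mathcal{W}(t)\overrightarrow{v_+}\|_{\dot H^1\times L^2}\le C|\mu|\,\|(v_0,v_1)\|_{\Sigma^r}\begin{cases}(1+t)^{-1}\{1+\log(1+t)\}^{\delta} & \text{if }\alpha<0,\text{ or }\alpha=0\text{ and }r>1,\\ (1+t)^{-1}\{1+\log(1+t)\}^{\frac12+\delta} & \text{if }\alpha=0\text{ and }r=1,\\ (1+t)^{\alpha-1}\{1+\log(1+t)\}^{\delta} & \text{if }\alpha\in(0,1).\end{cases}$$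
   Context: Notation. For $\mu\in\mathbb{R}$ set $\nu:=\frac12\sqrt{1-4\mu}$ if $\mu\le 1/4$ and $\nu:=\frac{i}{2}\sqrt{4\mu-1}$ if $\mu>1/4$ (so $\operatorname{Re}\nu=0$ for $\mu\geq 1/4$). For $1\le r<2$ set $\alpha=\alpha(r,\mu):=\frac12+\operatorname{Re}\nu-\frac{d(2-r)}{2r}$. Set $\delta:=1$ if $\mu=1/4$ and $\delta:=0$ if $\mu\ne1/4$. $\Sigma^r:=(H^1(\mathbb{R}^d)\cap L^r(\mathbb{R}^d))\times(L^2(\mathbb{R}^d)\cap L^r(\mathbb{R}^d))$, with the natural norm $\|(f,g)\|_{\Sigma^r}=\|f\|_{H^1}+\|f\|_{L^r}+\|g\|_{L^2}+\|g\|_{L^r}$. $\dot H^1(\mathbb{R}^d)$ is the (complete) homogeneous Sobolev space with norm $\|f\|_{\dot H^1}=\||\xi|\widehat f\,\|_{L^2}$. For $\overrightarrow{f}=(f,g)$, $\|\overrightarrow f\|_{\dot H^1\times L^2}$ is the product norm. $\overrightarrow v(t):=(v(t),\partial_t v(t))$. $\mathcal{W}(t)$ is the solution map of the free wave equation: $\mathcal{W}(t)(f,g)=\big(\cos(t|\nabla|)f+|\nabla|^{-1}\sin(t|\nabla|)g,\ -|\nabla|\sin(t|\nabla|)f+\cos(t|\nabla|)g\big)$, where functions of $|\nabla|$ are Fourier multipliers in $|\xi|$. "The solution" is the unique solution in $C([0,\infty);H^1)\cap C^1([0,\infty);L^2)$; equivalently, for a.e. $\xi$, $\widehat v(t,\xi)$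 solves $\partial_t^2\widehat v+|\xi|^2\widehat v+\mu(1+t)^{-2}\widehat v=0$ with data $(\widehat v_0(\xi),\widehat v_1(\xi))$. *)

theory Defs
  imports "HOL-Analysis.Analysis"
begin

text \<open>
  Elements of function spaces are represented by Borel measurable complex-valued functions;
  functions that agree almost everywhere are not identified, and no definition below
  distinguishes them.
\<close>

definition Lp_space :: "real \<Rightarrow> ('a::euclidean_space \<Rightarrow> complex) set" where
  "Lp_space p = {f. f \<in> borel_measurable lborel \<and> integrable lborel (\<lambda>x. cmod (f x) powr p)}"

text \<open>For functions outside \<^term>\<open>Lp_space p\<close> the value is junk.\<close>

definition Lp_norm :: "real \<Rightarrow> ('a::euclidean_space \<Rightarrow> complex) \<Rightarrow> real" where
  "Lp_norm p f = (\<integral>x. cmod (f x) powr p \<partial>lborel) powr (1 / p)"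

definition fourier_integral ::
  "('a::euclidean_space \<Rightarrow> complex) \<Rightarrow> 'a \<Rightarrow> complex" where
  "fourier_integral f \<xi> =
     of_real ((2 * pi) powr (- real DIM('a) / 2)) *
     (\<integral>x. exp (- \<i> * of_real (x \<bullet> \<xi>)) * f x \<partial>lborel)"

text \<open>
  The Fourier--Plancherel transform of a square-integrable \<open>f\<close> is the \<open>L\<^sup>2\<close> limit of the
  Fourier integrals of the truncations of \<open>f\<close> to balls. The distance is measured by a
  nonnegative integral so that a non-integrable difference counts as infinite.
\<close>

definition is_fourier_L2 ::
  "('a::euclidean_space \<Rightarrow> complex) \<Rightarrow> ('a \<Rightarrow> complex) \<Rightarrow> bool" where
  "is_fourier_L2 f F \<longleftrightarrow>
     f \<in> Lp_space 2 \<and> F \<in> Lp_space 2 \<and>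
     ((\<lambda>R. \<integral>\<^sup>+\<xi>. ennreal ((cmod (fourier_integral
          (\<lambda>x. indicator (cball 0 R) x * f x) \<xi> - F \<xi>))\<^sup>2) \<partial>lborel) \<longlongrightarrow> 0) at_top"

text \<open>The transforms are determined up to null sets; the choice picks a representative.\<close>

definition fourier_L2 ::
  "('a::euclidean_space \<Rightarrow> complex) \<Rightarrow> 'a \<Rightarrow> complex" where
  "fourier_L2 f = (SOME F. is_fourier_L2 f F)"

definition inv_fourier_L2 ::
  "('a::euclidean_space \<Rightarrow> complex) \<Rightarrow> 'a \<Rightarrow> complex" where
  "inv_fourier_L2 F = (SOME f. is_fourier_L2 f F)"

definition H1_space :: "('a::euclidean_space \<Rightarrow> complex) set" where
  "H1_space = {f \<in> Lp_space 2.
     (\<lambda>\<xi>. of_real (sqrt (1 + (norm \<xi>)\<^sup>2)) * fourier_L2 f \<xi>) \<in> Lp_space 2}"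

definition H1_norm :: "('a::euclidean_space \<Rightarrow> complex) \<Rightarrow> real" where
  "H1_norm f = Lp_norm 2 (\<lambda>\<xi>. of_real (sqrt (1 + (norm \<xi>)\<^sup>2)) * fourier_L2 f \<xi>)"

text \<open>
  The complete homogeneous Sobolev space \<open>Hdot\<^sup>1\<close> is the completion with respect to the
  \<open>L\<^sup>2\<close> norm of \<open>norm \<xi> * fourier_L2 f \<xi>\<close>. In dimensions 1 and 2 it is not a space of
  functions or tempered distributions in \<open>x\<close>, so its elements are represented, in every
  dimension, by their Fourier transforms: it is the weighted space
  \<open>L\<^sup>2(|\<xi>|\<^sup>2 d\<xi>)\<close>. A function \<open>f\<close> in \<open>H\<^sup>1\<close> is embedded as \<open>fourier_L2 f\<close>.
\<close>

definition Hdot1_space :: "('a::euclidean_space \<Rightarrow> complex) set" where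
  "Hdot1_space = {F. F \<in> borel_measurable lborel \<and>
     (\<lambda>\<xi>. of_real (norm \<xi>) * F \<xi>) \<in> Lp_space 2}"

definition Hdot1_norm :: "('a::euclidean_space \<Rightarrow> complex) \<Rightarrow> real" where
  "Hdot1_norm F = Lp_norm 2 (\<lambda>\<xi>. of_real (norm \<xi>) * F \<xi>)"

text \<open>
  In pairs representing elements of \<open>Hdot\<^sup>1 \<times> L\<^sup>2\<close> the first component lives on the
  Fourier side, as above, and the second one is a function of \<open>x\<close>.
\<close>

definition energy_space ::
  "(('a::euclidean_space \<Rightarrow> complex) \<times> ('a \<Rightarrow> complex)) set" where
  "energy_space = Hdot1_space \<times> Lp_space 2"

definition energy_norm ::
  "('a::euclidean_space \<Rightarrow> complex) \<times> ('a \<Rightarrow> complex) \<Rightarrow> real" where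
  "energy_norm p = sqrt ((Hdot1_norm (fst p))\<^sup>2 + (Lp_norm 2 (snd p))\<^sup>2)"

definition energy_diff ::
  "('a \<Rightarrow> complex) \<times> ('a \<Rightarrow> complex) \<Rightarrow> ('a \<Rightarrow> complex) \<times> ('a \<Rightarrow> complex) \<Rightarrow>
   ('a \<Rightarrow> complex) \<times> ('a \<Rightarrow> complex)" where
  "energy_diff p q = ((\<lambda>\<xi>. fst p \<xi> - fst q \<xi>), (\<lambda>x. snd p x - snd q x))"

definition embed_energy ::
  "('a::euclidean_space \<Rightarrow> complex) \<times> ('a \<Rightarrow> complex) \<Rightarrow> ('a \<Rightarrow> complex) \<times> ('a \<Rightarrow> complex)" where
  "embed_energy p = (fourier_L2 (fst p), snd p)"

text \<open>The solution map of the free wave equation; at \<open>\<xi> = 0\<close> the values are irrelevant.\<close>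

definition free_wave ::
  "real \<Rightarrow> ('a::euclidean_space \<Rightarrow> complex) \<times> ('a \<Rightarrow> complex) \<Rightarrow>
   ('a \<Rightarrow> complex) \<times> ('a \<Rightarrow> complex)" where
  "free_wave t = (\<lambda>(F, g).
     ((\<lambda>\<xi>. of_real (cos (t * norm \<xi>)) * F \<xi> +
            of_real (sin (t * norm \<xi>) / norm \<xi>) * fourier_L2 g \<xi>),
      inv_fourier_L2
        (\<lambda>\<xi>. - of_real (norm \<xi> * sin (t * norm \<xi>)) * F \<xi> +
              of_real (cos (t * norm \<xi>)) * fourier_L2 g \<xi>)))"

definition Sigma_space ::
  "real \<Rightarrow> (('a::euclidean_space \<Rightarrow> complex) \<times> ('a \<Rightarrow> complex)) set" where
  "Sigma_space r = (H1_space \<inter> Lp_space r) \<times> (Lp_space 2 \<inter> Lp_space r)"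

definition Sigma_norm ::
  "real \<Rightarrow> ('a::euclidean_space \<Rightarrow> complex) \<times> ('a \<Rightarrow> complex) \<Rightarrow> real" where
  "Sigma_norm r p =
     H1_norm (fst p) + Lp_norm r (fst p) + Lp_norm 2 (snd p) + Lp_norm r (snd p)"

definition curve_continuous ::
  "(('a \<Rightarrow> complex) \<Rightarrow> real) \<Rightarrow> (real \<Rightarrow> 'a \<Rightarrow> complex) \<Rightarrow> bool" where
  "curve_continuous N u \<longleftrightarrow>
     (\<forall>t\<ge>0. ((\<lambda>s. N (\<lambda>x. u s x - u t x)) \<longlongrightarrow> 0) (at t within {0..}))"

definition curve_has_derivative ::
  "(('a \<Rightarrow> complex) \<Rightarrow> real) \<Rightarrow> (real \<Rightarrow> 'a \<Rightarrow> complex) \<Rightarrow> (real \<Rightarrow> 'a \<Rightarrow> complex) \<Rightarrow> bool" where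
  "curve_has_derivative N u u' \<longleftrightarrow>
     (\<forall>t\<ge>0. ((\<lambda>s. N (\<lambda>x. (u s x - u t x) / of_real (s - t) - u' t x)) \<longlongrightarrow> 0)
        (at t within {0..}))"

text \<open>
  \<open>v\<close> is the solution in \<open>C([0,\<infinity>); H\<^sup>1) \<inter> C\<^sup>1([0,\<infinity>); L\<^sup>2)\<close>, with \<open>L\<^sup>2\<close>-valued
  time derivative \<open>vt\<close>. The equation and the initial conditions are imposed for almost
  every frequency. As \<open>fourier_L2 (v t)\<close> is only determined up to a null set depending on
  \<open>t\<close>, this is said of a version \<open>w\<close> of it, whose pointwise time derivative is \<open>w'\<close>.
\<close>

definition is_wave_solution ::
  "real \<Rightarrow> ('a::euclidean_space \<Rightarrow> complex) \<Rightarrow> ('a \<Rightarrow> complex) \<Rightarrow>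
   (real \<Rightarrow> 'a \<Rightarrow> complex) \<Rightarrow> (real \<Rightarrow> 'a \<Rightarrow> complex) \<Rightarrow> bool" where
  "is_wave_solution \<mu> v0 v1 v vt \<longleftrightarrow>
     (\<forall>t\<ge>0. v t \<in> H1_space) \<and> curve_continuous H1_norm v \<and>
     (\<forall>t\<ge>0. vt t \<in> Lp_space 2) \<and> curve_has_derivative (Lp_norm 2) v vt \<and>
     curve_continuous (Lp_norm 2) vt \<and>
     (\<exists>w w'.
        (\<forall>t\<ge>0. AE \<xi> in lborel. w t \<xi> = fourier_L2 (v t) \<xi>) \<and>
        (AE \<xi> in lborel.
           w 0 \<xi> = fourier_L2 v0 \<xi> \<and> w' 0 \<xi> = fourier_L2 v1 \<xi> \<and>
           (\<forall>t\<ge>0.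
              ((\<lambda>s. w s \<xi>) has_vector_derivative w' t \<xi>) (at t within {0..}) \<and>
              ((\<lambda>s. w' s \<xi>) has_vector_derivative
                 (- of_real ((norm \<xi>)\<^sup>2) * w t \<xi> - of_real (\<mu> / (1 + t)\<^sup>2) * w t \<xi>))
                 (at t within {0..}))))"

definition nu :: "real \<Rightarrow> complex" where
  "nu \<mu> = (if \<mu> \<le> 1/4 then of_real (1/2 * sqrt (1 - 4 * \<mu>))
           else \<i> / 2 * of_real (sqrt (4 * \<mu> - 1)))"

definition alpha :: "nat \<Rightarrow> real \<Rightarrow> real \<Rightarrow> real" where
  "alpha d r \<mu> = 1/2 + Re (nu \<mu>) - real d * (2 - r) / (2 * r)"

definition delta :: "real \<Rightarrow> real" where
  "delta \<mu> = (if \<mu> = 1/4 then 1 else 0)"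

definition decay_rate :: "nat \<Rightarrow> real \<Rightarrow> real \<Rightarrow> real \<Rightarrow> real" where
  "decay_rate d r \<mu> t =
     (if alpha d r \<mu> < 0 \<or> (alpha d r \<mu> = 0 \<and> r > 1) then
        (1 + t) powr (-1) * (1 + ln (1 + t)) powr (delta \<mu>)
      else if alpha d r \<mu> = 0 \<and> r = 1 then
        (1 + t) powr (-1) * (1 + ln (1 + t)) powr (1/2 + delta \<mu>)
      else
        (1 + t) powr (alpha d r \<mu> - 1) * (1 + ln (1 + t)) powr (delta \<mu>))"

end

theory Submission
  imports Defs "HOL-Probability.Characteristic_Functions"
begin

text \<open>
  At a frequency of modulus \<open>\<rho>\<close> the pair \<open>(\<rho> w, w')\<close>, written in the frame that the free flow
  rotates, has time derivative of size \<open>|\<mu>| (1 + t)\<^sup>-\<^sup>2 |w|\<close>. Hence it converges, its limit is the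
  scattering state, and the error at time \<open>t\<close> is controlled pointwise in the frequency by any
  growth bound for \<open>w\<close> with exponent less than 1. With \<open>\<beta> = 1/2 + Re \<nu>\<close>, a mode grows like
  \<open>(1 + t)\<^sup>\<beta>\<close>, with a logarithm if \<open>\<mu> = 1/4\<close>, until \<open>\<rho> (1 + t) = 1\<close>, and stays bounded by its
  value there afterwards; this is proved by energy estimates in the time \<open>ln (1 + t)\<close>, without
  Bessel functions. So a low-frequency mode is bounded by \<open>\<rho>\<^sup>-\<^sup>\<gamma> (1 + t)\<^sup>\<beta>\<^sup>-\<^sup>\<gamma>\<close> for every
  \<open>\<gamma>\<close> between 0 and \<open>\<beta>\<close>. For \<open>r > 1\<close> one takes \<open>\<gamma> = min s \<beta>\<close> with \<open>s = d (1/r - 1/2)\<close> and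
  applies Pitt's inequality \<open>\<parallel>|\<xi>|\<^sup>-\<^sup>s f^\<parallel>\<^sub>2 \<le> C \<parallel>f\<parallel>\<^sub>r\<close>. For \<open>r = 1\<close>, where the transform is bounded,
  one integrates over \<open>\<rho> \<le> 1/(1 + t)\<close> with some \<open>\<gamma> < d/2\<close> and over the remaining low frequencies
  with \<open>\<gamma> = \<beta>\<close>; the extra half power of the logarithm at \<open>\<alpha> = 0\<close> is the integral of \<open>\<rho>\<^sup>-\<^sup>1\<close>.

  Plancherel's theorem follows from the transform of the autocorrelation of \<open>f\<close>, which is
  \<open>|f^|\<^sup>2\<close> up to a constant, integrated against widening Gaussians.
\<close>

section \<open>Square-integrable functions\<close>

text \<open>The hypothesis \<alpha> < 1 says that some \<gamma> usable with data in L^r leaves a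
  mode growth exponent \<kappa> = \<beta> - \<gamma> below 1, so that (1 + t)^(\<kappa> - 2), the
  size of the derivative of the rotated pair, is integrable in time. At r = 1 and \<alpha> \<ge> 0
  no single \<gamma> gives the rate: |\<xi>|^(-2 \<gamma>) is integrable at the origin only for
  \<gamma> < d/2, while such a \<gamma> alone yields a rate that is too slow. The value \<mu> = 1/4
  is separate because \<nu> = 0 there, and the energy p^2 + |\<nu>|^2 y^2 behind the other cases no
  longer controls y. A second obstacle is measurability: the mode version \<open>w\<close> agrees
  with the chosen transforms only up to null sets depending on the time. It therefore serves for
  pointwise bounds only, and the scattering state is built from the chosen transforms at integer
  times.\<close>

definition sq_mass :: "('a::euclidean_space \<Rightarrow> complex) \<Rightarrow> ennreal" where
  "sq_mass f = (\<integral>\<^sup>+x. ennreal ((cmod (f x))\<^sup>2) \<partial>lborel)"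

lemma L2_iff: "f \<in> Lp_space 2 \<longleftrightarrow> f \<in> borel_measurable borel \<and> sq_mass f < \<infinity>"
proof -
  have "(\<lambda>x. cmod (f x) powr 2) = (\<lambda>x. (cmod (f x))\<^sup>2)" by (auto simp: fun_eq_iff)
  then show ?thesis
    unfolding Lp_space_def sq_mass_def by (auto simp: integrable_iff_bounded)
qed

lemma L2_measurable: "f \<in> Lp_space 2 \<Longrightarrow> f \<in> borel_measurable borel"
  by (simp add: L2_iff)

lemma L2_finite: "f \<in> Lp_space 2 \<Longrightarrow> sq_mass f < \<infinity>"
  by (simp add: L2_iff)

lemma L2_sq_integrable: "f \<in> Lp_space 2 \<Longrightarrow> integrable lborel (\<lambda>x. (cmod (f x))\<^sup>2)"
  unfolding Lp_space_def by simp

lemma Lp_norm_2: "Lp_norm 2 f = sqrt (\<integral>x. (cmod (f x))\<^sup>2 \<partial>lborel)"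
  unfolding Lp_norm_def by (simp add: powr_half_sqrt)

lemma Lp_norm_nonneg [simp]: "0 \<le> Lp_norm p f"
  unfolding Lp_norm_def by simp

lemma sq_mass_eq: "f \<in> Lp_space 2 \<Longrightarrow> sq_mass f = ennreal ((Lp_norm 2 f)\<^sup>2)"
  unfolding sq_mass_def Lp_norm_2
  by (subst nn_integral_eq_integral[OF L2_sq_integrable]) auto

lemma sq_mass_mono:
  "(\<And>x. cmod (f x) \<le> cmod (g x)) \<Longrightarrow> sq_mass f \<le> sq_mass g"
  unfolding sq_mass_def by (intro nn_integral_mono ennreal_leI power_mono) auto

lemma sq_mass_cong_AE:
  "AE x in lborel. cmod (f x) = cmod (g x) \<Longrightarrow> sq_mass f = sq_mass g"
  unfolding sq_mass_def by (intro nn_integral_cong_AE) auto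

lemma sq_mass_scale: "f \<in> borel_measurable borel \<Longrightarrow> sq_mass (\<lambda>x. c * f x) = ennreal ((cmod c)\<^sup>2) * sq_mass f"
  unfolding sq_mass_def
  by (subst nn_integral_cmult[symmetric]) (auto simp: norm_mult power_mult_distrib ennreal_mult)

lemma sq_mass_add_le:
  assumes [measurable]: "f \<in> borel_measurable borel" "g \<in> borel_measurable borel"
  shows "sq_mass (\<lambda>x. f x + g x) \<le> 2 * sq_mass f + 2 * sq_mass g"
proof -
  have *: "(cmod (f x + g x))\<^sup>2 \<le> 2 * (cmod (f x))\<^sup>2 + 2 * (cmod (g x))\<^sup>2" for x
  proof -
    have "(cmod (f x + g x))\<^sup>2 \<le> (cmod (f x) + cmod (g x))\<^sup>2"
      by (intro power_mono norm_triangle_ineq) auto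
    also have "\<dots> \<le> 2 * (cmod (f x))\<^sup>2 + 2 * (cmod (g x))\<^sup>2"
      using sum_squares_bound[of "cmod (f x)" "cmod (g x)"] by (simp add: power2_sum)
    finally show ?thesis .
  qed
  have "sq_mass (\<lambda>x. f x + g x) \<le> (\<integral>\<^sup>+x. 2 * ennreal ((cmod (f x))\<^sup>2) + 2 * ennreal ((cmod (g x))\<^sup>2) \<partial>lborel)"
    unfolding sq_mass_def
  proof (intro nn_integral_mono)
    fix x
    have "ennreal ((cmod (f x + g x))\<^sup>2) \<le> ennreal (2 * (cmod (f x))\<^sup>2 + 2 * (cmod (g x))\<^sup>2)"
      by (intro ennreal_leI *)
    also have "\<dots> = 2 * ennreal ((cmod (f x))\<^sup>2) + 2 * ennreal ((cmod (g x))\<^sup>2)"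
      by (simp add: ennreal_plus ennreal_mult)
    finally show "ennreal ((cmod (f x + g x))\<^sup>2) \<le> 2 * ennreal ((cmod (f x))\<^sup>2) + 2 * ennreal ((cmod (g x))\<^sup>2)" .
  qed
  also have "\<dots> = 2 * sq_mass f + 2 * sq_mass g"
    unfolding sq_mass_def by (simp add: nn_integral_add nn_integral_cmult)
  finally show ?thesis .
qed

lemma L2_add:
  assumes "f \<in> Lp_space 2" "g \<in> Lp_space 2" shows "(\<lambda>x. f x + g x) \<in> Lp_space 2"
proof -
  have "2 * sq_mass f + 2 * sq_mass g < \<infinity>"
    using assms by (auto simp: L2_iff ennreal_mult_less_top)
  then have "sq_mass (\<lambda>x. f x + g x) < \<infinity>"
    using assms by (intro le_less_trans[OF sq_mass_add_le[of f g]]) (auto simp: L2_iff)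
  then show ?thesis using assms by (auto simp: L2_iff)
qed

lemma L2_scale: "f \<in> Lp_space 2 \<Longrightarrow> (\<lambda>x. c * f x) \<in> Lp_space 2"
  by (auto simp: L2_iff sq_mass_scale ennreal_mult_less_top)

lemma L2_uminus: "f \<in> Lp_space 2 \<Longrightarrow> (\<lambda>x. - f x) \<in> Lp_space 2"
  using L2_scale[of f "-1"] by simp

lemma L2_diff: "f \<in> Lp_space 2 \<Longrightarrow> g \<in> Lp_space 2 \<Longrightarrow> (\<lambda>x. f x - g x) \<in> Lp_space 2"
  using L2_add[of f "\<lambda>x. - g x"] L2_uminus[of g] by simp

lemma L2_cnj: "f \<in> Lp_space 2 \<Longrightarrow> (\<lambda>x. cnj (f x)) \<in> Lp_space 2"
proof -
  assume f: "f \<in> Lp_space 2"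
  have "(\<lambda>x. cnj (f x)) \<in> borel_measurable borel"
    using L2_measurable[OF f] by (intro borel_measurable_continuous_on[of cnj] continuous_intros) auto
  then show ?thesis using f by (auto simp: L2_iff sq_mass_def)
qed

lemma L2_dominated:
  assumes "g \<in> Lp_space 2" "f \<in> borel_measurable borel" "\<And>x. cmod (f x) \<le> cmod (g x)"
  shows "f \<in> Lp_space 2"
  using assms le_less_trans[OF sq_mass_mono[of f g]] by (auto simp: L2_iff)

lemma L2_mult_integrable:
  assumes f: "f \<in> Lp_space 2" and g: "g \<in> Lp_space 2"
  shows "integrable lborel (\<lambda>x. f x * g x)"
proof (rule Bochner_Integration.integrable_bound)
  show "integrable lborel (\<lambda>x. (cmod (f x))\<^sup>2 + (cmod (g x))\<^sup>2)"
    using L2_sq_integrable[OF f] L2_sq_integrable[OF g] by auto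
  show "(\<lambda>x. f x * g x) \<in> borel_measurable lborel"
    using L2_measurable[OF f] L2_measurable[OF g] by simp
  have *: "a * b \<le> a\<^sup>2 + b\<^sup>2" if "a \<ge> 0" "b \<ge> 0" for a b :: real
    using sum_squares_bound[of a b] mult_nonneg_nonneg[OF that] by linarith
  show "AE x in lborel. cmod (f x * g x) \<le> norm ((cmod (f x))\<^sup>2 + (cmod (g x))\<^sup>2)"
    by (auto simp: norm_mult intro!: order_trans[OF *])
qed

lemma L2_Cauchy_Schwarz_abs:
  assumes f: "f \<in> Lp_space 2" and g: "g \<in> Lp_space 2"
  shows "(\<integral>x. cmod (f x) * cmod (g x) \<partial>lborel) \<le> Lp_norm 2 f * Lp_norm 2 g"
proof -
  note [measurable] = L2_measurable[OF f] L2_measurable[OF g]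
  have int: "integrable lborel (\<lambda>x. cmod (f x) * cmod (g x))"
    using integrable_norm[OF L2_mult_integrable[OF f g]] by (simp add: norm_mult)
  let ?I = "\<integral>x. cmod (f x) * cmod (g x) \<partial>lborel"
  have "(\<integral>\<^sup>+x. ennreal (cmod (f x)) * ennreal (cmod (g x)) \<partial>lborel)\<^sup>2 \<le>
     (\<integral>\<^sup>+x. ennreal (cmod (f x)) ^ 2 \<partial>lborel) * (\<integral>\<^sup>+x. ennreal (cmod (g x)) ^ 2 \<partial>lborel)"
    by (rule Cauchy_Schwarz_nn_integral) auto
  also have "\<dots> = sq_mass f * sq_mass g"
    by (simp add: sq_mass_def ennreal_power)
  also have "\<dots> = ennreal ((Lp_norm 2 f * Lp_norm 2 g)\<^sup>2)"
    by (simp add: sq_mass_eq f g ennreal_mult power_mult_distrib)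
  also have "(\<integral>\<^sup>+x. ennreal (cmod (f x)) * ennreal (cmod (g x)) \<partial>lborel) = ennreal ?I"
    by (subst nn_integral_eq_integral[OF int, symmetric]) (auto simp: ennreal_mult)
  finally have "?I\<^sup>2 \<le> (Lp_norm 2 f * Lp_norm 2 g)\<^sup>2"
    by (simp add: ennreal_power)
  then show ?thesis
    by (rule power2_le_imp_le) simp
qed

lemma L2_Cauchy_Schwarz:
  assumes f: "f \<in> Lp_space 2" and g: "g \<in> Lp_space 2"
  shows "cmod (\<integral>x. f x * g x \<partial>lborel) \<le> Lp_norm 2 f * Lp_norm 2 g"
  using integral_norm_bound[of lborel "\<lambda>x. f x * g x"] L2_Cauchy_Schwarz_abs[OF f g]
  by (simp add: norm_mult)

lemma L2_triangle:
  assumes f: "f \<in> Lp_space 2" and g: "g \<in> Lp_space 2"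
  shows "Lp_norm 2 (\<lambda>x. f x + g x) \<le> Lp_norm 2 f + Lp_norm 2 g"
proof -
  have int: "integrable lborel (\<lambda>x. cmod (f x) * cmod (g x))"
    using integrable_norm[OF L2_mult_integrable[OF f g]] by (simp add: norm_mult)
  have "(Lp_norm 2 (\<lambda>x. f x + g x))\<^sup>2 = (\<integral>x. (cmod (f x + g x))\<^sup>2 \<partial>lborel)"
    by (simp add: Lp_norm_2)
  also have "\<dots> \<le> (\<integral>x. (cmod (f x))\<^sup>2 + (cmod (g x))\<^sup>2 + 2 * (cmod (f x) * cmod (g x)) \<partial>lborel)"
  proof (rule integral_mono)
    show "integrable lborel (\<lambda>x. (cmod (f x + g x))\<^sup>2)"
      by (rule L2_sq_integrable[OF L2_add[OF f g]])
    show "integrable lborel (\<lambda>x. (cmod (f x))\<^sup>2 + (cmod (g x))\<^sup>2 + 2 * (cmod (f x) * cmod (g x)))"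
      using L2_sq_integrable[OF f] L2_sq_integrable[OF g] int by auto
    show "(cmod (f x + g x))\<^sup>2 \<le> (cmod (f x))\<^sup>2 + (cmod (g x))\<^sup>2 + 2 * (cmod (f x) * cmod (g x))" for x
      using power_mono[OF norm_triangle_ineq[of "f x" "g x"], of 2] by (simp add: power2_sum)
  qed
  also have "\<dots> = (Lp_norm 2 f)\<^sup>2 + (Lp_norm 2 g)\<^sup>2 + 2 * (\<integral>x. cmod (f x) * cmod (g x) \<partial>lborel)"
    using L2_sq_integrable[OF f] L2_sq_integrable[OF g] int by (simp add: Lp_norm_2)
  also have "\<dots> \<le> (Lp_norm 2 f + Lp_norm 2 g)\<^sup>2"
    using L2_Cauchy_Schwarz_abs[OF f g] by (simp add: power2_sum)
  finally show ?thesis by (rule power2_le_imp_le) simp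
qed

lemma Lp_norm_2_commute: "Lp_norm 2 (\<lambda>x. f x - g x) = Lp_norm 2 (\<lambda>x. g x - f x)"
  unfolding Lp_norm_2 by (simp add: norm_minus_commute)

lemma L2_triangle_abs:
  assumes f: "f \<in> Lp_space 2" and g: "g \<in> Lp_space 2"
  shows "\<bar>Lp_norm 2 f - Lp_norm 2 g\<bar> \<le> Lp_norm 2 (\<lambda>x. f x - g x)"
  using L2_triangle[OF g L2_diff[OF f g]] L2_triangle[OF f L2_diff[OF g f]]
  by (simp add: Lp_norm_2_commute[of g f])

text \<open>The transform is defined by convergence of a nonnegative integral, whereas the triangle
  inequality is available for \<open>Lp_norm 2\<close>; this passes between the two.\<close>

lemma sq_mass_tendsto_iff:
  assumes "\<And>i. f i \<in> Lp_space 2"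
  shows "((\<lambda>i. sq_mass (f i)) \<longlongrightarrow> 0) F \<longleftrightarrow> ((\<lambda>i. Lp_norm 2 (f i)) \<longlongrightarrow> 0) F"
proof -
  have "((\<lambda>i. sq_mass (f i)) \<longlongrightarrow> 0) F \<longleftrightarrow> ((\<lambda>i. ennreal ((Lp_norm 2 (f i))\<^sup>2)) \<longlongrightarrow> ennreal 0) F"
    by (simp add: sq_mass_eq assms)
  also have "\<dots> \<longleftrightarrow> ((\<lambda>i. (Lp_norm 2 (f i))\<^sup>2) \<longlongrightarrow> 0) F"
    by (subst tendsto_ennreal_iff) auto
  also have "\<dots> \<longleftrightarrow> ((\<lambda>i. Lp_norm 2 (f i)) \<longlongrightarrow> 0) F"
    using tendsto_power[of "\<lambda>i. Lp_norm 2 (f i)" 0 F 2] tendsto_real_sqrt[of "\<lambda>i. (Lp_norm 2 (f i))\<^sup>2" 0 F]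
    by auto
  finally show ?thesis .
qed

text \<open>Riesz--Fischer: summability of \<open>2^n |f (Suc n) - f n|^2\<close> forces pointwise convergence.\<close>

lemma L2_fast_Cauchy_limit:
  assumes f: "\<And>n. f n \<in> Lp_space 2"
    and fast: "\<And>n. sq_mass (\<lambda>x. f (Suc n) x - f n x) \<le> ennreal ((1/4) ^ n)"
  obtains F where "F \<in> Lp_space 2" "(\<lambda>n. sq_mass (\<lambda>x. f n x - F x)) \<longlonglongrightarrow> 0"
proof -
  note [measurable] = L2_measurable[OF f]
  \<comment> \<open>The weight \<open>2 ^ n\<close> still leaves a summable series, with ratio 2/4.
    Where the sum is finite its terms are bounded, so the differences decay like powers of
    \<open>sqrt (1/2)\<close>, again geometrically.\<close>
  define D where "D n x = ennreal (2 ^ n * (cmod (f (Suc n) x - f n x))\<^sup>2)" for n x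
  have "(\<integral>\<^sup>+x. (\<Sum>n. D n x) \<partial>lborel) = (\<Sum>n. \<integral>\<^sup>+x. D n x \<partial>lborel)"
    unfolding D_def by (rule nn_integral_suminf) auto
  also have "\<dots> \<le> (\<Sum>n. ennreal ((1/2) ^ n))"
  proof (rule suminf_le)
    fix n
    have "(\<integral>\<^sup>+x. D n x \<partial>lborel) = ennreal (2 ^ n) * sq_mass (\<lambda>x. f (Suc n) x - f n x)"
      unfolding D_def sq_mass_def by (subst nn_integral_cmult[symmetric]) (auto simp: ennreal_mult)
    also have "\<dots> \<le> ennreal (2 ^ n) * ennreal ((1/4) ^ n)"
      using fast[of n] by (intro mult_left_mono) auto
    also have "\<dots> = ennreal ((1/2) ^ n)"
      by (simp add: ennreal_mult[symmetric] power_mult_distrib[symmetric])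
    finally show "(\<integral>\<^sup>+x. D n x \<partial>lborel) \<le> ennreal ((1/2) ^ n)" .
  qed auto
  also have "\<dots> < \<infinity>"
    by (subst suminf_ennreal2) (auto intro: summable_geometric)
  finally have "AE x in lborel. (\<Sum>n. D n x) \<noteq> \<infinity>"
    by (intro nn_integral_PInf_AE) (auto simp: D_def)
  then have conv: "AE x in lborel. convergent (\<lambda>n. f n x)"
  proof eventually_elim
    case (elim x)
    have "summable (\<lambda>n. 2 ^ n * (cmod (f (Suc n) x - f n x))\<^sup>2)"
      using elim unfolding D_def by (intro summable_suminf_not_top) auto
    then have "(\<lambda>n. 2 ^ n * (cmod (f (Suc n) x - f n x))\<^sup>2) \<longlonglongrightarrow> 0"
      by (rule summable_LIMSEQ_zero)
    then have "Bseq (\<lambda>n. 2 ^ n * (cmod (f (Suc n) x - f n x))\<^sup>2)"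
      by (rule convergent_imp_Bseq[OF convergentI])
    then obtain K where K: "K > 0" "\<And>n. norm (2 ^ n * (cmod (f (Suc n) x - f n x))\<^sup>2) \<le> K"
      by (auto elim: BseqE)
    have geom: "norm (f (Suc n) x - f n x) \<le> sqrt K * (sqrt (1/2)) ^ n" for n
    proof (rule power2_le_imp_le)
      have "(cmod (f (Suc n) x - f n x))\<^sup>2 \<le> K * (1/2) ^ n"
        using K(2)[of n] by (simp add: field_simps power_divide)
      also have "\<dots> = (sqrt K * (sqrt (1/2)) ^ n)\<^sup>2"
        using K(1) by (simp add: power_mult_distrib power_mult[symmetric] mult.commute[of n 2])
          (simp add: power_mult)
      finally show "(norm (f (Suc n) x - f n x))\<^sup>2 \<le> (sqrt K * (sqrt (1/2)) ^ n)\<^sup>2" .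
    qed (use K(1) in auto)
    have "norm (sqrt (1/2)) < (1::real)"
      by (simp add: real_sqrt_less_iff real_sqrt_divide)
    then have "summable (\<lambda>n. sqrt K * (sqrt (1/2)) ^ n)"
      by (intro summable_mult summable_geometric)
    then have "summable (\<lambda>n. f (Suc n) x - f n x)"
      by (rule summable_comparison_test'[where N=0]) (rule geom)
    then have "convergent (\<lambda>n. \<Sum>k<n. f (Suc k) x - f k x)"
      by (simp add: summable_iff_convergent)
    moreover have "(\<Sum>k<n. f (Suc k) x - f k x) = f n x - f 0 x" for n
      by (rule sum_lessThan_telescope)
    ultimately have "convergent (\<lambda>n. f n x - f 0 x)"
      by (simp only:)
    from convergent_add[OF this convergent_const[of "f 0 x"]]
    show ?case by (simp only: diff_add_cancel)
  qed
  define F where "F x = lim (\<lambda>n. f n x)" for x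
  have F[measurable]: "F \<in> borel_measurable borel"
    unfolding F_def by measurable
  have lim: "AE x in lborel. (\<lambda>n. f n x) \<longlonglongrightarrow> F x"
    using conv by eventually_elim (auto simp: F_def convergent_LIMSEQ_iff)
  have tele: "sq_mass (\<lambda>x. f m x - f n x) \<le> ennreal (16 * (1/4) ^ n)" if "n \<le> m" for m n
  proof -
    have *: "Lp_norm 2 (\<lambda>x. f (Suc k) x - f k x) \<le> (1/2) ^ k" for k
    proof (rule power2_le_imp_le)
      have "ennreal ((Lp_norm 2 (\<lambda>x. f (Suc k) x - f k x))\<^sup>2) \<le> ennreal ((1/4) ^ k)"
        using fast[of k] sq_mass_eq[OF L2_diff[OF f f, of "Suc k" k]]
        by simp
      also have "(1/4) ^ k = ((1/2::real) ^ k)\<^sup>2"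
        by (simp add: power2_eq_square power_mult_distrib[symmetric])
      finally show "(Lp_norm 2 (\<lambda>x. f (Suc k) x - f k x))\<^sup>2 \<le> ((1/2) ^ k)\<^sup>2"
        by simp
    qed simp
    have "Lp_norm 2 (\<lambda>x. f m x - f n x) \<le> 2 * (1/2) ^ n - 2 * (1/2) ^ m"
      using that
    proof (induction m rule: dec_induct)
      case base
      show ?case by (simp add: Lp_norm_2)
    next
      case (step m)
      have "Lp_norm 2 (\<lambda>x. f (Suc m) x - f n x) \<le> Lp_norm 2 (\<lambda>x. f (Suc m) x - f m x) + Lp_norm 2 (\<lambda>x. f m x - f n x)"
        using L2_triangle[OF L2_diff[OF f f, of "Suc m" m] L2_diff[OF f f, of m n]] by simp
      also have "\<dots> \<le> (1/2) ^ m + (2 * (1/2) ^ n - 2 * (1/2) ^ m)"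
        using *[of m] step by simp
      also have "\<dots> = 2 * (1/2) ^ n - 2 * (1/2) ^ (Suc m)" by simp
      finally show ?case .
    qed
    then have "Lp_norm 2 (\<lambda>x. f m x - f n x) \<le> 4 * (1/2) ^ n"
      using zero_le_power[of "1/2::real" n] zero_le_power[of "1/2::real" m] by linarith
    then have "(Lp_norm 2 (\<lambda>x. f m x - f n x))\<^sup>2 \<le> (4 * (1/2) ^ n)\<^sup>2"
      by (rule power_mono) simp
    also have "\<dots> = 16 * (1/4) ^ n"
      by (simp add: power_mult_distrib power2_eq_square power_mult_distrib[symmetric])
    finally show ?thesis by (subst sq_mass_eq[OF L2_diff[OF f f]]) (rule ennreal_leI)
  qed
  \<comment> \<open>Fatou's lemma in \<open>m\<close> with \<open>n\<close> fixed turns the uniform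
    tail bound into a bound of the distance to the limit, which also puts the limit in L2.\<close>
  have bound: "sq_mass (\<lambda>x. f n x - F x) \<le> ennreal (16 * (1/4) ^ n)" for n
  proof -
    have "sq_mass (\<lambda>x. f n x - F x) = (\<integral>\<^sup>+x. liminf (\<lambda>m. ennreal ((cmod (f n x - f m x))\<^sup>2)) \<partial>lborel)"
      unfolding sq_mass_def
    proof (intro nn_integral_cong_AE)
      show "AE x in lborel. ennreal ((cmod (f n x - F x))\<^sup>2) = liminf (\<lambda>m. ennreal ((cmod (f n x - f m x))\<^sup>2))"
        using lim
      proof eventually_elim
        case (elim x)
        have "(\<lambda>m. ennreal ((cmod (f n x - f m x))\<^sup>2)) \<longlonglongrightarrow> ennreal ((cmod (f n x - F x))\<^sup>2)"
          by (intro tendsto_intros tendsto_ennrealI elim)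
        then show ?case by (intro lim_imp_Liminf[symmetric]) auto
      qed
    qed
    also have "\<dots> \<le> liminf (\<lambda>m. \<integral>\<^sup>+x. ennreal ((cmod (f n x - f m x))\<^sup>2) \<partial>lborel)"
      by (rule nn_integral_liminf) auto
    also have "\<dots> \<le> ennreal (16 * (1/4) ^ n)"
    proof -
      have "\<forall>\<^sub>F m in sequentially. (\<integral>\<^sup>+x. ennreal ((cmod (f n x - f m x))\<^sup>2) \<partial>lborel) \<le> ennreal (16 * (1/4) ^ n)"
        using eventually_ge_at_top[of n]
        by eventually_elim
           (use tele[of n] in \<open>simp add: sq_mass_def norm_minus_commute[of "f n _"]\<close>)
      then show ?thesis
        by (intro Liminf_le) auto
    qed
    finally show ?thesis .
  qed
  have "(\<lambda>x. f 0 x - F x) \<in> Lp_space 2"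
    using le_less_trans[OF bound[of 0]] by (auto simp: L2_iff)
  from L2_diff[OF f[of 0] this] have "F \<in> Lp_space 2" by simp
  moreover have "(\<lambda>n. ennreal (16 * (1/4) ^ n)) \<longlonglongrightarrow> ennreal (16 * 0)"
    by (intro tendsto_ennrealI tendsto_mult tendsto_const LIMSEQ_power_zero) auto
  then have "(\<lambda>n. ennreal (16 * (1/4) ^ n)) \<longlonglongrightarrow> 0" by simp
  then have "(\<lambda>n. sq_mass (\<lambda>x. f n x - F x)) \<longlonglongrightarrow> 0"
    by (rule tendsto_sandwich[OF _ _ tendsto_const, rotated 2]) (simp_all add: bound)
  ultimately show thesis by (rule that)
qed

section \<open>Continuity of translations\<close>

lemma nn_integral_affine:
  fixes f :: "'a::euclidean_space \<Rightarrow> ennreal"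
  assumes [measurable]: "f \<in> borel_measurable borel" and c: "c \<noteq> 0"
  shows "(\<integral>\<^sup>+x. f x \<partial>lborel) = ennreal (\<bar>c\<bar> ^ DIM('a)) * (\<integral>\<^sup>+x. f (t + c *\<^sub>R x) \<partial>lborel)"
  by (subst lborel_affine[OF c, of t])
     (simp add: nn_integral_density nn_integral_distr nn_integral_cmult)

lemma integrable_affine:
  fixes f :: "'a::euclidean_space \<Rightarrow> 'b::{banach, second_countable_topology}"
  assumes f: "integrable lborel f" and c: "c \<noteq> 0"
  shows "integrable lborel (\<lambda>x. f (t + c *\<^sub>R x))"
proof -
  have [measurable]: "f \<in> borel_measurable borel" using f by auto
  show ?thesis
    using f c nn_integral_affine[of "\<lambda>x. ennreal (norm (f x))" c t]
    by (auto simp: integrable_iff_bounded ennreal_mult_less_top)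
qed

lemma integral_affine:
  fixes f :: "'a::euclidean_space \<Rightarrow> 'b::{banach, second_countable_topology}"
  assumes [measurable]: "f \<in> borel_measurable borel" and c: "c \<noteq> 0"
  shows "(\<integral>x. f x \<partial>lborel) = (\<bar>c\<bar> ^ DIM('a)) *\<^sub>R (\<integral>x. f (t + c *\<^sub>R x) \<partial>lborel)"
  by (subst lborel_affine[OF c, of t])
     (simp add: integral_density integral_distr)

lemma sq_mass_affine:
  fixes f :: "'a::euclidean_space \<Rightarrow> complex"
  assumes [measurable]: "f \<in> borel_measurable borel" and "\<bar>c\<bar> = 1"
  shows "sq_mass (\<lambda>x. f (t + c *\<^sub>R x)) = sq_mass f"
  unfolding sq_mass_def using nn_integral_affine[of "\<lambda>x. ennreal ((cmod (f x))\<^sup>2)" c t] assms(2)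
  by auto

lemma L2_affine:
  assumes "f \<in> Lp_space 2" "\<bar>c\<bar> = 1"
  shows "(\<lambda>x. f (t + c *\<^sub>R x)) \<in> Lp_space 2"
  using assms L2_measurable[OF assms(1)] by (auto simp: L2_iff sq_mass_affine)

lemma Lp_norm_2_eqI: "sq_mass f = sq_mass g \<Longrightarrow> f \<in> Lp_space 2 \<Longrightarrow> g \<in> Lp_space 2 \<Longrightarrow> Lp_norm 2 f = Lp_norm 2 g"
  by (simp add: sq_mass_eq)

text \<open>Where the indicators differ, exactly one of \<open>x\<close> and \<open>x - h\<close>
  lies in \<open>A\<close>. If that point misses \<open>K\<close>, it is counted by
  \<open>A - K\<close>; otherwise the other point lies in \<open>U\<close> and is counted by
  \<open>U - A\<close>. Either point may take either role, whence the factors 2.\<close>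

lemma nn_integral_indicator_translate_le:
  fixes A K U :: "'a::euclidean_space set"
  assumes [measurable]: "A \<in> sets borel" "K \<in> sets borel" "U \<in> sets borel"
    and "K \<subseteq> A" "A \<subseteq> U" and h: "(\<lambda>x. x + h) ` K \<subseteq> U" "(\<lambda>x. x - h) ` K \<subseteq> U"
  shows "(\<integral>\<^sup>+x. ennreal \<bar>indicator A (x - h) - indicator A x\<bar> \<partial>lborel) \<le>
    2 * emeasure lborel (A - K) + 2 * emeasure lborel (U - A)"
proof -
  have *: "(\<integral>\<^sup>+x. indicator (A - K) (x - h) \<partial>lborel) = emeasure lborel (A - K)"
    using nn_integral_affine[of "indicator (A - K)" 1 "-h"] by (simp add: add.commute)
  have **: "(\<integral>\<^sup>+x. indicator (U - A) (x - h) \<partial>lborel) = emeasure lborel (U - A)"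
    using nn_integral_affine[of "indicator (U - A)" 1 "-h"] by (simp add: add.commute)
  have "(\<integral>\<^sup>+x. ennreal \<bar>indicator A (x - h) - indicator A x\<bar> \<partial>lborel) \<le>
    (\<integral>\<^sup>+x. ((indicator (A - K) (x - h) + indicator (A - K) x) + (indicator (U - A) (x - h) + indicator (U - A) x)) \<partial>lborel)"
  proof (intro nn_integral_mono)
    fix x :: 'a
    have "x \<in> U" if "x - h \<in> K" using that h(1) by (metis diff_add_cancel image_subset_iff)
    moreover have "x - h \<in> U" if "x \<in> K" using that h(2) by auto
    ultimately show "ennreal \<bar>indicator A (x - h) - indicator A x\<bar> \<le>
       ((indicator (A - K) (x - h) + indicator (A - K) x) + (indicator (U - A) (x - h) + indicator (U - A) x))"
      using assms(4,5) by (auto simp: indicator_def)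
  qed
  also have "\<dots> = 2 * emeasure lborel (A - K) + 2 * emeasure lborel (U - A)"
    by (simp add: nn_integral_add * ** mult_2)
  finally show ?thesis .
qed

lemma ennreal_tendsto_0I:
  fixes f :: "'b \<Rightarrow> ennreal"
  assumes "\<And>e. e > (0::real) \<Longrightarrow> \<forall>\<^sub>F n in F. f n \<le> ennreal e"
  shows "(f \<longlongrightarrow> 0) F"
proof (rule order_tendstoI)
  fix a :: ennreal assume "0 < a"
  then obtain b where b: "0 < b" "b < a" using dense by blast
  define e where "e = enn2real b"
  have "b < top" using b(2) top_greatest[of a] by (rule less_le_trans)
  then have "b = ennreal e" by (simp add: e_def)
  with b have e: "0 < e" "ennreal e < a" by (auto simp: ennreal_less_zero_iff)
  from assms[OF e(1)] show "\<forall>\<^sub>F n in F. f n < a"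
    by eventually_elim (use e in auto)
qed simp

text \<open>A small shift keeps a compact inner approximation inside an open outer one, so only the
  two thin differences contribute.\<close>

lemma L1_translation_indicator:
  fixes A :: "'a::euclidean_space set"
  assumes A[measurable]: "A \<in> sets borel" and fin: "emeasure lborel A < \<infinity>" and h: "h \<longlonglongrightarrow> 0"
  shows "(\<lambda>n. \<integral>\<^sup>+x. ennreal \<bar>indicator A (x - h n) - indicator A x\<bar> \<partial>lborel) \<longlonglongrightarrow> 0"
proof (rule ennreal_tendsto_0I)
  fix e :: real assume e: "e > 0"
  obtain U where U: "open U" "A \<subseteq> U" "emeasure lborel (U - A) < ennreal (e/8)"
    using outer_regular_lborel[OF A, of "e/8"] e by auto
  \<comment> \<open>Inner approximation by a closed set, read off from outer regularity of the
    complement.\<close>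
  obtain C where C: "closed C" "C \<subseteq> A" "emeasure lborel (A - C) < ennreal (e/8)"
  proof -
    have "- A \<in> sets borel" using A by auto
    then obtain V where "open V" "- A \<subseteq> V" "emeasure lborel (V - (- A)) < ennreal (e/8)"
      using outer_regular_lborel[of "-A" "e/8"] e by auto
    moreover have "V - (- A) = A - (- V)" by auto
    ultimately show thesis by (intro that[of "- V"]) auto
  qed
  have [measurable]: "C \<in> sets borel" "U \<in> sets borel" using C U by auto
  \<comment> \<open>Intersecting \<open>C\<close> with a large ball makes it compact; the finite
    measure of \<open>A\<close> gives continuity from above for what is cut off.\<close>
  have "(\<lambda>n. emeasure lborel (C - cball 0 (real n))) \<longlonglongrightarrow> emeasure lborel (\<Inter>n. C - cball 0 (real n))"
  proof (rule Lim_emeasure_decseq)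
    show "decseq (\<lambda>n. C - cball 0 (real n))" by (auto simp: decseq_def)
    show "emeasure lborel (C - cball 0 (real n)) \<noteq> \<infinity>" for n
    proof -
      have "emeasure lborel (C - cball 0 (real n)) \<le> emeasure lborel A"
        using C by (intro emeasure_mono) auto
      then show ?thesis using fin by (auto simp: top_unique)
    qed
  qed auto
  moreover have "(\<Inter>n. C - cball 0 (real n)) = {}"
    by (auto intro: real_arch_simple)
  ultimately have "(\<lambda>n. emeasure lborel (C - cball 0 (real n))) \<longlonglongrightarrow> 0"
    by (simp only: emeasure_empty)
  then have "\<forall>\<^sub>F n in sequentially. emeasure lborel (C - cball 0 (real n)) < ennreal (e/8)"
    using e by (intro order_tendstoD) auto
  then obtain n where n: "emeasure lborel (C - cball 0 (real n)) < ennreal (e/8)"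
    by (auto simp: eventually_sequentially)
  define K where "K = C \<inter> cball 0 (real n)"
  have K: "compact K" "K \<subseteq> A" using C by (auto simp: K_def intro: closed_Int_compact)
  then have [measurable]: "K \<in> sets borel" by (simp add: compact_imp_closed)
  have AK: "emeasure lborel (A - K) \<le> ennreal (e/4)"
  proof -
    have "emeasure lborel (A - K) \<le> emeasure lborel ((A - C) \<union> (C - cball 0 (real n)))"
      by (intro emeasure_mono) (auto simp: K_def)
    also have "\<dots> \<le> emeasure lborel (A - C) + emeasure lborel (C - cball 0 (real n))"
      by (intro emeasure_subadditive) auto
    also have "\<dots> \<le> ennreal (e/8) + ennreal (e/8)"
      using C n by (intro add_mono) auto
    also have "\<dots> = ennreal (e/4)" using e by (simp add: ennreal_plus[symmetric] del: ennreal_plus)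
    finally show ?thesis .
  qed
  obtain d where d: "d > 0" "(\<Union>x\<in>K. ball x d) \<subseteq> U"
    using compact_subset_open_imp_ball_epsilon_subset[of K U] K U by auto
  have "\<forall>\<^sub>F n in sequentially. norm (h n) < d"
    using h d(1) by (auto simp: tendsto_iff)
  then show "\<forall>\<^sub>F n in sequentially. (\<integral>\<^sup>+x. ennreal \<bar>indicator A (x - h n) - indicator A x\<bar> \<partial>lborel) \<le> ennreal e"
  proof eventually_elim
    case (elim n)
    have "(\<integral>\<^sup>+x. ennreal \<bar>indicator A (x - h n) - indicator A x\<bar> \<partial>lborel) \<le> 2 * emeasure lborel (A - K) + 2 * emeasure lborel (U - A)"
    proof (rule nn_integral_indicator_translate_le)
      have "y \<in> U" if "x \<in> K" "norm (x - y) < d" for x y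
        using d(2) that by (auto simp: dist_norm subset_iff)
      from this[of _ "_ + h n"] this[of _ "_ - h n"] elim
      show "(\<lambda>x. x + h n) ` K \<subseteq> U" "(\<lambda>x. x - h n) ` K \<subseteq> U"
        by auto
    qed (use K U in auto)
    also have "\<dots> \<le> 2 * ennreal (e/4) + 2 * ennreal (e/8)"
      using AK U by (intro add_mono mult_left_mono) auto
    also have "\<dots> = ennreal ((e/4 + e/4) + (e/8 + e/8))"
      using e by (simp only: mult_2) (simp add: ennreal_plus[symmetric] del: ennreal_plus)
    also have "\<dots> \<le> ennreal e" using e by (intro ennreal_leI) auto
    finally show ?case .
  qed
qed

lemma L1_translation_continuous:
  fixes f :: "'a::euclidean_space \<Rightarrow> complex"
  assumes "integrable lborel f" and h: "h \<longlonglongrightarrow> 0"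
  shows "(\<lambda>n. \<integral>\<^sup>+x. ennreal (cmod (f (x - h n) - f x)) \<partial>lborel) \<longlonglongrightarrow> 0"
  using assms(1)
proof (induct rule: integrable_induct)
  case (base A c)
  have [measurable]: "A \<in> sets borel" using base by simp
  have "(\<lambda>n. ennreal (cmod c) * (\<integral>\<^sup>+x. ennreal \<bar>indicator A (x - h n) - indicator A x\<bar> \<partial>lborel)) \<longlonglongrightarrow> ennreal (cmod c) * 0"
    using base by (intro ennreal_tendsto_cmult L1_translation_indicator h) auto
  moreover have "(\<integral>\<^sup>+x. ennreal (cmod (indicat_real A (x - h n) *\<^sub>R c - indicat_real A x *\<^sub>R c)) \<partial>lborel) =
     ennreal (cmod c) * (\<integral>\<^sup>+x. ennreal \<bar>indicator A (x - h n) - indicator A x\<bar> \<partial>lborel)" for n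
    by (subst nn_integral_cmult[symmetric])
       (auto simp: scaleR_diff_left[symmetric] ennreal_mult[symmetric] mult.commute simp del: scaleR_diff_left)
  ultimately show ?case by simp
next
  case (add f g)
  have [measurable]: "f \<in> borel_measurable borel" "g \<in> borel_measurable borel" using add by auto
  show ?case
  proof (rule tendsto_sandwich[OF _ _ tendsto_const])
    show "(\<lambda>n. (\<integral>\<^sup>+x. ennreal (cmod (f (x - h n) - f x)) \<partial>lborel) + (\<integral>\<^sup>+x. ennreal (cmod (g (x - h n) - g x)) \<partial>lborel)) \<longlonglongrightarrow> 0"
      using tendsto_add[OF add(2,4)] by simp
    have "(\<integral>\<^sup>+x. ennreal (cmod (f (x - h n) + g (x - h n) - (f x + g x))) \<partial>lborel) \<le>
      (\<integral>\<^sup>+x. ennreal (cmod (f (x - h n) - f x)) \<partial>lborel) + (\<integral>\<^sup>+x. ennreal (cmod (g (x - h n) - g x)) \<partial>lborel)" for n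
      by (subst nn_integral_add[symmetric])
         (auto intro!: nn_integral_mono simp: ennreal_plus[symmetric] norm_diff_triangle_ineq simp del: ennreal_plus)
    then show "\<forall>\<^sub>F n in sequentially. (\<integral>\<^sup>+x. ennreal (cmod (f (x - h n) + g (x - h n) - (f x + g x))) \<partial>lborel) \<le>
      (\<integral>\<^sup>+x. ennreal (cmod (f (x - h n) - f x)) \<partial>lborel) + (\<integral>\<^sup>+x. ennreal (cmod (g (x - h n) - g x)) \<partial>lborel)"
      by auto
  qed auto
next
  case (lim f s)
  have [measurable]: "f \<in> borel_measurable borel" "\<And>i. s i \<in> borel_measurable borel" using lim by auto
  have conv: "(\<lambda>i. \<integral>\<^sup>+x. ennreal (cmod (s i x - f x)) \<partial>lborel) \<longlonglongrightarrow> 0"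
  proof -
    have "(\<lambda>i. \<integral>\<^sup>+x. ennreal (cmod (s i x - f x)) \<partial>lborel) \<longlonglongrightarrow> (\<integral>\<^sup>+x. ennreal (cmod (f x - f x)) \<partial>lborel)"
    \<comment> \<open>The induction principle supplies approximants with
      \<open>cmod (s i x) \<le> 2 * cmod (f x)\<close>, hence the factor 3 for the
      difference.\<close>
    proof (rule nn_integral_dominated_convergence[where w="\<lambda>x. ennreal (3 * cmod (f x))"])
      show "(\<integral>\<^sup>+x. ennreal (3 * cmod (f x)) \<partial>lborel) < \<infinity>"
        using lim(5) nn_integral_eq_integral[of lborel "\<lambda>x. 3 * cmod (f x)"] by simp
      show "AE x in lborel. ennreal (cmod (s i x - f x)) \<le> ennreal (3 * cmod (f x))" for i
      proof (intro AE_I2 ennreal_leI)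
        fix x show "cmod (s i x - f x) \<le> 3 * cmod (f x)"
          using lim(4)[of x i] norm_triangle_ineq4[of "s i x" "f x"] by simp
      qed
      show "AE x in lborel. (\<lambda>i. ennreal (cmod (s i x - f x))) \<longlonglongrightarrow> ennreal (cmod (f x - f x))"
        using lim(3) by (intro AE_I2 tendsto_intros tendsto_ennrealI) auto
    qed auto
    then show ?thesis by simp
  qed
  show ?case
  proof (rule ennreal_tendsto_0I)
    fix e :: real assume e: "e > 0"
    then have "\<forall>\<^sub>F i in sequentially. (\<integral>\<^sup>+x. ennreal (cmod (s i x - f x)) \<partial>lborel) < ennreal (e/3)"
      using conv by (intro order_tendstoD) auto
    then obtain i where i: "(\<integral>\<^sup>+x. ennreal (cmod (s i x - f x)) \<partial>lborel) < ennreal (e/3)"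
      by (auto simp: eventually_sequentially)
    have "\<forall>\<^sub>F n in sequentially. (\<integral>\<^sup>+x. ennreal (cmod (s i (x - h n) - s i x)) \<partial>lborel) < ennreal (e/3)"
      using lim(2)[of i] e by (intro order_tendstoD) auto
    then show "\<forall>\<^sub>F n in sequentially. (\<integral>\<^sup>+x. ennreal (cmod (f (x - h n) - f x)) \<partial>lborel) \<le> ennreal e"
    proof eventually_elim
      case (elim n)
      have *: "(\<integral>\<^sup>+x. ennreal (cmod (s i (x - h n) - f (x - h n))) \<partial>lborel) = (\<integral>\<^sup>+x. ennreal (cmod (s i x - f x)) \<partial>lborel)"
        using nn_integral_affine[of "\<lambda>x. ennreal (cmod (s i x - f x))" 1 "- h n"] by (simp add: add.commute)
      have "(\<integral>\<^sup>+x. ennreal (cmod (f (x - h n) - f x)) \<partial>lborel) \<le>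
        (\<integral>\<^sup>+x. (ennreal (cmod (s i (x - h n) - f (x - h n))) + ennreal (cmod (s i (x - h n) - s i x)) + ennreal (cmod (s i x - f x))) \<partial>lborel)"
      proof (intro nn_integral_mono)
        fix x
        have "cmod (f (x - h n) - f x) \<le> cmod (s i (x - h n) - f (x - h n)) + cmod (s i (x - h n) - s i x) + cmod (s i x - f x)"
          using norm_triangle_ineq4[of "s i (x - h n) - f x" "s i (x - h n) - f (x - h n)"]
             norm_triangle_ineq[of "s i (x - h n) - s i x" "s i x - f x"] by simp
        then show "ennreal (cmod (f (x - h n) - f x)) \<le> ennreal (cmod (s i (x - h n) - f (x - h n))) + ennreal (cmod (s i (x - h n) - s i x)) + ennreal (cmod (s i x - f x))"
          by (simp add: ennreal_plus[symmetric] del: ennreal_plus)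
      qed
      also have "\<dots> = (\<integral>\<^sup>+x. ennreal (cmod (s i x - f x)) \<partial>lborel) + (\<integral>\<^sup>+x. ennreal (cmod (s i (x - h n) - s i x)) \<partial>lborel)
          + (\<integral>\<^sup>+x. ennreal (cmod (s i x - f x)) \<partial>lborel)"
        by (simp add: nn_integral_add *)
      also have "\<dots> \<le> ennreal (e/3) + ennreal (e/3) + ennreal (e/3)"
        using i elim by (intro add_mono) auto
      also have "\<dots> = ennreal e" using e by (simp add: ennreal_plus[symmetric] del: ennreal_plus)
      finally show ?case .
    qed
  qed
qed

section \<open>The Fourier transform of integrable functions\<close>

text \<open>This is the characteristic function of the standard normal law at \<open>- a\<close>,
  the normalizing factor being multiplied back; the sign comes from the kernel of the
  transform.\<close>

lemma gaussian_char_1d: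
  fixes a :: real
  shows "integrable lborel (\<lambda>u. exp (- \<i> * of_real (u * a)) * complex_of_real (exp (- u\<^sup>2 / 2)))"
    and "(\<integral>u. exp (- \<i> * of_real (u * a)) * complex_of_real (exp (- u\<^sup>2 / 2)) \<partial>lborel) =
      of_real (sqrt (2 * pi) * exp (- a\<^sup>2 / 2))"
proof -
  have eq: "exp (- \<i> * of_real (u * a)) * complex_of_real (exp (- u\<^sup>2 / 2)) =
      of_real (sqrt (2 * pi)) * (std_normal_density u *\<^sub>R iexp (- a * u))" for u
    by (simp add: std_normal_density_def scaleR_conv_of_real mult.commute)
  have int: "integrable lborel (\<lambda>u. std_normal_density u *\<^sub>R iexp (- a * u))"
  proof (rule Bochner_Integration.integrable_bound)
    show "integrable lborel std_normal_density" by simp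
    show "(\<lambda>u. std_normal_density u *\<^sub>R iexp (- a * u)) \<in> borel_measurable lborel" by measurable
    show "AE u in lborel. norm (std_normal_density u *\<^sub>R iexp (- a * u)) \<le> norm (std_normal_density u)"
      by (intro AE_I2) (simp del: of_real_mult)
  qed
  show "integrable lborel (\<lambda>u. exp (- \<i> * of_real (u * a)) * complex_of_real (exp (- u\<^sup>2 / 2)))"
    unfolding eq by (intro integrable_mult_right int)
  have "(\<integral>u. std_normal_density u *\<^sub>R iexp (- a * u) \<partial>lborel) = char std_normal_distribution (- a)"
    unfolding char_def by (subst integral_density) auto
  also have "\<dots> = of_real (exp (- a\<^sup>2 / 2))"
    by (simp add: char_std_normal_distribution)
  finally have X: "(\<integral>u. std_normal_density u *\<^sub>R iexp (- a * u) \<partial>lborel) = of_real (exp (- a\<^sup>2 / 2))" .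
  show "(\<integral>u. exp (- \<i> * of_real (u * a)) * complex_of_real (exp (- u\<^sup>2 / 2)) \<partial>lborel) =
      of_real (sqrt (2 * pi) * exp (- a\<^sup>2 / 2))"
    unfolding eq integral_mult_right_zero X by simp
qed

text \<open>\<open>lborel\<close> is the image of a product measure over \<open>Basis\<close>, and
  both the character and the Gaussian factor along the coordinates, so one-dimensional integrals
  multiply.\<close>

lemma gaussian_char:
  fixes \<xi> :: "'a::euclidean_space"
  shows "integrable lborel (\<lambda>x::'a. exp (- \<i> * of_real (x \<bullet> \<xi>)) * complex_of_real (exp (- (norm x)\<^sup>2 / 2)))" (is ?int)
    and "(\<integral>x. exp (- \<i> * of_real (x \<bullet> \<xi>)) * complex_of_real (exp (- (norm x)\<^sup>2 / 2)) \<partial>lborel) =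
      of_real ((2 * pi) powr (real DIM('a) / 2) * exp (- (norm \<xi>)\<^sup>2 / 2))" (is ?eq)
proof -
  interpret product_sigma_finite "\<lambda>_::'a. lborel :: real measure" ..
  define g where "g b u = exp (- \<i> * of_real (u * (\<xi> \<bullet> b))) * complex_of_real (exp (- u\<^sup>2 / 2))" for b and u :: real
  define T where "T f = (\<Sum>b\<in>Basis. f b *\<^sub>R b)" for f :: "'a \<Rightarrow> real"
  have T[measurable]: "T \<in> (\<Pi>\<^sub>M b\<in>Basis. lborel) \<rightarrow>\<^sub>M borel"
    unfolding T_def by measurable
  have lb: "lborel = distr (\<Pi>\<^sub>M b\<in>Basis. lborel) borel T"
    unfolding T_def by (rule lborel_eq)
  let ?h = "\<lambda>x::'a. exp (- \<i> * of_real (x \<bullet> \<xi>)) * complex_of_real (exp (- (norm x)\<^sup>2 / 2))"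
  have hT: "?h (T f) = (\<Prod>b\<in>Basis. g b (f b))" for f
  proof -
    have 1: "T f \<bullet> \<xi> = (\<Sum>b\<in>Basis. f b * (\<xi> \<bullet> b))"
      by (simp add: T_def inner_sum_left inner_commute[of \<xi>])
    have "T f \<bullet> b = f b" if "b \<in> Basis" for b
      using that by (simp add: T_def)
    then have 2: "(norm (T f))\<^sup>2 = (\<Sum>b\<in>Basis. (f b)\<^sup>2)"
      by (simp add: norm_eq_sqrt_inner euclidean_inner[of "T f" "T f"] sum_nonneg power2_eq_square[symmetric])
    show ?thesis
      unfolding 1 2 g_def prod.distrib
      by (simp add: exp_sum[symmetric] sum_distrib_left sum_negf[symmetric] sum_divide_distrib of_real_prod[symmetric] del: of_real_prod)
  qed
  have m: "?h \<in> borel_measurable borel" by measurable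
  have gi: "integrable lborel (g b)" for b
    unfolding g_def by (rule gaussian_char_1d)
  show ?int
    by (subst lb, subst integrable_distr_eq[OF T m], unfold hT) (intro product_integrable_prod gi finite_Basis)
  have "integral\<^sup>L lborel ?h = (\<integral>f. (\<Prod>b\<in>Basis. g b (f b)) \<partial>(\<Pi>\<^sub>M b\<in>Basis. lborel))"
    by (subst lb, subst integral_distr[OF T m]) (simp only: hT)
  also have "\<dots> = (\<Prod>b\<in>Basis. integral\<^sup>L lborel (g b))"
    by (intro product_integral_prod gi finite_Basis)
  also have "\<dots> = (\<Prod>b\<in>Basis. of_real (sqrt (2 * pi) * exp (- (\<xi> \<bullet> b)\<^sup>2 / 2)))"
    unfolding g_def gaussian_char_1d ..
  also have "\<dots> = of_real ((sqrt (2 * pi)) ^ DIM('a) * exp (\<Sum>b\<in>(Basis::'a set). - (\<xi> \<bullet> b)\<^sup>2 / 2))"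
    by (simp add: prod.distrib exp_sum of_real_prod[symmetric] del: of_real_prod of_real_mult)
  also have "(\<Sum>b\<in>(Basis::'a set). - (\<xi> \<bullet> b)\<^sup>2 / 2) = - (norm \<xi>)\<^sup>2 / 2"
    by (simp add: norm_eq_sqrt_inner euclidean_inner[of \<xi> \<xi>] sum_nonneg power2_eq_square[symmetric] sum_negf sum_divide_distrib[symmetric])
  also have "(sqrt (2 * pi)) ^ DIM('a) = (2 * pi) powr (real DIM('a) / 2)"
    by (simp add: powr_half_sqrt[symmetric] powr_powr powr_realpow[symmetric])
  finally show ?eq .
qed

section \<open>Fourier integrals: sup bound, linearity, exchange formula\<close>

lemma fourier_integral_measurable [measurable]:
  assumes [measurable]: "f \<in> borel_measurable borel"
  shows "fourier_integral f \<in> borel_measurable borel"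
  unfolding fourier_integral_def[abs_def] by measurable

lemma fourier_integrand_integrable:
  assumes "integrable lborel f"
  shows "integrable lborel (\<lambda>x. exp (- \<i> * of_real (x \<bullet> \<xi>)) * f x)"
proof (rule Bochner_Integration.integrable_bound[OF assms])
  have [measurable]: "f \<in> borel_measurable borel" using assms by auto
  show "(\<lambda>x. exp (- \<i> * of_real (x \<bullet> \<xi>)) * f x) \<in> borel_measurable lborel" by measurable
qed (auto simp: norm_mult)

text \<open>Besides normalizing the transform, it is its bound from L1 to the sup norm, and its
  inverse is the mass of \<open>gaussian\<close>. The type argument carries the dimension.\<close>

definition fourier_const :: "'a::euclidean_space itself \<Rightarrow> real" where
  "fourier_const _ = (2 * pi) powr (- real DIM('a) / 2)"

lemma fourier_const_pos [simp]: "0 < fourier_const TYPE('a::euclidean_space)"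
  unfolding fourier_const_def by simp

lemma fourier_integral_bound:
  fixes f :: "'a::euclidean_space \<Rightarrow> complex"
  shows "cmod (fourier_integral f \<xi>) \<le> fourier_const TYPE('a) * (\<integral>x. cmod (f x) \<partial>lborel)"
proof -
  have "cmod (\<integral>x. exp (- \<i> * of_real (x \<bullet> \<xi>)) * f x \<partial>lborel) \<le> (\<integral>x. cmod (exp (- \<i> * of_real (x \<bullet> \<xi>)) * f x) \<partial>lborel)"
    by (rule integral_norm_bound)
  also have "\<dots> = (\<integral>x. cmod (f x) \<partial>lborel)"
    by (simp add: norm_mult)
  finally show ?thesis
    unfolding fourier_integral_def fourier_const_def by (simp add: norm_mult mult_left_mono)
qed

lemma fourier_integral_diff:
  assumes "integrable lborel f" "integrable lborel g"
  shows "fourier_integral (\<lambda>x. f x - g x) \<xi> = fourier_integral f \<xi> - fourier_integral g \<xi>"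
  using fourier_integrand_integrable[OF assms(1), of \<xi>] fourier_integrand_integrable[OF assms(2), of \<xi>]
  unfolding fourier_integral_def by (simp add: right_diff_distrib)

lemma integrable_lborel_tensor:
  fixes f :: "'a::euclidean_space \<Rightarrow> complex" and g :: "'b::euclidean_space \<Rightarrow> complex"
  assumes f: "integrable lborel f" and g: "integrable lborel g"
  shows "integrable (lborel \<Otimes>\<^sub>M lborel) (\<lambda>(x, y). f x * g y)"
proof (rule lborel_pair.Fubini_integrable)
  have [measurable]: "f \<in> borel_measurable borel" "g \<in> borel_measurable borel" using f g by auto
  show "(\<lambda>(x, y). f x * g y) \<in> borel_measurable (lborel \<Otimes>\<^sub>M lborel)" by measurable
  show "integrable lborel (\<lambda>x. \<integral>y. norm (case (x, y) of (x, y) \<Rightarrow> f x * g y) \<partial>lborel)"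
    using f g by (simp add: norm_mult)
  show "AE x in lborel. integrable lborel (\<lambda>y. case (x, y) of (x, y) \<Rightarrow> f x * g y)"
    using g by simp
qed

text \<open>The kernel is symmetric in the two variables, so Fubini moves the transform to the other
  factor. It is used with a Gaussian for Plancherel and on truncations for surjectivity.\<close>

lemma fourier_multiplication_formula:
  fixes f g :: "'a::euclidean_space \<Rightarrow> complex"
  assumes f: "integrable lborel f" and g: "integrable lborel g"
  shows "(\<integral>\<xi>. fourier_integral f \<xi> * g \<xi> \<partial>lborel) = (\<integral>x. f x * fourier_integral g x \<partial>lborel)"
proof -
  have [measurable]: "f \<in> borel_measurable borel" "g \<in> borel_measurable borel" using f g by auto
  define k where "k x \<xi> = exp (- \<i> * of_real (x \<bullet> \<xi>)) * f x * g \<xi>" for x \<xi> :: 'a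
  have int: "integrable (lborel \<Otimes>\<^sub>M lborel) (case_prod k)"
  proof (rule Bochner_Integration.integrable_bound[OF integrable_lborel_tensor[OF f g]])
    show "case_prod k \<in> borel_measurable (lborel \<Otimes>\<^sub>M lborel)" unfolding k_def by measurable
  qed (auto simp: k_def norm_mult)
  let ?c = "complex_of_real ((2 * pi) powr (- real DIM('a) / 2))"
  have "(\<integral>\<xi>. fourier_integral f \<xi> * g \<xi> \<partial>lborel) = (\<integral>\<xi>. ?c * (\<integral>x. k x \<xi> \<partial>lborel) \<partial>lborel)"
    unfolding fourier_integral_def k_def by (simp only: integral_mult_left_zero mult.assoc[of ?c])
  also have "\<dots> = ?c * (\<integral>\<xi>. (\<integral>x. k x \<xi> \<partial>lborel) \<partial>lborel)"
    by simp
  also have "\<dots> = ?c * (\<integral>x. (\<integral>\<xi>. k x \<xi> \<partial>lborel) \<partial>lborel)"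
    by (simp add: lborel_pair.Fubini_integral[OF int])
  also have "\<dots> = (\<integral>x. ?c * (\<integral>\<xi>. k x \<xi> \<partial>lborel) \<partial>lborel)"
    by simp
  also have "\<dots> = (\<integral>x. f x * fourier_integral g x \<partial>lborel)"
  proof (rule Bochner_Integration.integral_cong[OF refl])
    fix x
    have "(\<integral>\<xi>. k x \<xi> \<partial>lborel) = (\<integral>\<xi>. f x * (exp (- \<i> * of_real (\<xi> \<bullet> x)) * g \<xi>) \<partial>lborel)"
      unfolding k_def by (intro Bochner_Integration.integral_cong refl) (simp add: inner_commute)
    then show "?c * (\<integral>\<xi>. k x \<xi> \<partial>lborel) = f x * fourier_integral g x"
      unfolding fourier_integral_def by simp
  qed
  finally show ?thesis .
qed

section \<open>Autocorrelation\<close>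

definition autocorr :: "('a::euclidean_space \<Rightarrow> complex) \<Rightarrow> 'a \<Rightarrow> complex" where
  "autocorr f h = (\<integral>x. f x * cnj (f (x - h)) \<partial>lborel)"

lemma cnj_measurable [measurable]: "cnj \<in> borel_measurable borel"
  by (intro borel_measurable_continuous_onI continuous_intros)

lemma autocorr_integrable_prod:
  assumes f: "integrable lborel f"
  shows "integrable (lborel \<Otimes>\<^sub>M lborel) (\<lambda>(x, h). f x * cnj (f (x - h)))"
proof (rule lborel_pair.Fubini_integrable)
  have [measurable]: "f \<in> borel_measurable borel" using f by auto
  show "(\<lambda>(x, h). f x * cnj (f (x - h))) \<in> borel_measurable (lborel \<Otimes>\<^sub>M lborel)" by measurable
  have int: "integrable lborel (\<lambda>h. f (x - h))" for x
    using integrable_affine[OF f, of "-1" x] by simp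
  have "(\<integral>h. cmod (f (x - h)) \<partial>lborel) = (\<integral>h. cmod (f h) \<partial>lborel)" for x
    using integral_affine[of "\<lambda>x. cmod (f x)" "-1" x] by simp
  then show "integrable lborel (\<lambda>x. \<integral>h. norm (case (x, h) of (x, h) \<Rightarrow> f x * cnj (f (x - h))) \<partial>lborel)"
    using f by (simp add: norm_mult)
  show "AE x in lborel. integrable lborel (\<lambda>h. case (x, h) of (x, h) \<Rightarrow> f x * cnj (f (x - h)))"
    using integrable_cnj[OF int] by simp
qed

lemma autocorr_integrable:
  assumes f: "integrable lborel f"
  shows "integrable lborel (autocorr f)"
  using lborel_pair.integrable_snd[of "\<lambda>x h. f x * cnj (f (x - h))"] autocorr_integrable_prod[OF f]
  unfolding autocorr_def by simp

text \<open>After the substitution y = x - h the character splits into one in x and a conjugate one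
  in y, and the double integral becomes \<open>I * cnj I\<close>. The squared modulus contains the
  normalizing factor twice, the transform once; hence the extra constant.\<close>

lemma fourier_autocorr:
  fixes f :: "'a::euclidean_space \<Rightarrow> complex"
  assumes f: "integrable lborel f"
  shows "of_real (fourier_const TYPE('a)) * fourier_integral (autocorr f) \<xi> = of_real ((cmod (fourier_integral f \<xi>))\<^sup>2)"
proof -
  have [measurable]: "f \<in> borel_measurable borel" using f by auto
  define c where "c = complex_of_real (fourier_const TYPE('a))"
  define I where "I = (\<integral>x. exp (- \<i> * of_real (x \<bullet> \<xi>)) * f x \<partial>lborel)"
  define k where "k x h = exp (- \<i> * of_real (h \<bullet> \<xi>)) * (f x * cnj (f (x - h)))" for x h :: 'a
  have int: "integrable (lborel \<Otimes>\<^sub>M lborel) (case_prod k)"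
  proof (rule Bochner_Integration.integrable_bound[OF autocorr_integrable_prod[OF f]])
    show "case_prod k \<in> borel_measurable (lborel \<Otimes>\<^sub>M lborel)" unfolding k_def by measurable
  qed (auto simp: k_def norm_mult)
  have inner: "(\<integral>h. k x h \<partial>lborel) = (exp (- \<i> * of_real (x \<bullet> \<xi>)) * f x) * cnj I" for x
  proof -
    have "(\<integral>h. k x h \<partial>lborel) = (\<integral>y. k x (x - y) \<partial>lborel)"
      using integral_affine[of "k x" "-1" x] unfolding k_def by simp
    also have "\<dots> = (\<integral>y. (exp (- \<i> * of_real (x \<bullet> \<xi>)) * f x) * cnj (exp (- \<i> * of_real (y \<bullet> \<xi>)) * f y) \<partial>lborel)"
      unfolding k_def
      by (intro Bochner_Integration.integral_cong refl)
         (simp add: inner_diff_left exp_cnj exp_diff exp_minus field_simps)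
    also have "\<dots> = (exp (- \<i> * of_real (x \<bullet> \<xi>)) * f x) * cnj I"
      unfolding I_def Bochner_Integration.integral_cnj[symmetric] by (rule integral_mult_right_zero)
    finally show ?thesis .
  qed
  have "fourier_integral (autocorr f) \<xi> = c * (\<integral>h. (\<integral>x. k x h \<partial>lborel) \<partial>lborel)"
    unfolding fourier_integral_def autocorr_def k_def c_def fourier_const_def by simp
  also have "\<dots> = c * (\<integral>x. (\<integral>h. k x h \<partial>lborel) \<partial>lborel)"
    by (simp add: lborel_pair.Fubini_integral[OF int])
  also have "\<dots> = c * (I * cnj I)"
    unfolding inner I_def by simp
  finally have "c * fourier_integral (autocorr f) \<xi> = (c * I) * cnj (c * I)"
    by (simp add: c_def)
  also have "c * I = fourier_integral f \<xi>"
    unfolding c_def I_def fourier_const_def fourier_integral_def ..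
  finally show ?thesis
    unfolding c_def by (simp only: complex_norm_square)
qed

lemma autocorr_bound:
  assumes f: "f \<in> Lp_space 2"
  shows "cmod (autocorr f h) \<le> (Lp_norm 2 f)\<^sup>2"
proof -
  have t: "(\<lambda>x. f (x - h)) \<in> Lp_space 2"
    using L2_affine[OF f, of 1 "-h"] by (simp add: add.commute)
  have n: "Lp_norm 2 (\<lambda>x. cnj (f (x - h))) = Lp_norm 2 f"
  proof (rule Lp_norm_2_eqI)
    show "sq_mass (\<lambda>x. cnj (f (x - h))) = sq_mass f"
      using sq_mass_affine[OF L2_measurable[OF f], of 1 "-h"] by (simp add: sq_mass_def add.commute)
  qed (use f L2_cnj[OF t] in auto)
  show ?thesis
    using L2_Cauchy_Schwarz[OF f L2_cnj[OF t]] unfolding autocorr_def n by (simp add: power2_eq_square)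
qed

lemma autocorr_0: "f \<in> Lp_space 2 \<Longrightarrow> autocorr f 0 = of_real ((Lp_norm 2 f)\<^sup>2)"
proof -
  have "f x * cnj (f (x - 0)) = of_real ((cmod (f x))\<^sup>2)" for x
    by (simp only: diff_zero complex_norm_square)
  then show ?thesis
    unfolding autocorr_def by (simp only: integral_complex_of_real) (simp add: Lp_norm_2)
qed

section \<open>The Plancherel identity\<close>

lemma L2_dominated_null:
  assumes f: "f \<in> Lp_space 2" and u[measurable]: "\<And>n. u n \<in> borel_measurable borel"
    and dom: "\<And>n x. cmod (u n x) \<le> cmod (f x)" and lim: "\<And>x. (\<lambda>n. u n x) \<longlonglongrightarrow> 0"
  shows "(\<lambda>n. sq_mass (u n)) \<longlonglongrightarrow> 0"
proof -
  have [measurable]: "f \<in> borel_measurable borel" by (rule L2_measurable[OF f])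
  have "(\<lambda>n. \<integral>\<^sup>+x. ennreal ((cmod (u n x))\<^sup>2) \<partial>lborel) \<longlonglongrightarrow> (\<integral>\<^sup>+x. ennreal ((cmod 0)\<^sup>2) \<partial>(lborel::'a measure))"
  proof (rule nn_integral_dominated_convergence[where w="\<lambda>x. ennreal ((cmod (f x))\<^sup>2)"])
    show "(\<integral>\<^sup>+x. ennreal ((cmod (f x))\<^sup>2) \<partial>lborel) < \<infinity>"
      using L2_finite[OF f] by (simp add: sq_mass_def)
    show "AE x in lborel. ennreal ((cmod (u n x))\<^sup>2) \<le> ennreal ((cmod (f x))\<^sup>2)" for n
      by (intro AE_I2 ennreal_leI power_mono dom) auto
    show "AE x in lborel. (\<lambda>n. ennreal ((cmod (u n x))\<^sup>2)) \<longlonglongrightarrow> ennreal ((cmod 0)\<^sup>2)"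
      by (intro AE_I2 tendsto_ennrealI tendsto_intros lim)
  qed auto
  then show ?thesis by (simp add: sq_mass_def)
qed

text \<open>Translations are known to be continuous in L1 only. The part of \<open>f\<close> of
  height at most \<open>m\<close> is paired with that; the part above \<open>m\<close> has small L2
  norm and is treated by Cauchy-Schwarz, the translated difference having norm at most
  \<open>2 * Lp_norm 2 f\<close>.\<close>

lemma autocorr_continuous:
  fixes f :: "'a::euclidean_space \<Rightarrow> complex"
  assumes f: "f \<in> Lp_space 2" "integrable lborel f" and h: "h \<longlonglongrightarrow> 0"
  shows "(\<lambda>n. autocorr f (h n)) \<longlonglongrightarrow> autocorr f 0"
proof -
  note [measurable] = L2_measurable[OF f(1)]
  define g where "g n x = f (x - h n) - f x" for n x
  have t: "(\<lambda>x. f (x - h n)) \<in> Lp_space 2" for n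
    using L2_affine[OF f(1), of 1 "- h n"] by (simp add: add.commute)
  have tn: "Lp_norm 2 (\<lambda>x. f (x - h n)) = Lp_norm 2 f" for n
    using sq_mass_affine[OF L2_measurable[OF f(1)], of 1 "- h n"]
    by (intro Lp_norm_2_eqI t f) (simp add: add.commute)
  have g: "g n \<in> Lp_space 2" for n unfolding g_def by (intro L2_diff t f)
  have gn: "Lp_norm 2 (g n) \<le> 2 * Lp_norm 2 f" for n
    using L2_triangle[OF t[of n] L2_uminus[OF f(1)]] tn[of n] by (simp add: g_def Lp_norm_2)
  have gi: "integrable lborel (g n)" for n
    unfolding g_def using integrable_affine[OF f(2), of 1 "- h n"] f(2) by (auto simp: add.commute)
  have g1: "(\<lambda>n. \<integral>x. cmod (g n x) \<partial>lborel) \<longlonglongrightarrow> 0"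
  proof -
    have "(\<integral>\<^sup>+x. ennreal (cmod (g n x)) \<partial>lborel) = ennreal (\<integral>x. cmod (g n x) \<partial>lborel)" for n
      using gi[of n] by (intro nn_integral_eq_integral) auto
    then have "(\<lambda>n. ennreal (\<integral>x. cmod (g n x) \<partial>lborel)) \<longlonglongrightarrow> ennreal 0"
      using L1_translation_continuous[OF f(2) h] by (simp add: g_def)
    then show ?thesis by (subst (asm) tendsto_ennreal_iff) auto
  qed
  define w where "w m x = (if cmod (f x) > real m then f x else 0)" for m x
  have [measurable]: "w m \<in> borel_measurable borel" for m unfolding w_def[abs_def] by measurable
  have w: "w m \<in> Lp_space 2" for m
    by (rule L2_dominated[OF f(1)]) (auto simp: w_def)
  have "(\<lambda>m. sq_mass (w m)) \<longlonglongrightarrow> 0"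
  proof (rule L2_dominated_null[OF f(1)])
    show "(\<lambda>m. w m x) \<longlonglongrightarrow> 0" for x
    proof (rule tendsto_eventually)
      obtain k where "cmod (f x) \<le> real k" using real_arch_simple by blast
      then show "\<forall>\<^sub>F m in sequentially. w m x = 0"
        unfolding eventually_sequentially by (intro exI[of _ k]) (auto simp: w_def)
    qed
  qed (auto simp: w_def)
  then have w0: "(\<lambda>m. Lp_norm 2 (w m)) \<longlonglongrightarrow> 0"
    by (simp add: sq_mass_tendsto_iff w)
  have main: "cmod (autocorr f (h n) - autocorr f 0) \<le> real m * (\<integral>x. cmod (g n x) \<partial>lborel) + Lp_norm 2 (w m) * (2 * Lp_norm 2 f)" for m n
  proof -
    have "autocorr f (h n) - autocorr f 0 = (\<integral>x. f x * cnj (g n x) \<partial>lborel)"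
      unfolding autocorr_def g_def
      by (subst Bochner_Integration.integral_diff[symmetric])
         (auto intro!: L2_mult_integrable L2_cnj t f simp: right_diff_distrib)
    also have "cmod \<dots> \<le> (\<integral>x. cmod (f x * cnj (g n x)) \<partial>lborel)"
      by (rule integral_norm_bound)
    also have "\<dots> \<le> (\<integral>x. real m * cmod (g n x) + cmod (w m x) * cmod (g n x) \<partial>lborel)"
    proof (rule integral_mono)
      show "integrable lborel (\<lambda>x. cmod (f x * cnj (g n x)))"
        by (intro integrable_norm L2_mult_integrable L2_cnj f g)
      show "integrable lborel (\<lambda>x. real m * cmod (g n x) + cmod (w m x) * cmod (g n x))"
        using integrable_norm[OF L2_mult_integrable[OF w g]] integrable_norm[OF gi]
        by (auto simp: norm_mult)
      show "cmod (f x * cnj (g n x)) \<le> real m * cmod (g n x) + cmod (w m x) * cmod (g n x)" for x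
        by (auto simp: w_def norm_mult intro: mult_right_mono)
    qed
    also have "\<dots> = real m * (\<integral>x. cmod (g n x) \<partial>lborel) + (\<integral>x. cmod (w m x) * cmod (g n x) \<partial>lborel)"
      using integrable_norm[OF L2_mult_integrable[OF w g]] integrable_norm[OF gi]
      by (subst Bochner_Integration.integral_add) (auto simp: norm_mult)
    also have "(\<integral>x. cmod (w m x) * cmod (g n x) \<partial>lborel) \<le> Lp_norm 2 (w m) * Lp_norm 2 (g n)"
      by (rule L2_Cauchy_Schwarz_abs[OF w g])
    also have "\<dots> \<le> Lp_norm 2 (w m) * (2 * Lp_norm 2 f)"
      by (intro mult_left_mono gn) auto
    finally show ?thesis by simp
  qed
  show ?thesis
  proof (rule tendstoI)
    fix e :: real assume e: "e > 0"
    have "(\<lambda>m. Lp_norm 2 (w m) * (2 * Lp_norm 2 f)) \<longlonglongrightarrow> 0 * (2 * Lp_norm 2 f)"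
      by (intro tendsto_intros w0)
    then have "\<forall>\<^sub>F m in sequentially. Lp_norm 2 (w m) * (2 * Lp_norm 2 f) < e/2"
      using e by (intro order_tendstoD) auto
    then obtain m where m: "Lp_norm 2 (w m) * (2 * Lp_norm 2 f) < e/2"
      by (auto simp: eventually_sequentially)
    have "(\<lambda>n. real m * (\<integral>x. cmod (g n x) \<partial>lborel)) \<longlonglongrightarrow> real m * 0"
      by (intro tendsto_intros g1)
    then have "\<forall>\<^sub>F n in sequentially. real m * (\<integral>x. cmod (g n x) \<partial>lborel) < e/2"
      using e by (intro order_tendstoD) auto
    then show "\<forall>\<^sub>F n in sequentially. dist (autocorr f (h n)) (autocorr f 0) < e"
    proof eventually_elim
      case (elim n)
      then show ?case using main[of n m] m unfolding dist_norm by linarith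
    qed
  qed
qed

section \<open>Gaussian weights and Plancherel's identity\<close>

definition gaussian :: "'a::euclidean_space \<Rightarrow> real" where
  "gaussian x = exp (- (norm x)\<^sup>2 / 2)"

lemma gaussian_measurable [measurable]: "gaussian \<in> borel_measurable borel"
  unfolding gaussian_def[abs_def] by measurable

lemma gaussian_pos [simp]: "0 < gaussian x"
  by (simp add: gaussian_def)

lemma gaussian_integrable: "integrable lborel (\<lambda>x::'a::euclidean_space. complex_of_real (gaussian x))"
  using gaussian_char(1)[of "0::'a"] by (simp add: gaussian_def)

lemma gaussian_integral:
  "(\<integral>x. complex_of_real (gaussian (x::'a::euclidean_space)) \<partial>lborel) = of_real (1 / fourier_const TYPE('a))"
  using gaussian_char(2)[of "0::'a"] by (simp add: gaussian_def fourier_const_def powr_minus field_simps)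

text \<open>Widening the Gaussian concentrates its transform at the origin without changing the
  mass: an approximate identity, which picks out the value of the autocorrelation at 0.\<close>

lemma fourier_integral_gaussian_scaled:
  fixes x :: "'a::euclidean_space"
  assumes N: "N > 0"
  shows "fourier_integral (\<lambda>\<xi>. of_real (gaussian ((1/N) *\<^sub>R \<xi>))) x = of_real (N ^ DIM('a) * gaussian (N *\<^sub>R x))"
proof -
  let ?F = "\<lambda>\<xi>. exp (- \<i> * of_real (\<xi> \<bullet> x)) * complex_of_real (gaussian ((1/N) *\<^sub>R \<xi>))"
  have "(\<integral>\<xi>. ?F \<xi> \<partial>lborel) = (\<bar>N\<bar> ^ DIM('a)) *\<^sub>R (\<integral>\<xi>. ?F (0 + N *\<^sub>R \<xi>) \<partial>lborel)"
    using N by (intro integral_affine) auto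
  also have "(\<integral>\<xi>. ?F (0 + N *\<^sub>R \<xi>) \<partial>lborel) =
      (\<integral>\<xi>. exp (- \<i> * of_real (\<xi> \<bullet> (N *\<^sub>R x))) * complex_of_real (exp (- (norm \<xi>)\<^sup>2 / 2)) \<partial>lborel)"
    using N by (intro Bochner_Integration.integral_cong refl) (simp add: gaussian_def)
  also have "\<dots> = of_real ((2 * pi) powr (real DIM('a) / 2) * gaussian (N *\<^sub>R x))"
    unfolding gaussian_char gaussian_def ..
  finally show ?thesis
    using N unfolding fourier_integral_def by (simp add: powr_minus scaleR_conv_of_real field_simps)
qed

text \<open>The integral of the squared transform against a Gaussian of width \<open>N n\<close> has
  two limits: the whole mass by monotone convergence, and, through the exchange formula, the
  autocorrelation at 0 by dominated convergence.\<close>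

theorem Plancherel_L1_L2:
  fixes f :: "'a::euclidean_space \<Rightarrow> complex"
  assumes f: "f \<in> Lp_space 2" "integrable lborel f"
  shows "sq_mass (fourier_integral f) = sq_mass f"
proof -
  note [measurable] = L2_measurable[OF f(1)]
  define c where "c = fourier_const TYPE('a)"
  have c: "c > 0" by (simp add: c_def)
  define A where "A = autocorr f"
  have A: "integrable lborel A" unfolding A_def by (rule autocorr_integrable[OF f(2)])
  then have [measurable]: "A \<in> borel_measurable borel" by auto
  define N where "N n = real (Suc n)" for n
  have N: "N n > 0" for n by (simp add: N_def)
  define g where "g n \<xi> = gaussian ((1 / N n) *\<^sub>R \<xi>)" for n and \<xi> :: 'a
  have [measurable]: "g n \<in> borel_measurable borel" for n unfolding g_def by measurable
  have gi: "integrable lborel (\<lambda>\<xi>. complex_of_real (g n \<xi>))" for n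
    using integrable_affine[OF gaussian_integrable, of "1 / N n" 0] N[of n] unfolding g_def by simp
  have gir: "integrable lborel (g n)" for n
    using integrable_norm[OF gi[of n]] by (simp add: g_def[abs_def] abs_of_pos)
  \<comment> \<open>The substitution by \<open>1 / N n\<close> cancels the factor
    \<open>N n ^ DIM('a)\<close> and leaves a fixed Gaussian, so that only the argument of
    \<open>A\<close> still moves.\<close>
  have step: "(\<integral>\<xi>. fourier_integral A \<xi> * of_real (g n \<xi>) \<partial>lborel) = (\<integral>z. A ((1 / N n) *\<^sub>R z) * of_real (gaussian z) \<partial>lborel)" for n
  proof -
    have "(\<integral>\<xi>. fourier_integral A \<xi> * of_real (g n \<xi>) \<partial>lborel) =
       (\<integral>x. A x * of_real (N n ^ DIM('a) * gaussian (N n *\<^sub>R x)) \<partial>lborel)"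
      using fourier_multiplication_formula[OF A gi[of n]] fourier_integral_gaussian_scaled[OF N[of n], where 'a='a]
      by (simp add: g_def[abs_def])
    also have "\<dots> = (\<bar>1 / N n\<bar> ^ DIM('a)) *\<^sub>R (\<integral>z. A (0 + (1 / N n) *\<^sub>R z) * of_real (N n ^ DIM('a) * gaussian (N n *\<^sub>R (0 + (1 / N n) *\<^sub>R z))) \<partial>lborel)"
      using N[of n] by (intro integral_affine) auto
    also have "\<dots> = (\<bar>1 / N n\<bar> ^ DIM('a)) *\<^sub>R (\<integral>z. of_real (N n ^ DIM('a)) * (A ((1 / N n) *\<^sub>R z) * of_real (gaussian z)) \<partial>lborel)"
      using N[of n] by (intro arg_cong2[where f=scaleR] Bochner_Integration.integral_cong refl) simp
    also have "\<dots> = (\<integral>z. A ((1 / N n) *\<^sub>R z) * of_real (gaussian z) \<partial>lborel)"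
      using N[of n] unfolding integral_mult_right_zero by (simp add: scaleR_conv_of_real power_divide)
    finally show ?thesis .
  qed
  have "(\<lambda>n. \<integral>z. A ((1 / N n) *\<^sub>R z) * of_real (gaussian z) \<partial>lborel) \<longlonglongrightarrow> (\<integral>z. A 0 * of_real (gaussian (z::'a)) \<partial>lborel)"
  proof (rule integral_dominated_convergence[where w="\<lambda>z. (Lp_norm 2 f)\<^sup>2 * gaussian z"])
    show "integrable lborel (\<lambda>z::'a. (Lp_norm 2 f)\<^sup>2 * gaussian z)"
      using integrable_norm[OF gaussian_integrable[where 'a='a]] by (simp add: abs_of_pos)
    show "AE z in lborel. (\<lambda>n. A ((1 / N n) *\<^sub>R z) * of_real (gaussian z)) \<longlonglongrightarrow> A 0 * of_real (gaussian z)"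
    proof (intro AE_I2 tendsto_intros)
      fix z :: 'a
      have "(\<lambda>n. (1 / N n) *\<^sub>R z) \<longlonglongrightarrow> 0 *\<^sub>R z"
        unfolding N_def using LIMSEQ_inverse_real_of_nat
        by (intro tendsto_intros) (simp add: divide_inverse)
      then show "(\<lambda>n. A ((1 / N n) *\<^sub>R z)) \<longlonglongrightarrow> A 0"
        unfolding A_def by (intro autocorr_continuous f) simp
    qed
    show "AE z in lborel. norm (A ((1 / N n) *\<^sub>R z) * of_real (gaussian z)) \<le> (Lp_norm 2 f)\<^sup>2 * gaussian z" for n
      unfolding A_def using autocorr_bound[OF f(1)]
      by (intro AE_I2) (simp add: norm_mult abs_of_pos mult_right_mono)
  qed auto
  also have "(\<integral>z. A 0 * of_real (gaussian (z::'a)) \<partial>lborel) = of_real ((Lp_norm 2 f)\<^sup>2 / c)"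
    unfolding integral_mult_right_zero gaussian_integral A_def autocorr_0[OF f(1)] c_def by simp
  finally have "(\<lambda>n. of_real c * (\<integral>\<xi>. fourier_integral A \<xi> * of_real (g n \<xi>) \<partial>lborel)) \<longlonglongrightarrow> of_real c * of_real ((Lp_norm 2 f)\<^sup>2 / c)"
    unfolding step by (intro tendsto_intros)
  moreover have "of_real c * (\<integral>\<xi>. fourier_integral A \<xi> * of_real (g n \<xi>) \<partial>lborel) =
     complex_of_real (\<integral>\<xi>. (cmod (fourier_integral f \<xi>))\<^sup>2 * g n \<xi> \<partial>lborel)" for n
    unfolding integral_mult_right_zero[symmetric] integral_complex_of_real[symmetric] A_def c_def
      mult.assoc[symmetric] fourier_autocorr[OF f(2)] of_real_mult ..
  ultimately have "(\<lambda>n. complex_of_real (\<integral>\<xi>. (cmod (fourier_integral f \<xi>))\<^sup>2 * g n \<xi> \<partial>lborel)) \<longlonglongrightarrow> complex_of_real ((Lp_norm 2 f)\<^sup>2)"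
    using c by simp
  then have lim: "(\<lambda>n. \<integral>\<xi>. (cmod (fourier_integral f \<xi>))\<^sup>2 * g n \<xi> \<partial>lborel) \<longlonglongrightarrow> (Lp_norm 2 f)\<^sup>2"
    by (simp only: tendsto_of_real_iff)
  \<comment> \<open>A bounded transform times an integrable Gaussian is integrable; this lets the
    limit of Bochner integrals be read as one of nonnegative integrals.\<close>
  have eq: "(\<integral>\<^sup>+\<xi>. ennreal ((cmod (fourier_integral f \<xi>))\<^sup>2 * g n \<xi>) \<partial>lborel) = ennreal (\<integral>\<xi>. (cmod (fourier_integral f \<xi>))\<^sup>2 * g n \<xi> \<partial>lborel)" for n
  proof (rule nn_integral_eq_integral)
    let ?B = "c * (\<integral>x. cmod (f x) \<partial>lborel)"
    have "integrable lborel (\<lambda>\<xi>. ?B\<^sup>2 * g n \<xi>)"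
      by (intro integrable_mult_right gir)
    then show "integrable lborel (\<lambda>\<xi>. (cmod (fourier_integral f \<xi>))\<^sup>2 * g n \<xi>)"
    proof (rule Bochner_Integration.integrable_bound)
      show "AE \<xi> in lborel. norm ((cmod (fourier_integral f \<xi>))\<^sup>2 * g n \<xi>) \<le> norm (?B\<^sup>2 * g n \<xi>)"
        using fourier_integral_bound[of f]
        by (intro AE_I2) (auto simp: abs_mult c_def intro!: mult_right_mono power_mono)
    qed auto
  qed (auto simp: g_def less_imp_le intro!: AE_I2 mult_nonneg_nonneg)
  have "(\<lambda>n. \<integral>\<^sup>+\<xi>. ennreal ((cmod (fourier_integral f \<xi>))\<^sup>2 * g n \<xi>) \<partial>lborel) \<longlonglongrightarrow> (\<integral>\<^sup>+\<xi>. ennreal ((cmod (fourier_integral f \<xi>))\<^sup>2) \<partial>lborel)"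
  proof (rule nn_integral_LIMSEQ)
    have mono: "g m \<xi> \<le> g n \<xi>" if "m \<le> n" for m n \<xi>
    proof -
      have "norm ((1 / N n) *\<^sub>R \<xi>) \<le> norm ((1 / N m) *\<^sub>R \<xi>)"
        using that by (auto simp: N_def intro!: mult_right_mono frac_le)
      then show ?thesis
        unfolding g_def gaussian_def by (simp add: power_mono del: norm_scaleR)
    qed
    show "incseq (\<lambda>n \<xi>. ennreal ((cmod (fourier_integral f \<xi>))\<^sup>2 * g n \<xi>))"
      by (intro incseq_SucI le_funI ennreal_leI mult_left_mono mono) auto
    fix \<xi> :: 'a
    have "(\<lambda>n. 1 / N n) \<longlonglongrightarrow> 0"
      unfolding N_def using LIMSEQ_inverse_real_of_nat by (simp add: divide_inverse)
    then have "(\<lambda>n. g n \<xi>) \<longlonglongrightarrow> exp (- (norm (0 *\<^sub>R \<xi>))\<^sup>2 / 2)"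
      unfolding g_def gaussian_def by (intro tendsto_intros) auto
    then have "(\<lambda>n. g n \<xi>) \<longlonglongrightarrow> 1" by simp
    then have "(\<lambda>n. (cmod (fourier_integral f \<xi>))\<^sup>2 * g n \<xi>) \<longlonglongrightarrow> (cmod (fourier_integral f \<xi>))\<^sup>2 * 1"
      by (intro tendsto_intros)
    then show "(\<lambda>n. ennreal ((cmod (fourier_integral f \<xi>))\<^sup>2 * g n \<xi>)) \<longlonglongrightarrow> ennreal ((cmod (fourier_integral f \<xi>))\<^sup>2)"
      by (intro tendsto_ennrealI) simp
  qed auto
  moreover have "(\<lambda>n. \<integral>\<^sup>+\<xi>. ennreal ((cmod (fourier_integral f \<xi>))\<^sup>2 * g n \<xi>) \<partial>lborel) \<longlonglongrightarrow> ennreal ((Lp_norm 2 f)\<^sup>2)"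
    unfolding eq by (intro tendsto_ennrealI lim)
  ultimately have "(\<integral>\<^sup>+\<xi>. ennreal ((cmod (fourier_integral f \<xi>))\<^sup>2) \<partial>lborel) = ennreal ((Lp_norm 2 f)\<^sup>2)"
    by (rule LIMSEQ_unique)
  then show ?thesis
    by (simp add: sq_mass_eq[OF f(1)]) (simp add: sq_mass_def)
qed

section \<open>The Fourier--Plancherel transform\<close>

lemma Lp_norm_2_sq: "(Lp_norm 2 f)\<^sup>2 = (\<integral>x. (cmod (f x))\<^sup>2 \<partial>lborel)"
  by (simp add: Lp_norm_2)

abbreviation truncate_ball :: "real \<Rightarrow> ('a::euclidean_space \<Rightarrow> complex) \<Rightarrow> 'a \<Rightarrow> complex" where
  "truncate_ball R f \<equiv> (\<lambda>x. indicator (cball 0 R) x * f x)"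

lemma L2_indicator_cball: "(\<lambda>x. indicator (cball (0::'a::euclidean_space) R) x) \<in> Lp_space 2"
proof -
  have "sq_mass (\<lambda>x::'a. indicator (cball 0 R) x) = emeasure lborel (cball (0::'a) R)"
  proof -
    have "sq_mass (\<lambda>x::'a. indicator (cball 0 R) x) = (\<integral>\<^sup>+x. indicator (cball (0::'a) R) x \<partial>lborel)"
      unfolding sq_mass_def by (intro nn_integral_cong) (auto simp: indicator_def)
    then show ?thesis by simp
  qed
  also have "\<dots> < \<infinity>" by (rule emeasure_lborel_cball_finite)
  finally show ?thesis by (auto simp: L2_iff intro!: borel_measurable_indicator)
qed

lemma truncate_ball:
  assumes f: "f \<in> Lp_space 2"
  shows "truncate_ball R f \<in> Lp_space 2" "integrable lborel (truncate_ball R f)"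
proof -
  note [measurable] = L2_measurable[OF f]
  show "truncate_ball R f \<in> Lp_space 2"
    by (rule L2_dominated[OF f]) (auto simp: indicator_def)
  show "integrable lborel (truncate_ball R f)"
    by (rule L2_mult_integrable[OF L2_indicator_cball f])
qed

lemma truncate_ball_tendsto:
  assumes f: "f \<in> Lp_space 2"
  shows "((\<lambda>R. Lp_norm 2 (\<lambda>x. truncate_ball R f x - f x)) \<longlongrightarrow> 0) at_top"
proof (rule tendsto_at_topI_sequentially)
  fix X :: "nat \<Rightarrow> real" assume X: "filterlim X at_top sequentially"
  note [measurable] = L2_measurable[OF f]
  have "(\<lambda>n. sq_mass (\<lambda>x. truncate_ball (X n) f x - f x)) \<longlonglongrightarrow> 0"
  proof (rule L2_dominated_null[OF f])
    show "(\<lambda>n. truncate_ball (X n) f x - f x) \<longlonglongrightarrow> 0" for x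
    proof (rule tendsto_eventually)
      have "\<forall>\<^sub>F n in sequentially. norm x \<le> X n"
        using X by (simp add: filterlim_at_top)
      then show "\<forall>\<^sub>F n in sequentially. truncate_ball (X n) f x - f x = 0"
        by eventually_elim auto
    qed
  qed (auto simp: indicator_def)
  then show "(\<lambda>n. Lp_norm 2 (\<lambda>x. truncate_ball (X n) f x - f x)) \<longlonglongrightarrow> 0"
    using f by (subst (asm) sq_mass_tendsto_iff) (auto intro!: L2_diff truncate_ball)
qed

lemma fourier_integral_L2:
  assumes f: "f \<in> Lp_space 2" "integrable lborel f"
  shows "fourier_integral f \<in> Lp_space 2" "Lp_norm 2 (fourier_integral f) = Lp_norm 2 f"
proof -
  note [measurable] = L2_measurable[OF f(1)]
  show *: "fourier_integral f \<in> Lp_space 2"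
    using L2_finite[OF f(1)] by (auto simp: L2_iff Plancherel_L1_L2[OF f])
  show "Lp_norm 2 (fourier_integral f) = Lp_norm 2 f"
    by (rule Lp_norm_2_eqI[OF Plancherel_L1_L2[OF f] * f(1)])
qed

lemma fourier_integral_L2_diff:
  assumes "f \<in> Lp_space 2" "integrable lborel f" "g \<in> Lp_space 2" "integrable lborel g"
  shows "Lp_norm 2 (\<lambda>\<xi>. fourier_integral f \<xi> - fourier_integral g \<xi>) = Lp_norm 2 (\<lambda>x. f x - g x)"
proof -
  have "(\<lambda>\<xi>. fourier_integral f \<xi> - fourier_integral g \<xi>) = fourier_integral (\<lambda>x. f x - g x)"
    by (rule ext) (simp add: fourier_integral_diff assms)
  then show ?thesis
    using fourier_integral_L2(2)[OF L2_diff[OF assms(1,3)]] assms by simp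
qed

lemma L2_triangle3:
  assumes "f \<in> Lp_space 2" "g \<in> Lp_space 2" "h \<in> Lp_space 2"
  shows "Lp_norm 2 (\<lambda>x. f x - h x) \<le> Lp_norm 2 (\<lambda>x. f x - g x) + Lp_norm 2 (\<lambda>x. g x - h x)"
  using L2_triangle[OF L2_diff[OF assms(1,2)] L2_diff[OF assms(2,3)]] by simp

lemma is_fourier_L2_iff:
  "is_fourier_L2 f F \<longleftrightarrow> f \<in> Lp_space 2 \<and> F \<in> Lp_space 2 \<and>
    ((\<lambda>R. Lp_norm 2 (\<lambda>\<xi>. fourier_integral (truncate_ball R f) \<xi> - F \<xi>)) \<longlongrightarrow> 0) at_top"
proof -
  have "((\<lambda>R. sq_mass (\<lambda>\<xi>. fourier_integral (truncate_ball R f) \<xi> - F \<xi>)) \<longlongrightarrow> 0) at_top \<longleftrightarrow>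
    ((\<lambda>R. Lp_norm 2 (\<lambda>\<xi>. fourier_integral (truncate_ball R f) \<xi> - F \<xi>)) \<longlongrightarrow> 0) at_top"
    if "f \<in> Lp_space 2" "F \<in> Lp_space 2"
    using that by (intro sq_mass_tendsto_iff L2_diff fourier_integral_L2 truncate_ball)
  then show ?thesis
    unfolding is_fourier_L2_def sq_mass_def[symmetric] by blast
qed

lemma is_fourier_L2_D:
  assumes "is_fourier_L2 f F"
  shows "f \<in> Lp_space 2" "F \<in> Lp_space 2"
    "((\<lambda>R. Lp_norm 2 (\<lambda>\<xi>. fourier_integral (truncate_ball R f) \<xi> - F \<xi>)) \<longlongrightarrow> 0) at_top"
  using assms by (auto simp: is_fourier_L2_iff)

text \<open>By isometry the transforms of two truncations are as close as the truncations. Along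
  rapidly chosen radii they converge by completeness; comparison with one such radius gives
  convergence along all radii, which the definition demands.\<close>

theorem is_fourier_L2_exists:
  assumes f: "f \<in> Lp_space 2"
  shows "\<exists>F. is_fourier_L2 f F"
proof -
  let ?F = "\<lambda>R. fourier_integral (truncate_ball R f)"
  \<comment> \<open>Two consecutive errors of this size add up to less than
    \<open>(1/2) ^ k\<close>, whose square is the rate required by
    \<open>L2_fast_Cauchy_limit\<close>.\<close>
  have "\<exists>R. Lp_norm 2 (\<lambda>x. truncate_ball R f x - f x) < (1/2) ^ k / 4" for k :: nat
  proof -
    have "\<forall>\<^sub>F R in at_top. Lp_norm 2 (\<lambda>x. truncate_ball R f x - f x) < (1/2) ^ k / 4"
      by (intro order_tendstoD(2)[OF truncate_ball_tendsto[OF f]]) auto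
    then show ?thesis by (auto simp: eventually_at_top_linorder)
  qed
  then obtain R where R: "\<And>k::nat. Lp_norm 2 (\<lambda>x. truncate_ball (R k) f x - f x) < (1/2) ^ k / 4"
    by metis
  note t = truncate_ball[OF f]
  note Fl = fourier_integral_L2(1)[OF t]
  have iso: "Lp_norm 2 (\<lambda>\<xi>. ?F a \<xi> - ?F b \<xi>) \<le>
      Lp_norm 2 (\<lambda>x. truncate_ball a f x - f x) + Lp_norm 2 (\<lambda>x. truncate_ball b f x - f x)" for a b
    using L2_triangle3[OF t(1)[of a] f t(1)[of b]] fourier_integral_L2_diff[OF t[of a] t[of b]]
    by (simp add: Lp_norm_2_commute[of f])
  obtain F where F: "F \<in> Lp_space 2" "(\<lambda>n. sq_mass (\<lambda>\<xi>. ?F (R n) \<xi> - F \<xi>)) \<longlonglongrightarrow> 0"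
  proof (rule L2_fast_Cauchy_limit[of "\<lambda>n. ?F (R n)"])
    show "?F (R n) \<in> Lp_space 2" for n by (rule Fl)
    show "sq_mass (\<lambda>\<xi>. ?F (R (Suc n)) \<xi> - ?F (R n) \<xi>) \<le> ennreal ((1/4) ^ n)" for n
    proof -
      have "Lp_norm 2 (\<lambda>\<xi>. ?F (R (Suc n)) \<xi> - ?F (R n) \<xi>) \<le> (1/2) ^ Suc n / 4 + (1/2) ^ n / 4"
        using iso[of "R (Suc n)" "R n"] R[of n] R[of "Suc n"] by linarith
      also have "\<dots> \<le> (1/2) ^ n" by simp
      finally have "(Lp_norm 2 (\<lambda>\<xi>. ?F (R (Suc n)) \<xi> - ?F (R n) \<xi>))\<^sup>2 \<le> ((1/2) ^ n)\<^sup>2"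
        by (rule power_mono) simp
      also have "\<dots> = (1/4) ^ n" by (simp add: power2_eq_square power_mult_distrib[symmetric])
      finally show ?thesis
        by (subst sq_mass_eq[OF L2_diff[OF Fl Fl]]) (rule ennreal_leI)
    qed
  qed (use that in blast)
  have FR: "(\<lambda>n. Lp_norm 2 (\<lambda>\<xi>. ?F (R n) \<xi> - F \<xi>)) \<longlonglongrightarrow> 0"
    using F(2) by (subst (asm) sq_mass_tendsto_iff) (intro L2_diff Fl F(1))
  have "((\<lambda>a. Lp_norm 2 (\<lambda>\<xi>. ?F a \<xi> - F \<xi>)) \<longlongrightarrow> 0) at_top"
  proof (rule tendstoI)
    fix e :: real assume e: "e > 0"
    have "(\<lambda>k. (1/2) ^ k / 4 :: real) \<longlonglongrightarrow> 0 / 4"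
      by (intro tendsto_intros LIMSEQ_power_zero) auto
    then have "\<forall>\<^sub>F k in sequentially. (1/2) ^ k / 4 < e/3"
      by (rule order_tendstoD(2)) (use e in simp)
    moreover have "\<forall>\<^sub>F k in sequentially. Lp_norm 2 (\<lambda>\<xi>. ?F (R k) \<xi> - F \<xi>) < e/3"
      using e by (intro order_tendstoD(2)[OF FR]) auto
    ultimately have "\<forall>\<^sub>F k in sequentially. (1/2) ^ k / 4 < e/3 \<and> Lp_norm 2 (\<lambda>\<xi>. ?F (R k) \<xi> - F \<xi>) < e/3"
      by eventually_elim simp
    then obtain k where k: "(1/2) ^ k / 4 < e/3" "Lp_norm 2 (\<lambda>\<xi>. ?F (R k) \<xi> - F \<xi>) < e/3"
      by (auto simp: eventually_sequentially)
    have "\<forall>\<^sub>F a in at_top. Lp_norm 2 (\<lambda>x. truncate_ball a f x - f x) < e/3"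
      using e by (intro order_tendstoD(2)[OF truncate_ball_tendsto[OF f]]) auto
    then show "\<forall>\<^sub>F a in at_top. dist (Lp_norm 2 (\<lambda>\<xi>. ?F a \<xi> - F \<xi>)) 0 < e"
    proof eventually_elim
      case (elim a)
      then show ?case
        using L2_triangle3[OF Fl[of a] Fl[of "R k"] F(1)] iso[of a "R k"] R[of k] k by simp
    qed
  qed
  with f F(1) show ?thesis unfolding is_fourier_L2_iff by blast
qed

lemma Lp_norm_2_tendsto:
  assumes "\<And>i. u i \<in> Lp_space 2" "v \<in> Lp_space 2"
    and "((\<lambda>i. Lp_norm 2 (\<lambda>x. u i x - v x)) \<longlongrightarrow> 0) F"
  shows "((\<lambda>i. Lp_norm 2 (u i)) \<longlongrightarrow> Lp_norm 2 v) F"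
proof -
  have "((\<lambda>i. Lp_norm 2 (u i) - Lp_norm 2 v) \<longlongrightarrow> 0) F"
    by (rule Lim_null_comparison[OF _ assms(3)]) (simp add: L2_triangle_abs assms)
  then show ?thesis by (simp add: LIM_zero_iff)
qed

lemma is_fourier_L2_norm:
  assumes F: "is_fourier_L2 f F"
  shows "Lp_norm 2 F = Lp_norm 2 f"
proof -
  note f = is_fourier_L2_D(1)[OF F]
  have "((\<lambda>R. Lp_norm 2 (fourier_integral (truncate_ball R f))) \<longlongrightarrow> Lp_norm 2 F) at_top"
    by (intro Lp_norm_2_tendsto is_fourier_L2_D[OF F] fourier_integral_L2 truncate_ball f)
  moreover have "((\<lambda>R. Lp_norm 2 (fourier_integral (truncate_ball R f))) \<longlongrightarrow> Lp_norm 2 f) at_top"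
    unfolding fourier_integral_L2(2)[OF truncate_ball[OF f]]
    by (intro Lp_norm_2_tendsto truncate_ball f truncate_ball_tendsto)
  ultimately show ?thesis by (intro tendsto_unique) auto
qed

text \<open>Linearity is proved for the relation, since the chosen \<open>fourier_L2\<close> is
  linear only up to null sets.\<close>

lemma is_fourier_L2_diff:
  assumes F: "is_fourier_L2 f F" and G: "is_fourier_L2 g G"
  shows "is_fourier_L2 (\<lambda>x. f x - g x) (\<lambda>\<xi>. F \<xi> - G \<xi>)"
  unfolding is_fourier_L2_iff
proof (intro conjI)
  note D = is_fourier_L2_D[OF F] is_fourier_L2_D[OF G]
  show "(\<lambda>x. f x - g x) \<in> Lp_space 2" "(\<lambda>\<xi>. F \<xi> - G \<xi>) \<in> Lp_space 2"
    by (intro L2_diff D)+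
  let ?F = "\<lambda>R. fourier_integral (truncate_ball R f)"
  let ?G = "\<lambda>R. fourier_integral (truncate_ball R g)"
  have eq: "fourier_integral (truncate_ball R (\<lambda>x. f x - g x)) \<xi> = ?F R \<xi> - ?G R \<xi>" for R \<xi>
    using fourier_integral_diff[OF truncate_ball(2)[OF D(1)] truncate_ball(2)[OF D(4)], of R R \<xi>]
    by (simp add: right_diff_distrib)
  have lim: "((\<lambda>R. Lp_norm 2 (\<lambda>\<xi>. ?F R \<xi> - F \<xi>) + Lp_norm 2 (\<lambda>\<xi>. ?G R \<xi> - G \<xi>)) \<longlongrightarrow> 0 + 0) at_top"
    by (intro tendsto_add D)
  show "((\<lambda>R. Lp_norm 2 (\<lambda>\<xi>. fourier_integral (truncate_ball R (\<lambda>x. f x - g x)) \<xi> - (F \<xi> - G \<xi>))) \<longlongrightarrow> 0) at_top"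
  proof (rule Lim_null_comparison[OF _ lim[simplified]], rule always_eventually, rule allI)
    fix R
    have "(\<lambda>\<xi>. ?F R \<xi> - F \<xi>) \<in> Lp_space 2" "(\<lambda>\<xi>. - (?G R \<xi> - G \<xi>)) \<in> Lp_space 2"
      by (intro L2_uminus L2_diff fourier_integral_L2 truncate_ball D)+
    from L2_triangle[OF this]
    have "Lp_norm 2 (\<lambda>\<xi>. (?F R \<xi> - ?G R \<xi>) - (F \<xi> - G \<xi>)) \<le> Lp_norm 2 (\<lambda>\<xi>. ?F R \<xi> - F \<xi>) + Lp_norm 2 (\<lambda>\<xi>. - (?G R \<xi> - G \<xi>))"
      by (simp add: algebra_simps)
    also have "Lp_norm 2 (\<lambda>\<xi>. - (?G R \<xi> - G \<xi>)) = Lp_norm 2 (\<lambda>\<xi>. ?G R \<xi> - G \<xi>)"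
      by (simp only: Lp_norm_2 norm_minus_cancel)
    finally show "norm (Lp_norm 2 (\<lambda>\<xi>. fourier_integral (truncate_ball R (\<lambda>x. f x - g x)) \<xi> - (F \<xi> - G \<xi>))) \<le>
      Lp_norm 2 (\<lambda>\<xi>. ?F R \<xi> - F \<xi>) + Lp_norm 2 (\<lambda>\<xi>. ?G R \<xi> - G \<xi>)"
      unfolding eq by simp
  qed
qed

lemma is_fourier_L2_dist:
  assumes "is_fourier_L2 f F" "is_fourier_L2 g G"
  shows "Lp_norm 2 (\<lambda>\<xi>. F \<xi> - G \<xi>) = Lp_norm 2 (\<lambda>x. f x - g x)"
  by (rule is_fourier_L2_norm[OF is_fourier_L2_diff[OF assms]])

lemma Lp_norm_2_eq_0_iff:
  assumes f: "f \<in> Lp_space 2"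
  shows "Lp_norm 2 f = 0 \<longleftrightarrow> (AE x in lborel. f x = 0)"
proof -
  note [measurable] = L2_measurable[OF f]
  have "Lp_norm 2 f = 0 \<longleftrightarrow> sq_mass f = 0" by (simp add: sq_mass_eq[OF f])
  also have "\<dots> \<longleftrightarrow> (AE x in lborel. f x = 0)"
    unfolding sq_mass_def by (subst nn_integral_0_iff_AE) auto
  finally show ?thesis .
qed

lemma is_fourier_L2_cong_AE:
  assumes F: "is_fourier_L2 f F" and G: "G \<in> Lp_space 2" "AE \<xi> in lborel. F \<xi> = G \<xi>"
  shows "is_fourier_L2 f G"
proof -
  note [measurable] = L2_measurable[OF G(1)] L2_measurable[OF is_fourier_L2_D(2)[OF F]]
    L2_measurable[OF fourier_integral_L2(1)[OF truncate_ball[OF is_fourier_L2_D(1)[OF F]]]]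
  have "Lp_norm 2 (\<lambda>\<xi>. fourier_integral (truncate_ball R f) \<xi> - F \<xi>) = Lp_norm 2 (\<lambda>\<xi>. fourier_integral (truncate_ball R f) \<xi> - G \<xi>)" for R
    unfolding Lp_norm_2 by (intro arg_cong[where f=sqrt] integral_cong_AE) (use G(2) in auto)
  then show ?thesis using F G(1) by (simp add: is_fourier_L2_iff)
qed

text \<open>The truncations and \<open>f\<close> itself are integrable here, so the isometry carries
  the convergence of the truncations over to Fourier integrals. This makes sup bounds available for
  the L2 transform.\<close>

lemma is_fourier_L2_fourier_integral:
  assumes f: "f \<in> Lp_space 2" "integrable lborel f"
  shows "is_fourier_L2 f (fourier_integral f)"
  unfolding is_fourier_L2_iff fourier_integral_L2_diff[OF truncate_ball[OF f(1)] f]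
  by (intro conjI f fourier_integral_L2 truncate_ball_tendsto)

lemma is_fourier_L2_fourier_L2: "f \<in> Lp_space 2 \<Longrightarrow> is_fourier_L2 f (fourier_L2 f)"
  unfolding fourier_L2_def by (rule someI_ex[OF is_fourier_L2_exists])

section \<open>Symmetries and inversion of the L2 transform\<close>

lemma is_fourier_L2_scale:
  assumes F: "is_fourier_L2 f F"
  shows "is_fourier_L2 (\<lambda>x. c * f x) (\<lambda>\<xi>. c * F \<xi>)"
  unfolding is_fourier_L2_iff
proof (intro conjI)
  note D = is_fourier_L2_D[OF F]
  show "(\<lambda>x. c * f x) \<in> Lp_space 2" "(\<lambda>\<xi>. c * F \<xi>) \<in> Lp_space 2" by (intro L2_scale D)+
  have "fourier_integral (truncate_ball R (\<lambda>x. c * f x)) \<xi> = c * fourier_integral (truncate_ball R f) \<xi>" for R \<xi>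
    unfolding fourier_integral_def integral_mult_right_zero[symmetric]
    by (intro Bochner_Integration.integral_cong refl) simp
  then have "Lp_norm 2 (\<lambda>\<xi>. fourier_integral (truncate_ball R (\<lambda>x. c * f x)) \<xi> - c * F \<xi>) =
      cmod c * Lp_norm 2 (\<lambda>\<xi>. fourier_integral (truncate_ball R f) \<xi> - F \<xi>)" for R
    unfolding Lp_norm_2 by (simp add: right_diff_distrib[symmetric] norm_mult power_mult_distrib real_sqrt_mult)
  then show "((\<lambda>R. Lp_norm 2 (\<lambda>\<xi>. fourier_integral (truncate_ball R (\<lambda>x. c * f x)) \<xi> - c * F \<xi>)) \<longlongrightarrow> 0) at_top"
    using tendsto_mult_left[OF D(3), of "cmod c"] by simp
qed

text \<open>Conjugating the kernel amounts to reflecting the frequency. This turns the bilinear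
  exchange formula into a statement on inner products.\<close>

lemma is_fourier_L2_cnj:
  assumes F: "is_fourier_L2 f F"
  shows "is_fourier_L2 (\<lambda>x. cnj (f x)) (\<lambda>\<xi>. cnj (F (- \<xi>)))"
  unfolding is_fourier_L2_iff
proof (intro conjI)
  note D = is_fourier_L2_D[OF F]
  note [measurable] = L2_measurable[OF D(2)] L2_measurable[OF fourier_integral_L2(1)[OF truncate_ball[OF D(1)]]]
  show "(\<lambda>x. cnj (f x)) \<in> Lp_space 2" by (intro L2_cnj D)
  show "(\<lambda>\<xi>. cnj (F (- \<xi>))) \<in> Lp_space 2"
    using L2_affine[OF D(2), of "-1" 0] by (intro L2_cnj) simp
  have eq: "fourier_integral (truncate_ball R (\<lambda>x. cnj (f x))) \<xi> = cnj (fourier_integral (truncate_ball R f) (- \<xi>))" for R \<xi>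
    unfolding fourier_integral_def complex_cnj_mult Bochner_Integration.integral_cnj[symmetric]
    by (intro arg_cong2[where f="(*)"] Bochner_Integration.integral_cong refl) (auto simp: exp_cnj indicator_def)
  have "Lp_norm 2 (\<lambda>\<xi>. fourier_integral (truncate_ball R (\<lambda>x. cnj (f x))) \<xi> - cnj (F (- \<xi>))) =
      Lp_norm 2 (\<lambda>\<xi>. fourier_integral (truncate_ball R f) \<xi> - F \<xi>)" for R
    using integral_affine[of "\<lambda>\<xi>. (cmod (fourier_integral (truncate_ball R f) \<xi> - F \<xi>))\<^sup>2" "-1" 0]
    unfolding Lp_norm_2 eq complex_cnj_diff[symmetric] complex_mod_cnj by simp
  then show "((\<lambda>R. Lp_norm 2 (\<lambda>\<xi>. fourier_integral (truncate_ball R (\<lambda>x. cnj (f x))) \<xi> - cnj (F (- \<xi>)))) \<longlongrightarrow> 0) at_top"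
    using D(3) by simp
qed

text \<open>\<open>u * v - f * g = (u - f) * v + f * (v - g)\<close>, with Cauchy-Schwarz on both
  terms; the norms of \<open>v i\<close> converge, so the first product tends to 0.\<close>

lemma L2_integral_mult_tendsto:
  assumes u: "\<And>i. u i \<in> Lp_space 2" "f \<in> Lp_space 2" "((\<lambda>i. Lp_norm 2 (\<lambda>x. u i x - f x)) \<longlongrightarrow> 0) F"
    and v: "\<And>i. v i \<in> Lp_space 2" "g \<in> Lp_space 2" "((\<lambda>i. Lp_norm 2 (\<lambda>x. v i x - g x)) \<longlongrightarrow> 0) F"
  shows "((\<lambda>i. \<integral>x. u i x * v i x \<partial>lborel) \<longlongrightarrow> (\<integral>x. f x * g x \<partial>lborel)) F"
proof -
  have lim: "((\<lambda>i. Lp_norm 2 (\<lambda>x. u i x - f x) * Lp_norm 2 (v i) + Lp_norm 2 f * Lp_norm 2 (\<lambda>x. v i x - g x)) \<longlongrightarrow>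
     0 * Lp_norm 2 g + Lp_norm 2 f * 0) F"
    by (intro tendsto_intros u v Lp_norm_2_tendsto)
  have "((\<lambda>i. (\<integral>x. u i x * v i x \<partial>lborel) - (\<integral>x. f x * g x \<partial>lborel)) \<longlongrightarrow> 0) F"
  proof (rule Lim_null_comparison[OF _ lim[simplified]], rule always_eventually, rule allI)
    fix i
    have "(\<integral>x. u i x * v i x \<partial>lborel) - (\<integral>x. f x * g x \<partial>lborel) = (\<integral>x. (u i x - f x) * v i x + f x * (v i x - g x) \<partial>lborel)"
      by (subst Bochner_Integration.integral_diff[symmetric])
         (auto intro!: L2_mult_integrable u v Bochner_Integration.integral_cong simp: algebra_simps)
    also have "\<dots> = (\<integral>x. (u i x - f x) * v i x \<partial>lborel) + (\<integral>x. f x * (v i x - g x) \<partial>lborel)"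
      by (intro Bochner_Integration.integral_add L2_mult_integrable L2_diff u v)
    also have "cmod \<dots> \<le> Lp_norm 2 (\<lambda>x. u i x - f x) * Lp_norm 2 (v i) + Lp_norm 2 f * Lp_norm 2 (\<lambda>x. v i x - g x)"
      by (intro norm_triangle_mono L2_Cauchy_Schwarz L2_diff u v)
    finally show "norm ((\<integral>x. u i x * v i x \<partial>lborel) - (\<integral>x. f x * g x \<partial>lborel)) \<le>
       Lp_norm 2 (\<lambda>x. u i x - f x) * Lp_norm 2 (v i) + Lp_norm 2 f * Lp_norm 2 (\<lambda>x. v i x - g x)" .
  qed
  then show ?thesis by (simp add: LIM_zero_iff)
qed

lemma fourier_L2_multiplication_formula:
  assumes F: "is_fourier_L2 f F" and G: "is_fourier_L2 g G"
  shows "(\<integral>\<xi>. F \<xi> * g \<xi> \<partial>lborel) = (\<integral>x. f x * G x \<partial>lborel)"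
proof -
  note D = is_fourier_L2_D[OF F] is_fourier_L2_D[OF G]
  let ?f = "\<lambda>R. truncate_ball R f" and ?g = "\<lambda>R. truncate_ball R g"
  have "((\<lambda>R. \<integral>\<xi>. fourier_integral (?f R) \<xi> * ?g R \<xi> \<partial>lborel) \<longlongrightarrow> (\<integral>\<xi>. F \<xi> * g \<xi> \<partial>lborel)) at_top"
    by (intro L2_integral_mult_tendsto D fourier_integral_L2 truncate_ball truncate_ball_tendsto)
  moreover have "((\<lambda>R. \<integral>x. ?f R x * fourier_integral (?g R) x \<partial>lborel) \<longlongrightarrow> (\<integral>x. f x * G x \<partial>lborel)) at_top"
    by (intro L2_integral_mult_tendsto D fourier_integral_L2 truncate_ball truncate_ball_tendsto)
  ultimately show ?thesis
    unfolding fourier_multiplication_formula[OF truncate_ball(2)[OF D(1)] truncate_ball(2)[OF D(4)]]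
    by (intro tendsto_unique) auto
qed

text \<open>With \<open>G\<close> the transform of \<open>F\<close>, the reflection \<open>f\<close> of \<open>G\<close> has a transform \<open>H\<close> with
  \<open>\<parallel>H\<parallel> = \<parallel>F\<parallel>\<close>, and the multiplication formula gives \<open>\<langle>H, F\<rangle> = \<parallel>F\<parallel>\<^sup>2\<close>; hence \<open>H = F\<close>.\<close>

theorem is_fourier_L2_surj:
  assumes F: "F \<in> Lp_space 2"
  shows "\<exists>f. is_fourier_L2 f F"
proof -
  obtain G where G: "is_fourier_L2 F G" using is_fourier_L2_exists[OF F] by blast
  note GL = is_fourier_L2_D(2)[OF G]
  note [measurable] = L2_measurable[OF GL] L2_measurable[OF F]
  define f where "f x = G (- x)" for x
  have f: "f \<in> Lp_space 2"
    using L2_affine[OF GL, of "-1" 0] by (simp add: f_def[abs_def])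
  have fn: "Lp_norm 2 f = Lp_norm 2 F"
    unfolding is_fourier_L2_norm[OF G, symmetric]
    using sq_mass_affine[of G "-1" 0] by (intro Lp_norm_2_eqI f GL) (simp_all add: f_def[abs_def])
  obtain H where H: "is_fourier_L2 f H" using is_fourier_L2_exists[OF f] by blast
  note HL = is_fourier_L2_D(2)[OF H]
  \<comment> \<open>The second pair in the exchange formula is \<open>cnj F\<close> with transform
    \<open>cnj (G (- x))\<close>, which equals \<open>cnj (f x)\<close> because \<open>f\<close> is
    the reflection of \<open>G\<close>.\<close>
  have "(\<integral>\<xi>. H \<xi> * cnj (F \<xi>) \<partial>lborel) = (\<integral>x. f x * cnj (G (- x)) \<partial>lborel)"
    by (rule fourier_L2_multiplication_formula[OF H is_fourier_L2_cnj[OF G]])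
  also have "\<dots> = (\<integral>x. complex_of_real ((cmod (f x))\<^sup>2) \<partial>lborel)"
    by (intro Bochner_Integration.integral_cong refl) (simp only: f_def complex_norm_square)
  also have "\<dots> = of_real ((Lp_norm 2 F)\<^sup>2)"
    unfolding fn[symmetric] integral_complex_of_real by (simp add: Lp_norm_2)
  finally have inner: "(\<integral>\<xi>. H \<xi> * cnj (F \<xi>) \<partial>lborel) = of_real ((Lp_norm 2 F)\<^sup>2)" .
  have expand: "(cmod (a - b))\<^sup>2 = (cmod a)\<^sup>2 + (cmod b)\<^sup>2 - 2 * Re (a * cnj b)" for a b
    unfolding cmod_power2 by (simp add: power2_eq_square algebra_simps)
  have "(Lp_norm 2 (\<lambda>\<xi>. H \<xi> - F \<xi>))\<^sup>2 = (\<integral>\<xi>. (cmod (H \<xi>))\<^sup>2 + (cmod (F \<xi>))\<^sup>2 - 2 * Re (H \<xi> * cnj (F \<xi>)) \<partial>lborel)"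
    by (simp only: Lp_norm_2_sq expand)
  also have "\<dots> = (\<integral>\<xi>. (cmod (H \<xi>))\<^sup>2 \<partial>lborel) + (\<integral>\<xi>. (cmod (F \<xi>))\<^sup>2 \<partial>lborel) - 2 * Re (\<integral>\<xi>. H \<xi> * cnj (F \<xi>) \<partial>lborel)"
  proof -
    have i: "integrable lborel (\<lambda>\<xi>. H \<xi> * cnj (F \<xi>))" by (intro L2_mult_integrable HL L2_cnj F)
    have "(\<integral>\<xi>. a \<xi> + b \<xi> - 2 * X \<xi> \<partial>lborel) = (\<integral>\<xi>. a \<xi> \<partial>lborel) + (\<integral>\<xi>. b \<xi> \<partial>lborel) - 2 * (\<integral>\<xi>. X \<xi> \<partial>lborel)"
      if "integrable lborel a" "integrable lborel b" "integrable lborel X" for a b X :: "'a \<Rightarrow> real"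
      using that by simp
    from this[OF L2_sq_integrable[OF HL] L2_sq_integrable[OF F] integrable_Re[OF i]]
    show ?thesis unfolding integral_Re[OF i] .
  qed
  also have "\<dots> = (Lp_norm 2 H)\<^sup>2 + (Lp_norm 2 F)\<^sup>2 - 2 * (Lp_norm 2 F)\<^sup>2"
    unfolding inner by (simp add: Lp_norm_2)
  also have "\<dots> = 0" by (simp add: is_fourier_L2_norm[OF H] fn)
  finally have "AE \<xi> in lborel. H \<xi> - F \<xi> = 0"
    using Lp_norm_2_eq_0_iff[OF L2_diff[OF HL F]] by simp
  then have "is_fourier_L2 f F"
    by (intro is_fourier_L2_cong_AE[OF H F]) simp
  then show ?thesis by blast
qed

lemma is_fourier_L2_inv_fourier_L2: "F \<in> Lp_space 2 \<Longrightarrow> is_fourier_L2 (inv_fourier_L2 F) F"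
  unfolding inv_fourier_L2_def by (rule someI_ex[OF is_fourier_L2_surj])

lemma is_fourier_L2_unique_AE:
  assumes "is_fourier_L2 f F" "is_fourier_L2 f G"
  shows "AE \<xi> in lborel. F \<xi> = G \<xi>"
  using Lp_norm_2_eq_0_iff[OF L2_diff[OF is_fourier_L2_D(2)[OF assms(1)] is_fourier_L2_D(2)[OF assms(2)]]]
    is_fourier_L2_dist[OF assms] by (simp add: Lp_norm_2)

section \<open>Power weights\<close>

lemma ennreal_mult_add_mult:
  "0 \<le> a \<Longrightarrow> 0 \<le> x \<Longrightarrow> 0 \<le> b \<Longrightarrow> 0 \<le> y \<Longrightarrow>
    ennreal a * ennreal x + ennreal b * ennreal y = ennreal (a * x + b * y)"
  by (simp add: ennreal_mult ennreal_plus)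

lemma nn_integral_powr_to_inf:
  fixes a e :: real
  assumes "0 < a" "e < -1"
  shows "(\<integral>\<^sup>+x. ennreal (x powr e) * indicator {a..} x \<partial>lborel) = ennreal (a powr (e + 1) / (- (e + 1)))"
proof -
  have "(\<integral>\<^sup>+x. ennreal (x powr e) * indicator {a..} x \<partial>lborel) = ennreal (- (a powr (e + 1)) / (e + 1))"
    by (rule nn_integral_has_integral_lebesgue'[OF _ has_integral_powr_to_inf]) (use assms in auto)
  also have "- (a powr (e + 1)) / (e + 1) = a powr (e + 1) / (- (e + 1))"
    by (simp only: minus_divide_left[symmetric] minus_divide_right)
  finally show ?thesis .
qed

lemma nn_integral_powr_from_0:
  fixes c e :: real
  assumes "0 \<le> c" "-1 < e"
  shows "(\<integral>\<^sup>+x. ennreal (x powr e) * indicator {0..c} x \<partial>lborel) = ennreal (c powr (e + 1) / (e + 1))"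
  by (rule nn_integral_has_integral_lebesgue'[OF _ has_integral_powr_from_0]) (use assms in auto)

text \<open>|\<xi>|^(-p) is the integral of \<open>p * R powr (-p-1)\<close> over R \<ge> |\<xi>|;
  then the integrals are exchanged. Weighted integrals reduce to masses on balls, in place of polar
  coordinates.\<close>

lemma nn_integral_norm_powr_layer_cake:
  fixes h :: "'a::euclidean_space \<Rightarrow> ennreal"
  assumes p: "0 < p" and [measurable]: "h \<in> borel_measurable borel"
  shows "(\<integral>\<^sup>+\<xi>. ennreal (norm \<xi> powr (-p)) * h \<xi> \<partial>lborel) \<le>
    (\<integral>\<^sup>+R. ennreal (p * R powr (-p-1)) * indicator {0<..} R * (\<integral>\<^sup>+\<xi>. h \<xi> * indicator (cball 0 R) \<xi> \<partial>lborel) \<partial>lborel)"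
proof -
  define k where "k R \<xi> = ennreal (p * R powr (-p-1)) * indicator {0<..} R * (h \<xi> * (if norm \<xi> \<le> R then 1 else 0))" for R and \<xi> :: 'a
  have ind: "indicator (cball 0 R) \<xi> = (if norm \<xi> \<le> R then 1 else (0::ennreal))" for R and \<xi> :: 'a
    by (auto simp: indicator_def)
  have "(\<integral>\<^sup>+\<xi>. ennreal (norm \<xi> powr (-p)) * h \<xi> \<partial>lborel) \<le> (\<integral>\<^sup>+\<xi>. (\<integral>\<^sup>+R. k R \<xi> \<partial>lborel) \<partial>lborel)"
  proof (intro nn_integral_mono)
    fix \<xi> :: 'a
    show "ennreal (norm \<xi> powr (-p)) * h \<xi> \<le> (\<integral>\<^sup>+R. k R \<xi> \<partial>lborel)"
    \<comment> \<open>At the origin \<open>0 powr (-p)\<close> is 0 while the integral over the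
      radii may diverge, so the pointwise comparison is only an inequality.\<close>
    proof (cases "\<xi> = 0")
      case False
      have "ennreal (norm \<xi> powr (-p)) = ennreal p * ennreal (norm \<xi> powr ((-p-1) + 1) / (- ((-p-1) + 1)))"
        using p by (simp add: ennreal_mult[symmetric])
      also have "\<dots> = ennreal p * (\<integral>\<^sup>+R. ennreal (R powr (-p-1)) * indicator {norm \<xi>..} R \<partial>lborel)"
        using p False by (subst nn_integral_powr_to_inf) auto
      also have "\<dots> = (\<integral>\<^sup>+R. ennreal (p * R powr (-p-1)) * indicator {norm \<xi>..} R \<partial>lborel)"
        using p by (subst nn_integral_cmult[symmetric]) (auto simp: ennreal_mult mult.assoc)
      finally have "ennreal (norm \<xi> powr (-p)) * h \<xi> = (\<integral>\<^sup>+R. ennreal (p * R powr (-p-1)) * indicator {norm \<xi>..} R * h \<xi> \<partial>lborel)"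
        by (simp add: nn_integral_multc)
      also have "\<dots> = (\<integral>\<^sup>+R. k R \<xi> \<partial>lborel)"
      proof (intro nn_integral_cong)
        fix R :: real
        have "0 < norm \<xi>" using False by simp
        then have "0 < R" if "norm \<xi> \<le> R" using that by (rule less_le_trans)
        then show "ennreal (p * R powr (-p-1)) * indicator {norm \<xi>..} R * h \<xi> = k R \<xi>"
          by (auto simp: k_def indicator_def)
      qed
      finally show ?thesis by simp
    qed simp
  qed
  also have "\<dots> = (\<integral>\<^sup>+R. (\<integral>\<^sup>+\<xi>. k R \<xi> \<partial>lborel) \<partial>lborel)"
    by (rule lborel_pair.Fubini'[symmetric]) (unfold k_def, measurable)
  also have "\<dots> = (\<integral>\<^sup>+R. ennreal (p * R powr (-p-1)) * indicator {0<..} R * (\<integral>\<^sup>+\<xi>. h \<xi> * indicator (cball 0 R) \<xi> \<partial>lborel) \<partial>lborel)"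
    unfolding k_def ind by (intro nn_integral_cong nn_integral_cmult) measurable
  finally show ?thesis .
qed

text \<open>In the layer cake the ball of radius min(R, \<rho>) contributes. Radii below
  \<open>R\<close>, integrable at 0 since p < d, give the term p / (d - p); radii above
  \<open>R\<close> give the summand 1.\<close>

lemma nn_integral_norm_powr_ball:
  assumes p: "0 < p" "p < real DIM('a)" and R: "0 < R"
  shows "(\<integral>\<^sup>+\<xi>. ennreal (norm \<xi> powr (-p)) * indicator (cball (0::'a::euclidean_space) R) \<xi> \<partial>lborel) \<le>
    ennreal (unit_ball_vol (real DIM('a)) * (p / (real DIM('a) - p) + 1) * R powr (real DIM('a) - p))"
proof -
  define d where "d = real DIM('a)"
  define V where "V = unit_ball_vol d"
  have V: "0 \<le> V" by (simp add: V_def d_def)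
  have ball: "emeasure lborel (cball (0::'a) \<rho>) = ennreal (V * \<rho> powr d)" if "0 < \<rho>" for \<rho>
    using that by (subst emeasure_cball) (auto simp: V_def d_def powr_realpow)
  have "(\<integral>\<^sup>+\<xi>. ennreal (norm \<xi> powr (-p)) * indicator (cball (0::'a) R) \<xi> \<partial>lborel) \<le>
    (\<integral>\<^sup>+\<rho>. ennreal (p * \<rho> powr (-p-1)) * indicator {0<..} \<rho> * (\<integral>\<^sup>+\<xi>. indicator (cball (0::'a) R) \<xi> * indicator (cball 0 \<rho>) \<xi> \<partial>lborel) \<partial>lborel)"
    by (intro nn_integral_norm_powr_layer_cake p borel_measurable_indicator) auto
  also have "\<dots> \<le> (\<integral>\<^sup>+\<rho>. ennreal (p * V) * (ennreal (\<rho> powr (d-p-1)) * indicator {0..R} \<rho>) +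
      ennreal (p * V * R powr d) * (ennreal (\<rho> powr (-p-1)) * indicator {R..} \<rho>) \<partial>lborel)"
  proof (intro nn_integral_mono)
    fix \<rho> :: real
    show "ennreal (p * \<rho> powr (-p-1)) * indicator {0<..} \<rho> * (\<integral>\<^sup>+\<xi>. indicator (cball (0::'a) R) \<xi> * indicator (cball 0 \<rho>) \<xi> \<partial>lborel)
      \<le> ennreal (p * V) * (ennreal (\<rho> powr (d-p-1)) * indicator {0..R} \<rho>) +
      ennreal (p * V * R powr d) * (ennreal (\<rho> powr (-p-1)) * indicator {R..} \<rho>)" (is "?l \<le> ?a + ?b")
    proof (cases "0 < \<rho>")
      case True
      have le: "(\<integral>\<^sup>+\<xi>. indicator (cball (0::'a) R) \<xi> * indicator (cball 0 \<rho>) \<xi> \<partial>lborel) \<le> emeasure lborel (cball (0::'a) x)"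
        if "x = R \<or> x = \<rho>" for x
      proof -
        have "(\<integral>\<^sup>+\<xi>. indicator (cball (0::'a) R) \<xi> * indicator (cball 0 \<rho>) \<xi> \<partial>lborel) \<le> (\<integral>\<^sup>+\<xi>. indicator (cball (0::'a) x) \<xi> \<partial>lborel)"
          using that by (intro nn_integral_mono) (auto simp: indicator_def)
        then show ?thesis by simp
      qed
      show ?thesis
      proof (cases "\<rho> \<le> R")
        case le_R: True
        have "?l \<le> ennreal (p * \<rho> powr (-p-1)) * ennreal (V * \<rho> powr d)"
          using le[of \<rho>] True by (simp add: ball mult_left_mono)
        also have "\<dots> = ennreal (p * V * (\<rho> powr (-p-1) * \<rho> powr d))"
          using p V by (simp add: ennreal_mult[symmetric] mult_ac)
        also have "\<rho> powr (-p-1) * \<rho> powr d = \<rho> powr (d-p-1)"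
          by (simp add: powr_add[symmetric] algebra_simps)
        also have "ennreal (p * V * \<rho> powr (d-p-1)) = ?a"
          using le_R True p V by (simp add: ennreal_mult)
        finally show ?thesis by (rule order_trans) simp
      next
        case False
        have "?l \<le> ennreal (p * \<rho> powr (-p-1)) * ennreal (V * R powr d)"
          using le[of R] True R by (simp add: ball mult_left_mono)
        also have "\<dots> = ennreal (p * V * R powr d * \<rho> powr (-p-1))"
          using p V by (simp add: ennreal_mult[symmetric] mult_ac)
        also have "\<dots> = ?b"
          using False p V by (simp add: ennreal_mult)
        finally show ?thesis by (rule order_trans) simp
      qed
    qed simp
  qed
  also have "\<dots> = ennreal (p * V) * (\<integral>\<^sup>+\<rho>. ennreal (\<rho> powr (d-p-1)) * indicator {0..R} \<rho> \<partial>lborel) +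
      ennreal (p * V * R powr d) * (\<integral>\<^sup>+\<rho>. ennreal (\<rho> powr (-p-1)) * indicator {R..} \<rho> \<partial>lborel)"
    by (subst nn_integral_add) (auto simp: nn_integral_cmult)
  also have "\<dots> = ennreal (p * V) * ennreal (R powr (d-p-1+1) / (d-p-1+1)) + ennreal (p * V * R powr d) * ennreal (R powr (-p-1+1) / (- (-p-1+1)))"
    using p R unfolding d_def[symmetric] by (subst nn_integral_powr_from_0, simp, simp, subst nn_integral_powr_to_inf) auto
  also have "\<dots> = ennreal (p * V * (R powr (d-p) / (d-p)) + p * V * R powr d * (R powr (-p) / p))"
    using p V R unfolding d_def[symmetric] by (subst ennreal_mult_add_mult) auto
  also have "p * V * (R powr (d-p) / (d-p)) + p * V * R powr d * (R powr (-p) / p) = V * (p / (d - p) + 1) * R powr (d - p)"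
  proof -
    have "R powr d * R powr (-p) = R powr (d - p)" by (simp add: powr_add[symmetric])
    then have "p * V * R powr d * (R powr (-p) / p) = V * R powr (d - p)"
      using p by (simp add: mult.assoc)
    then show ?thesis by (simp add: distrib_left distrib_right mult_ac)
  qed
  finally show ?thesis by (simp add: d_def V_def)
qed

text \<open>Radii below \<open>R\<close> see no mass. Above \<open>R\<close> the shell is bounded by
  the full ball, and p > d makes the remaining power integrable at infinity.\<close>

lemma nn_integral_norm_powr_outside:
  assumes p: "real DIM('a) < p" and R: "0 < R"
  shows "(\<integral>\<^sup>+\<xi>. ennreal (norm \<xi> powr (-p)) * indicator (- cball (0::'a::euclidean_space) R) \<xi> \<partial>lborel) \<le>
    ennreal (p * unit_ball_vol (real DIM('a)) / (p - real DIM('a)) * R powr (real DIM('a) - p))"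
proof -
  define d where "d = real DIM('a)"
  define V where "V = unit_ball_vol d"
  have V: "0 \<le> V" and d: "0 < d" by (simp_all add: V_def d_def)
  have ball: "emeasure lborel (cball (0::'a) \<rho>) = ennreal (V * \<rho> powr d)" if "0 < \<rho>" for \<rho>
    using that by (subst emeasure_cball) (auto simp: V_def d_def powr_realpow)
  have p0: "0 < p" using p by (simp add: order_le_less_trans[OF of_nat_0_le_iff])
  have "(\<integral>\<^sup>+\<xi>. ennreal (norm \<xi> powr (-p)) * indicator (- cball (0::'a) R) \<xi> \<partial>lborel) \<le>
    (\<integral>\<^sup>+\<rho>. ennreal (p * \<rho> powr (-p-1)) * indicator {0<..} \<rho> * (\<integral>\<^sup>+\<xi>. indicator (- cball (0::'a) R) \<xi> * indicator (cball 0 \<rho>) \<xi> \<partial>lborel) \<partial>lborel)"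
    by (intro nn_integral_norm_powr_layer_cake p0 borel_measurable_indicator) auto
  also have "\<dots> \<le> (\<integral>\<^sup>+\<rho>. ennreal (p * V) * (ennreal (\<rho> powr (d-p-1)) * indicator {R..} \<rho>) \<partial>lborel)"
  proof (intro nn_integral_mono)
    fix \<rho> :: real
    show "ennreal (p * \<rho> powr (-p-1)) * indicator {0<..} \<rho> * (\<integral>\<^sup>+\<xi>. indicator (- cball (0::'a) R) \<xi> * indicator (cball 0 \<rho>) \<xi> \<partial>lborel)
      \<le> ennreal (p * V) * (ennreal (\<rho> powr (d-p-1)) * indicator {R..} \<rho>)" (is "?l \<le> ?r")
    proof (cases "R \<le> \<rho>")
      case True
      have "(\<integral>\<^sup>+\<xi>. indicator (- cball (0::'a) R) \<xi> * indicator (cball 0 \<rho>) \<xi> \<partial>lborel) \<le> (\<integral>\<^sup>+\<xi>. indicator (cball (0::'a) \<rho>) \<xi> \<partial>lborel)"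
        by (intro nn_integral_mono) (auto simp: indicator_def)
      then have "?l \<le> ennreal (p * \<rho> powr (-p-1)) * ennreal (V * \<rho> powr d)"
        using R True by (simp add: ball mult_left_mono)
      also have "\<dots> = ennreal (p * V * (\<rho> powr (-p-1) * \<rho> powr d))"
        using p0 V by (simp add: ennreal_mult[symmetric] mult_ac)
      also have "\<rho> powr (-p-1) * \<rho> powr d = \<rho> powr (d-p-1)"
        by (simp add: powr_add[symmetric] algebra_simps)
      finally show ?thesis using True p0 V by (simp add: ennreal_mult)
    next
      case False
      then have "(\<integral>\<^sup>+\<xi>. indicator (- cball (0::'a) R) \<xi> * indicator (cball 0 \<rho>) \<xi> \<partial>lborel) = (\<integral>\<^sup>+\<xi>. 0 \<partial>(lborel::'a measure))"
        by (intro nn_integral_cong) (auto simp: indicator_def)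
      then show ?thesis by simp
    qed
  qed
  also have "\<dots> = ennreal (p * V) * ennreal (R powr (d-p-1+1) / (- (d-p-1+1)))"
    using p R unfolding d_def[symmetric] by (subst nn_integral_cmult, simp, subst nn_integral_powr_to_inf) auto
  also have "\<dots> = ennreal (p * V / (p - d) * R powr (d - p))"
    using p0 V p unfolding d_def[symmetric] by (simp add: ennreal_mult[symmetric])
  finally show ?thesis by (simp add: d_def V_def)
qed

text \<open>The borderline exponent: up to the volume of the unit ball, the layer density becomes d
  / \<rho>, whose integral from \<open>R\<close> to 1 is the logarithm. Beyond radius 1 the mass no
  longer grows, and the tail gives the summand 1.\<close>

lemma nn_integral_norm_powr_annulus:
  assumes R: "0 < R" "R \<le> 1"
  shows "(\<integral>\<^sup>+\<xi>. ennreal (norm \<xi> powr (- real DIM('a))) * indicator (cball 0 1 - cball (0::'a::euclidean_space) R) \<xi> \<partial>lborel) \<le>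
    ennreal (unit_ball_vol (real DIM('a)) * (1 + real DIM('a) * ln (1 / R)))"
proof -
  define d where "d = real DIM('a)"
  define V where "V = unit_ball_vol d"
  have V: "0 \<le> V" and d: "0 < d" by (simp_all add: V_def d_def)
  have ball: "emeasure lborel (cball (0::'a) \<rho>) = ennreal (V * \<rho> powr d)" if "0 < \<rho>" for \<rho>
    using that by (subst emeasure_cball) (auto simp: V_def d_def powr_realpow)
  let ?h = "indicator (cball 0 1 - cball (0::'a) R) :: 'a \<Rightarrow> ennreal"
  have "(\<integral>\<^sup>+\<xi>. ennreal (norm \<xi> powr (-d)) * ?h \<xi> \<partial>lborel) \<le>
    (\<integral>\<^sup>+\<rho>. ennreal (d * \<rho> powr (-d-1)) * indicator {0<..} \<rho> * (\<integral>\<^sup>+\<xi>. ?h \<xi> * indicator (cball 0 \<rho>) \<xi> \<partial>lborel) \<partial>lborel)"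
    by (intro nn_integral_norm_powr_layer_cake d borel_measurable_indicator) auto
  also have "\<dots> \<le> (\<integral>\<^sup>+\<rho>. ennreal (d * V) * (ennreal (1 / \<rho>) * indicator {R..1} \<rho>) + ennreal (d * V) * (ennreal (\<rho> powr (-d-1)) * indicator {1..} \<rho>) \<partial>lborel)"
  proof (intro nn_integral_mono)
    fix \<rho> :: real
    show "ennreal (d * \<rho> powr (-d-1)) * indicator {0<..} \<rho> * (\<integral>\<^sup>+\<xi>. ?h \<xi> * indicator (cball 0 \<rho>) \<xi> \<partial>lborel)
      \<le> ennreal (d * V) * (ennreal (1 / \<rho>) * indicator {R..1} \<rho>) + ennreal (d * V) * (ennreal (\<rho> powr (-d-1)) * indicator {1..} \<rho>)" (is "?l \<le> ?a + ?b")
    proof -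
      have le: "(\<integral>\<^sup>+\<xi>. ?h \<xi> * indicator (cball 0 \<rho>) \<xi> \<partial>lborel) \<le> emeasure lborel (cball (0::'a) x)"
        if "x = 1 \<or> x = \<rho>" for x
      proof -
        have "(\<integral>\<^sup>+\<xi>. ?h \<xi> * indicator (cball 0 \<rho>) \<xi> \<partial>lborel) \<le> (\<integral>\<^sup>+\<xi>. indicator (cball (0::'a) x) \<xi> \<partial>lborel)"
          using that by (intro nn_integral_mono) (auto simp: indicator_def)
        then show ?thesis by simp
      qed
      consider "\<rho> < R" | "R \<le> \<rho>" "\<rho> \<le> 1" | "1 < \<rho>" by linarith
      then show ?thesis
      proof cases
        case 1
        then have "(\<integral>\<^sup>+\<xi>. ?h \<xi> * indicator (cball 0 \<rho>) \<xi> \<partial>lborel) = (\<integral>\<^sup>+\<xi>. 0 \<partial>(lborel::'a measure))"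
          by (intro nn_integral_cong) (auto simp: indicator_def)
        then show ?thesis by simp
      next
        case 2
        have "?l \<le> ennreal (d * \<rho> powr (-d-1)) * ennreal (V * \<rho> powr d)"
          using le[of \<rho>] 2 R by (simp add: ball mult_left_mono)
        also have "\<dots> = ennreal (d * V * (\<rho> powr (-d-1) * \<rho> powr d))"
          using d V by (simp add: ennreal_mult[symmetric] mult_ac)
        also have "\<rho> powr (-d-1) * \<rho> powr d = 1 / \<rho>"
          using 2 R by (simp add: powr_add[symmetric] powr_minus divide_inverse)
        also have "ennreal (d * V * (1 / \<rho>)) = ?a"
          using 2 R d V by (subst ennreal_mult) auto
        finally show ?thesis by (rule order_trans) simp
      next
        case 3
        have "?l \<le> ennreal (d * \<rho> powr (-d-1)) * ennreal (V * 1 powr d)"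
          using le[of 1] 3 ball[of 1] by (simp add: mult_left_mono)
        also have "\<dots> = ennreal (d * V * \<rho> powr (-d-1))"
          using d V by (simp add: ennreal_mult[symmetric] mult_ac)
        also have "\<dots> = ?b"
          using 3 d V by (simp add: ennreal_mult)
        finally show ?thesis by (rule order_trans) simp
      qed
    qed
  qed
  also have "\<dots> = ennreal (d * V) * (\<integral>\<^sup>+\<rho>. ennreal (1 / \<rho>) * indicator {R..1} \<rho> \<partial>lborel) +
      ennreal (d * V) * (\<integral>\<^sup>+\<rho>. ennreal (\<rho> powr (-d-1)) * indicator {1..} \<rho> \<partial>lborel)"
    by (subst nn_integral_add) (auto simp: nn_integral_cmult)
  also have "(\<integral>\<^sup>+\<rho>. ennreal (1 / \<rho>) * indicator {R..1} \<rho> \<partial>lborel) = ennreal (ln 1 - ln R)"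
    by (rule nn_integral_FTC_Icc) (use R in \<open>auto intro!: derivative_eq_intros\<close>)
  also have "(\<integral>\<^sup>+\<rho>. ennreal (\<rho> powr (-d-1)) * indicator {1..} \<rho> \<partial>lborel) = ennreal (1 powr (-d-1+1) / (- (-d-1+1)))"
    by (rule nn_integral_powr_to_inf) (use d in auto)
  also have "ennreal (d * V) * ennreal (ln 1 - ln R) + ennreal (d * V) * ennreal (1 powr (-d-1+1) / (- (-d-1+1)))
     = ennreal (d * V * (ln 1 - ln R) + d * V * (1 / d))"
    using d V R by (subst ennreal_mult_add_mult) auto
  also have "d * V * (ln 1 - ln R) + d * V * (1 / d) = V * (1 + d * ln (1 / R))"
    using d R by (simp add: ln_div algebra_simps)
  finally show ?thesis by (simp add: d_def V_def)
qed

section \<open>Weighted estimates of the transform\<close>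

lemma Lp_measurable: "f \<in> Lp_space p \<Longrightarrow> f \<in> borel_measurable borel"
  by (simp add: Lp_space_def)

lemma unit_ball_emeasure:
  fixes R :: real assumes "0 < R"
  shows "emeasure lborel (cball (0::'a::euclidean_space) R) = ennreal (unit_ball_vol (real DIM('a)) * R powr real DIM('a))"
  using assms by (subst emeasure_cball) (auto simp: powr_realpow)

text \<open>The transform of the tall part is bounded by a multiple of its L1 norm \<open>N\<close>,
  so its mass on the ball is quadratic in \<open>N\<close>. One factor \<open>N\<close> is replaced
  by \<tau>^(1-r), by the normalization of \<open>f\<close>; the level \<tau> = R^(d/r) is the one
  for which \<tau>^(1-r) R^d = \<tau>. The result is linear in \<open>N\<close>, hence an integral
  to which Fubini applies later.\<close>

lemma sq_mass_on_ball_le: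
  fixes f F :: "'a::euclidean_space \<Rightarrow> complex"
  assumes r: "1 < r" "r < 2" and f: "f \<in> Lp_space 2" "f \<in> Lp_space r" "(\<integral>x. cmod (f x) powr r \<partial>lborel) \<le> 1"
    and F: "is_fourier_L2 f F" and R: "0 < R"
  defines "a \<equiv> real DIM('a) / r"
  shows "(\<integral>\<^sup>+\<xi>. ennreal ((cmod (F \<xi>))\<^sup>2) * indicator (cball 0 R) \<xi> \<partial>lborel) \<le>
    ennreal (2 * (fourier_const TYPE('a))\<^sup>2 * unit_ball_vol (real DIM('a)) * R powr a) *
      (\<integral>\<^sup>+x. ennreal (cmod (f x)) * (if R powr a < cmod (f x) then 1 else 0) \<partial>lborel) +
    2 * (\<integral>\<^sup>+x. ennreal ((cmod (f x))\<^sup>2) * (if cmod (f x) \<le> R powr a then 1 else 0) \<partial>lborel)"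
proof -
  define d where "d = real DIM('a)"
  define V where "V = unit_ball_vol d"
  define c where "c = fourier_const TYPE('a)"
  have c: "0 < c" by (simp add: c_def)
  have V: "0 \<le> V" by (simp add: V_def d_def)
  note [measurable] = Lp_measurable[OF f(1)] L2_measurable[OF is_fourier_L2_D(2)[OF F]]
  define \<tau> where "\<tau> = R powr a"
  have \<tau>: "0 < \<tau>" using R by (simp add: \<tau>_def)
  define f1 where "f1 x = (if \<tau> < cmod (f x) then f x else 0)" for x
  define f2 where "f2 x = (if cmod (f x) \<le> \<tau> then f x else 0)" for x
  have [measurable]: "f1 \<in> borel_measurable borel" "f2 \<in> borel_measurable borel"
    unfolding f1_def[abs_def] f2_def[abs_def] by measurable
  have f1: "f1 \<in> Lp_space 2" by (rule L2_dominated[OF f(1)]) (auto simp: f1_def)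
  \<comment> \<open>Above the level \<tau> the first power is dominated by the power
    \<open>r\<close> at the cost of \<tau>^(1-r), because 1 - r < 0.\<close>
  have f1_le: "cmod (f1 x) \<le> \<tau> powr (1 - r) * cmod (f x) powr r" for x
  proof (cases "\<tau> < cmod (f x)")
    case True
    have "cmod (f x) = cmod (f x) powr r * cmod (f x) powr (1 - r)"
      using True \<tau> by (simp add: powr_add[symmetric])
    also have "\<dots> \<le> cmod (f x) powr r * \<tau> powr (1 - r)"
      using True \<tau> r by (intro mult_left_mono powr_mono2') auto
    finally show ?thesis using True by (simp add: f1_def mult.commute)
  qed (simp add: f1_def)
  have int_r: "integrable lborel (\<lambda>x. \<tau> powr (1 - r) * cmod (f x) powr r)"
    using f(2) by (simp add: Lp_space_def)
  have f1i: "integrable lborel f1"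
    by (rule Bochner_Integration.integrable_bound[OF int_r]) (auto intro!: AE_I2 order_trans[OF f1_le])
  define N where "N = (\<integral>x. cmod (f1 x) \<partial>lborel)"
  have N0: "0 \<le> N" by (simp add: N_def)
  have N1: "N \<le> \<tau> powr (1 - r)"
  proof -
    have "N \<le> (\<integral>x. \<tau> powr (1 - r) * cmod (f x) powr r \<partial>lborel)"
      unfolding N_def by (intro integral_mono integrable_norm f1i int_r f1_le)
    also have "\<dots> \<le> \<tau> powr (1 - r) * 1"
      unfolding integral_mult_right_zero by (intro mult_left_mono f(3)) simp
    finally show ?thesis by simp
  qed
  have Nnn: "ennreal N = (\<integral>\<^sup>+x. ennreal (cmod (f x)) * (if \<tau> < cmod (f x) then 1 else 0) \<partial>lborel)"
    unfolding N_def
    by (subst nn_integral_eq_integral[OF integrable_norm[OF f1i], symmetric])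
       (auto intro!: nn_integral_cong simp: f1_def)
  define F1 where "F1 = fourier_integral f1"
  have [measurable]: "F1 \<in> borel_measurable borel" unfolding F1_def by measurable
  have F1: "is_fourier_L2 f1 F1" unfolding F1_def by (rule is_fourier_L2_fourier_integral[OF f1 f1i])
  have "(\<lambda>x. f x - f1 x) = f2" by (auto simp: f1_def f2_def fun_eq_iff)
  then have F2: "is_fourier_L2 f2 (\<lambda>\<xi>. F \<xi> - F1 \<xi>)"
    using is_fourier_L2_diff[OF F F1] by simp
  have n2: "sq_mass (\<lambda>\<xi>. F \<xi> - F1 \<xi>) = sq_mass f2"
    using is_fourier_L2_norm[OF F2] by (simp add: sq_mass_eq is_fourier_L2_D[OF F2])
  have "(\<integral>\<^sup>+\<xi>. ennreal ((cmod (F \<xi>))\<^sup>2) * indicator (cball 0 R) \<xi> \<partial>lborel) \<le>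
     (\<integral>\<^sup>+\<xi>. ennreal (2 * (c * N)\<^sup>2) * indicator (cball 0 R) \<xi> + 2 * ennreal ((cmod (F \<xi> - F1 \<xi>))\<^sup>2) \<partial>lborel)"
  proof (intro nn_integral_mono)
    fix \<xi> :: 'a
    have "cmod (F1 \<xi>) \<le> c * N" unfolding F1_def c_def N_def by (rule fourier_integral_bound)
    then have F1b: "(cmod (F1 \<xi>))\<^sup>2 \<le> (c * N)\<^sup>2" by (rule power_mono) simp
    have "(cmod (F \<xi>))\<^sup>2 \<le> (cmod (F1 \<xi>) + cmod (F \<xi> - F1 \<xi>))\<^sup>2"
      using norm_triangle_ineq[of "F1 \<xi>" "F \<xi> - F1 \<xi>"] by (intro power_mono) auto
    also have "\<dots> \<le> 2 * (cmod (F1 \<xi>))\<^sup>2 + 2 * (cmod (F \<xi> - F1 \<xi>))\<^sup>2"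
      using sum_squares_bound[of "cmod (F1 \<xi>)" "cmod (F \<xi> - F1 \<xi>)"] by (simp add: power2_sum)
    also have "\<dots> \<le> 2 * (c * N)\<^sup>2 + 2 * (cmod (F \<xi> - F1 \<xi>))\<^sup>2" using F1b by simp
    finally have "ennreal ((cmod (F \<xi>))\<^sup>2) \<le> ennreal (2 * (c * N)\<^sup>2 + 2 * (cmod (F \<xi> - F1 \<xi>))\<^sup>2)"
      by (rule ennreal_leI)
    also have "\<dots> = ennreal (2 * (c * N)\<^sup>2) + 2 * ennreal ((cmod (F \<xi> - F1 \<xi>))\<^sup>2)"
      by (simp add: ennreal_plus ennreal_mult)
    finally show "ennreal ((cmod (F \<xi>))\<^sup>2) * indicator (cball 0 R) \<xi> \<le>
       ennreal (2 * (c * N)\<^sup>2) * indicator (cball 0 R) \<xi> + 2 * ennreal ((cmod (F \<xi> - F1 \<xi>))\<^sup>2)"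
      by (auto simp: indicator_def)
  qed
  also have "\<dots> = ennreal (2 * (c * N)\<^sup>2) * emeasure lborel (cball (0::'a) R) + 2 * sq_mass f2"
  proof -
    have [measurable]: "cball (0::'a) R \<in> sets borel" by simp
    have "(\<integral>\<^sup>+\<xi>. ennreal (2 * (c * N)\<^sup>2) * indicator (cball (0::'a) R) \<xi> \<partial>lborel) = ennreal (2 * (c * N)\<^sup>2) * emeasure lborel (cball (0::'a) R)"
      by (rule nn_integral_cmult_indicator) simp
    moreover have "(\<integral>\<^sup>+\<xi>. 2 * ennreal ((cmod (F \<xi> - F1 \<xi>))\<^sup>2) \<partial>lborel) = 2 * sq_mass f2"
      unfolding n2[symmetric] by (simp add: sq_mass_def nn_integral_cmult)
    ultimately show ?thesis by (subst nn_integral_add) (auto intro!: borel_measurable_times_ennreal borel_measurable_indicator)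
  qed
  also have "ennreal (2 * (c * N)\<^sup>2) * emeasure lborel (cball (0::'a) R) \<le> ennreal (2 * c\<^sup>2 * V * \<tau>) * ennreal N"
  proof -
    have "ennreal (2 * (c * N)\<^sup>2) * emeasure lborel (cball (0::'a) R) = ennreal (2 * (c * N)\<^sup>2 * (V * R powr d))"
      using V unfolding unit_ball_emeasure[OF R] V_def d_def by (simp add: ennreal_mult)
    also have "\<dots> \<le> ennreal (2 * c\<^sup>2 * V * \<tau> * N)"
    proof (rule ennreal_leI)
      have ad: "\<tau> powr (1 - r) * R powr d = \<tau>"
        using r R by (simp add: \<tau>_def powr_powr powr_add[symmetric] a_def d_def[symmetric] field_simps)
      have "2 * (c * N)\<^sup>2 * (V * R powr d) = 2 * c\<^sup>2 * V * N * (N * R powr d)"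
        by (simp add: power2_eq_square)
      also have "\<dots> \<le> 2 * c\<^sup>2 * V * N * (\<tau> powr (1 - r) * R powr d)"
        using N1 N0 V by (intro mult_left_mono mult_right_mono) auto
      finally show "2 * (c * N)\<^sup>2 * (V * R powr d) \<le> 2 * c\<^sup>2 * V * \<tau> * N"
        unfolding ad by (simp add: mult_ac)
    qed
    also have "\<dots> = ennreal (2 * c\<^sup>2 * V * \<tau>) * ennreal N"
      using V \<tau> N0 by (simp add: ennreal_mult)
    finally show ?thesis .
  qed
  also have "sq_mass f2 = (\<integral>\<^sup>+x. ennreal ((cmod (f x))\<^sup>2) * (if cmod (f x) \<le> \<tau> then 1 else 0) \<partial>lborel)"
    unfolding sq_mass_def by (intro nn_integral_cong) (auto simp: f2_def)
  finally show ?thesis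
    unfolding Nnn by (simp add: c_def V_def d_def \<tau>_def add_right_mono)
qed

text \<open>Pitt's inequality: the truncation level of \<open>f\<close> is chosen depending on the radius \<open>R\<close> of the
  layer-cake decomposition of the weight, the upper part being estimated by \<open>L\<^sup>1 \<rightarrow> L\<^sup>\<infinity>\<close> and
  the lower one by Plancherel.\<close>

lemma Pitt_inequality_normalized:
  fixes f F :: "'a::euclidean_space \<Rightarrow> complex"
  assumes r: "1 < r" "r < 2" and f: "f \<in> Lp_space 2" "f \<in> Lp_space r" "(\<integral>x. cmod (f x) powr r \<partial>lborel) \<le> 1"
    and F: "is_fourier_L2 f F"
  defines "p \<equiv> real DIM('a) * (2 - r) / r"
  shows "(\<integral>\<^sup>+\<xi>. ennreal (norm \<xi> powr (-p)) * ennreal ((cmod (F \<xi>))\<^sup>2) \<partial>lborel) \<le>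
    ennreal (2 * (fourier_const TYPE('a))\<^sup>2 * unit_ball_vol (real DIM('a)) * (p / (real DIM('a) - real DIM('a) / r)) + 2)"
proof -
  define d where "d = real DIM('a)"
  define a where "a = d / r"
  define C where "C = 2 * (fourier_const TYPE('a))\<^sup>2 * unit_ball_vol d"
  have d: "0 < d" by (simp add: d_def)
  have C: "0 \<le> C" by (simp add: C_def d_def)
  have p: "0 < p" using r d by (simp add: p_def d_def[symmetric])
  have a: "0 < a" using r d by (simp add: a_def)
  have dar: "d = a * r" and par: "p = a * (2 - r)"
    using r by (simp_all add: a_def p_def d_def[symmetric])
  have ap: "a - p = d - a" unfolding par by (simp add: dar algebra_simps)
  have ap2: "0 < d - a" using a r by (simp add: dar)
  \<comment> \<open>These ratios make both integrals over the radius come out as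
    \<open>cmod (f x) powr r\<close>.\<close>
  have "d - a = a * (r - 1)" by (simp add: dar algebra_simps)
  then have da: "(d - a) / a = r - 1" "p / a = 2 - r"
    using a by (simp_all add: par)
  note [measurable] = Lp_measurable[OF f(1)] L2_measurable[OF is_fourier_L2_D(2)[OF F]]
  define k1 where "k1 R x = ennreal (p * C * R powr (d - a - 1)) * indicator {0<..} R * (ennreal (cmod (f x)) * (if R powr a < cmod (f x) then 1 else 0))" for R x
  define k2 where "k2 R x = ennreal (2 * p * R powr (-p-1)) * indicator {0<..} R * (ennreal ((cmod (f x))\<^sup>2) * (if cmod (f x) \<le> R powr a then 1 else 0))" for R x
  have [measurable]: "case_prod k1 \<in> borel_measurable (lborel \<Otimes>\<^sub>M lborel)" "case_prod k2 \<in> borel_measurable (lborel \<Otimes>\<^sub>M lborel)"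
    unfolding k1_def k2_def by measurable
  have "(\<integral>\<^sup>+\<xi>. ennreal (norm \<xi> powr (-p)) * ennreal ((cmod (F \<xi>))\<^sup>2) \<partial>lborel) \<le>
    (\<integral>\<^sup>+R. ennreal (p * R powr (-p-1)) * indicator {0<..} R * (\<integral>\<^sup>+\<xi>. ennreal ((cmod (F \<xi>))\<^sup>2) * indicator (cball 0 R) \<xi> \<partial>lborel) \<partial>lborel)"
    by (rule nn_integral_norm_powr_layer_cake[OF p]) measurable
  also have "\<dots> \<le> (\<integral>\<^sup>+R. (\<integral>\<^sup>+x. k1 R x \<partial>lborel) + (\<integral>\<^sup>+x. k2 R x \<partial>lborel) \<partial>lborel)"
  proof (intro nn_integral_mono)
    fix R :: real
    show "ennreal (p * R powr (-p-1)) * indicator {0<..} R * (\<integral>\<^sup>+\<xi>. ennreal ((cmod (F \<xi>))\<^sup>2) * indicator (cball 0 R) \<xi> \<partial>lborel)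
      \<le> (\<integral>\<^sup>+x. k1 R x \<partial>lborel) + (\<integral>\<^sup>+x. k2 R x \<partial>lborel)"
    proof (cases "0 < R")
      case R: True
      let ?A = "\<integral>\<^sup>+x. ennreal (cmod (f x)) * (if R powr a < cmod (f x) then 1 else 0) \<partial>lborel"
      let ?B = "\<integral>\<^sup>+x. ennreal ((cmod (f x))\<^sup>2) * (if cmod (f x) \<le> R powr a then 1 else 0) \<partial>lborel"
      have "ennreal (p * R powr (-p-1)) * indicator {0<..} R * (\<integral>\<^sup>+\<xi>. ennreal ((cmod (F \<xi>))\<^sup>2) * indicator (cball 0 R) \<xi> \<partial>lborel)
        \<le> ennreal (p * R powr (-p-1)) * (ennreal (C * R powr a) * ?A + 2 * ?B)"
        using sq_mass_on_ball_le[OF r f F R] R by (simp add: mult_left_mono C_def a_def d_def)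
      also have "\<dots> = ennreal (p * R powr (-p-1)) * ennreal (C * R powr a) * ?A + ennreal (p * R powr (-p-1)) * 2 * ?B"
        by (simp add: distrib_left mult.assoc)
      also have "ennreal (p * R powr (-p-1)) * ennreal (C * R powr a) = ennreal (p * C * R powr (d - a - 1))"
      proof -
        have "R powr (-p-1) * R powr a = R powr (d - a - 1)"
          unfolding ap[symmetric] by (simp add: powr_add[symmetric] algebra_simps)
        then show ?thesis using p C by (simp add: ennreal_mult[symmetric] mult_ac)
      qed
      also have "ennreal (p * R powr (-p-1)) * 2 = ennreal (2 * p * R powr (-p-1))"
        using p by (simp add: ennreal_mult mult_ac)
      also have "ennreal (p * C * R powr (d - a - 1)) * ?A = (\<integral>\<^sup>+x. k1 R x \<partial>lborel)"
        using R unfolding k1_def by (simp add: nn_integral_cmult[symmetric])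
      also have "ennreal (2 * p * R powr (-p-1)) * ?B = (\<integral>\<^sup>+x. k2 R x \<partial>lborel)"
        using R unfolding k2_def by (simp add: nn_integral_cmult[symmetric])
      finally show ?thesis .
    qed simp
  qed
  also have "\<dots> = (\<integral>\<^sup>+x. (\<integral>\<^sup>+R. k1 R x \<partial>lborel) \<partial>lborel) + (\<integral>\<^sup>+x. (\<integral>\<^sup>+R. k2 R x \<partial>lborel) \<partial>lborel)"
    by (simp add: nn_integral_add lborel_pair.Fubini'[of k1] lborel_pair.Fubini'[of k2])
  also have "(\<integral>\<^sup>+x. (\<integral>\<^sup>+R. k1 R x \<partial>lborel) \<partial>lborel) \<le> (\<integral>\<^sup>+x. ennreal (C * (p / (d - a))) * ennreal (cmod (f x) powr r) \<partial>lborel)"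
  proof (intro nn_integral_mono)
    fix x
    \<comment> \<open>For fixed \<open>x\<close> the tall part is present only for radii up to
      \<open>u powr (1/a)\<close>; the integral converges at 0 because d - a > 0.\<close>
    define u where "u = cmod (f x)"
    have u: "0 \<le> u" by (simp add: u_def)
    have "(\<integral>\<^sup>+R. k1 R x \<partial>lborel) \<le> (\<integral>\<^sup>+R. ennreal (p * C * u) * (ennreal (R powr (d - a - 1)) * indicator {0..u powr (1/a)} R) \<partial>lborel)"
    proof (intro nn_integral_mono)
      fix R :: real
      have "R \<le> u powr (1/a)" if "0 < R" "R powr a < u"
      proof -
        have "R = (R powr a) powr (1/a)" using that a by (simp add: powr_powr)
        also have "\<dots> \<le> u powr (1/a)" using that a by (intro powr_mono2) auto
        finally show ?thesis .
      qed
      then show "k1 R x \<le> ennreal (p * C * u) * (ennreal (R powr (d - a - 1)) * indicator {0..u powr (1/a)} R)"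
        using p C u by (auto simp: k1_def u_def[symmetric] indicator_def ennreal_mult[symmetric] mult_ac)
    qed
    also have "\<dots> = ennreal (p * C * u) * ennreal ((u powr (1/a)) powr (d - a) / (d - a))"
      using ap2 by (subst nn_integral_cmult, simp, subst nn_integral_powr_from_0) auto
    also have "\<dots> = ennreal (C * (p / (d - a)) * (u * u powr (r - 1)))"
      using p C u ap2 da(1) by (simp add: ennreal_mult[symmetric] powr_powr)
    also have "u * u powr (r - 1) = u powr r"
      using u r by (cases "u = 0") (auto simp: powr_diff)
    finally show "(\<integral>\<^sup>+R. k1 R x \<partial>lborel) \<le> ennreal (C * (p / (d - a))) * ennreal (cmod (f x) powr r)"
      using p C ap2 by (simp add: u_def ennreal_mult[symmetric])
  qed
  also have "\<dots> = ennreal (C * (p / (d - a))) * (\<integral>\<^sup>+x. ennreal (cmod (f x) powr r) \<partial>lborel)"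
    by (rule nn_integral_cmult) measurable
  also have "(\<integral>\<^sup>+x. (\<integral>\<^sup>+R. k2 R x \<partial>lborel) \<partial>lborel) \<le> (\<integral>\<^sup>+x. 2 * ennreal (cmod (f x) powr r) \<partial>lborel)"
  proof (intro nn_integral_mono)
    fix x
    \<comment> \<open>Here the radii start at \<open>u powr (1/a)\<close>, and the integral
      converges at infinity because p > 0; at u = 0 the integrand vanishes.\<close>
    define u where "u = cmod (f x)"
    show "(\<integral>\<^sup>+R. k2 R x \<partial>lborel) \<le> 2 * ennreal (cmod (f x) powr r)"
    proof (cases "u = 0")
      case False
      then have u: "0 < u" by (simp add: u_def)
      have "(\<integral>\<^sup>+R. k2 R x \<partial>lborel) \<le> (\<integral>\<^sup>+R. ennreal (2 * p * u\<^sup>2) * (ennreal (R powr (-p-1)) * indicator {u powr (1/a)..} R) \<partial>lborel)"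
      proof (intro nn_integral_mono)
        fix R :: real
        have "u powr (1/a) \<le> R" if "0 < R" "u \<le> R powr a"
        proof -
          have "u powr (1/a) \<le> (R powr a) powr (1/a)" using that a u by (intro powr_mono2) auto
          also have "\<dots> = R" using that a by (simp add: powr_powr)
          finally show ?thesis .
        qed
        then show "k2 R x \<le> ennreal (2 * p * u\<^sup>2) * (ennreal (R powr (-p-1)) * indicator {u powr (1/a)..} R)"
          using p u by (auto simp: k2_def u_def[symmetric] indicator_def ennreal_mult[symmetric] mult_ac)
      qed
      also have "\<dots> = ennreal (2 * p * u\<^sup>2) * ennreal ((u powr (1/a)) powr (-p) / p)"
        using p u by (subst nn_integral_cmult, simp, subst nn_integral_powr_to_inf) auto
      also have "\<dots> = ennreal (2 * (u powr 2 * u powr (- (p / a))))"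
        using p u by (simp add: ennreal_mult[symmetric] powr_powr)
      also have "u powr 2 * u powr (- (p / a)) = u powr r"
        unfolding da(2) by (simp add: powr_add[symmetric])
      finally show ?thesis by (simp add: u_def ennreal_mult)
    qed (simp add: k2_def u_def)
  qed
  also have "\<dots> = 2 * (\<integral>\<^sup>+x. ennreal (cmod (f x) powr r) \<partial>lborel)"
    by (rule nn_integral_cmult) measurable
  also have "(\<integral>\<^sup>+x. ennreal (cmod (f x) powr r) \<partial>lborel) = ennreal (\<integral>x. cmod (f x) powr r \<partial>lborel)"
    using f(2) by (intro nn_integral_eq_integral) (auto simp: Lp_space_def)
  also have "ennreal (C * (p / (d - a))) * ennreal (\<integral>x. cmod (f x) powr r \<partial>lborel) + 2 * ennreal (\<integral>x. cmod (f x) powr r \<partial>lborel)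
     \<le> ennreal (C * (p / (d - a))) * ennreal 1 + 2 * ennreal 1"
    using f(3) by (intro add_mono mult_left_mono ennreal_leI) auto
  also have "\<dots> = ennreal (C * (p / (d - a)) + 2)"
    using C p ap2 by (simp add: ennreal_plus)
  finally show ?thesis by (simp add: C_def d_def a_def add_mono)
qed

text \<open>Both sides are quadratic in \<open>f\<close>, so the normalized form is applied to
  \<open>f\<close> divided by its norm.\<close>

theorem Pitt_inequality:
  assumes r: "1 < r" "r < 2"
  shows "\<exists>C>0. \<forall>(f :: 'a::euclidean_space \<Rightarrow> complex) F. f \<in> Lp_space 2 \<longrightarrow> f \<in> Lp_space r \<longrightarrow> is_fourier_L2 f F \<longrightarrow>
    (\<integral>\<^sup>+\<xi>. ennreal (norm \<xi> powr (- (real DIM('a) * (2 - r) / r))) * ennreal ((cmod (F \<xi>))\<^sup>2) \<partial>lborel)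
      \<le> ennreal (C * (Lp_norm r f)\<^sup>2)"
proof -
  define p where "p = real DIM('a) * (2 - r) / r"
  define C where "C = 2 * (fourier_const TYPE('a))\<^sup>2 * unit_ball_vol (real DIM('a)) * (p / (real DIM('a) - real DIM('a) / r)) + 2"
  have C: "0 < C"
  proof -
    have "0 \<le> real DIM('a) - real DIM('a) / r" "0 \<le> p" using r by (auto simp: p_def field_simps)
    then have "0 \<le> 2 * (fourier_const TYPE('a))\<^sup>2 * unit_ball_vol (real DIM('a)) * (p / (real DIM('a) - real DIM('a) / r))"
      by (intro mult_nonneg_nonneg divide_nonneg_nonneg) auto
    then show ?thesis by (simp add: C_def)
  qed
  show ?thesis
  proof (intro exI[of _ C] conjI[of "0 < C"] allI impI)
    show "0 < C" by fact
    fix f F :: "'a \<Rightarrow> complex"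
    assume f: "f \<in> Lp_space 2" "f \<in> Lp_space r" and F: "is_fourier_L2 f F"
    note [measurable] = Lp_measurable[OF f(1)] L2_measurable[OF is_fourier_L2_D(2)[OF F]]
    define N where "N = Lp_norm r f"
    define m where "m = (\<integral>x. cmod (f x) powr r \<partial>lborel)"
    have m0: "0 \<le> m" by (simp add: m_def)
    have N: "N = m powr (1 / r)" by (simp add: N_def Lp_norm_def m_def)
    show "(\<integral>\<^sup>+\<xi>. ennreal (norm \<xi> powr (- (real DIM('a) * (2 - r) / r))) * ennreal ((cmod (F \<xi>))\<^sup>2) \<partial>lborel)
      \<le> ennreal (C * (Lp_norm r f)\<^sup>2)"
    \<comment> \<open>Division by the norm is impossible for m = 0; then \<open>f\<close>, and by
      isometry \<open>F\<close>, vanishes almost everywhere.\<close>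
    proof (cases "m = 0")
      case True
      have "AE x in lborel. cmod (f x) powr r = 0"
        using True f(2) by (subst integral_nonneg_eq_0_iff_AE[symmetric]) (auto simp: m_def Lp_space_def)
      then have "AE x in lborel. f x = 0" by eventually_elim simp
      then have "Lp_norm 2 F = 0" using Lp_norm_2_eq_0_iff[OF f(1)] is_fourier_L2_norm[OF F] by simp
      then have "AE \<xi> in lborel. F \<xi> = 0" using Lp_norm_2_eq_0_iff is_fourier_L2_D(2)[OF F] by blast
      then have "(\<integral>\<^sup>+\<xi>. ennreal (norm \<xi> powr (- (real DIM('a) * (2 - r) / r))) * ennreal ((cmod (F \<xi>))\<^sup>2) \<partial>lborel) = (\<integral>\<^sup>+\<xi>. 0 \<partial>(lborel::'a measure))"
        by (intro nn_integral_cong_AE) auto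
      then show ?thesis by simp
    next
      case False
      then have m: "0 < m" using m0 by simp
      then have N0: "0 < N" by (simp add: N)
      have Nr: "N powr r = m" using r m by (simp add: N powr_powr)
      define k where "k = complex_of_real (1 / N)"
      have k: "cmod k = 1 / N" using N0 by (simp add: k_def norm_divide)
      have pw: "cmod (k * f x) powr r = cmod (f x) powr r / m" for x
        using N0 by (simp add: norm_mult k powr_divide Nr)
      have g: "(\<lambda>x. k * f x) \<in> Lp_space r" "(\<integral>x. cmod (k * f x) powr r \<partial>lborel) \<le> 1"
        using f(2) m unfolding Lp_space_def mem_Collect_eq pw by (auto simp only: integral_divide_zero m_def[symmetric]) auto
      have "(\<integral>\<^sup>+\<xi>. ennreal (norm \<xi> powr (-p)) * ennreal ((cmod (k * F \<xi>))\<^sup>2) \<partial>lborel) \<le> ennreal C"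
        unfolding p_def C_def
        by (rule Pitt_inequality_normalized[OF r L2_scale[OF f(1)] g is_fourier_L2_scale[OF F]])
      then have "ennreal (N\<^sup>2) * (\<integral>\<^sup>+\<xi>. ennreal (norm \<xi> powr (-p)) * ennreal ((cmod (k * F \<xi>))\<^sup>2) \<partial>lborel) \<le> ennreal (N\<^sup>2) * ennreal C"
        by (rule mult_left_mono) simp
      also have "\<dots> = ennreal (C * N\<^sup>2)" using C by (simp add: ennreal_mult mult.commute)
      also have "ennreal (N\<^sup>2) * (\<integral>\<^sup>+\<xi>. ennreal (norm \<xi> powr (-p)) * ennreal ((cmod (k * F \<xi>))\<^sup>2) \<partial>lborel)
        = (\<integral>\<^sup>+\<xi>. ennreal (norm \<xi> powr (-p)) * ennreal ((cmod (F \<xi>))\<^sup>2) \<partial>lborel)"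
      proof -
        have "ennreal (N\<^sup>2) * (ennreal (norm \<xi> powr (-p)) * ennreal ((cmod (k * F \<xi>))\<^sup>2)) = ennreal (norm \<xi> powr (-p)) * ennreal ((cmod (F \<xi>))\<^sup>2)" for \<xi>
          using N0 by (simp add: ennreal_mult[symmetric] norm_mult k power_divide power_mult_distrib)
        then show ?thesis by (subst nn_integral_cmult[symmetric]) auto
      qed
      finally show ?thesis by (simp add: p_def N_def)
    qed
  qed
qed

text \<open>The substitute for Pitt's inequality at r = 1, where the weight would be |\<xi>|^(-d),
  not integrable at the origin.\<close>

lemma is_fourier_L2_sup_bound:
  fixes f :: "'a::euclidean_space \<Rightarrow> complex"
  assumes f: "f \<in> Lp_space 2" "f \<in> Lp_space 1" and F: "is_fourier_L2 f F"
  shows "AE \<xi> in lborel. cmod (F \<xi>) \<le> fourier_const TYPE('a) * Lp_norm 1 f"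
proof -
  note [measurable] = Lp_measurable[OF f(1)]
  have int: "integrable lborel f"
    using f(2) unfolding Lp_space_def by (subst integrable_norm_iff[symmetric]) auto
  have "AE \<xi> in lborel. F \<xi> = fourier_integral f \<xi>"
    by (rule is_fourier_L2_unique_AE[OF F is_fourier_L2_fourier_integral[OF f(1) int]])
  then show ?thesis
    by eventually_elim (use fourier_integral_bound[of f] in \<open>simp add: Lp_norm_def\<close>)
qed

section \<open>The equation at a fixed frequency\<close>

lemma nonincreasing_of_deriv_nonpos:
  fixes f :: "real \<Rightarrow> real"
  assumes deriv: "\<And>t. 0 \<le> t \<Longrightarrow> (f has_real_derivative f' t) (at t within {0..})"
    and nonpos: "\<And>t. 0 \<le> t \<Longrightarrow> f' t \<le> 0" and "0 \<le> a" "a \<le> b"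
  shows "f b \<le> f a"
proof (rule DERIV_nonpos_imp_decreasing_open[OF \<open>a \<le> b\<close>])
  show "\<exists>y. DERIV f x :> y \<and> y \<le> 0" if "a < x" for x
  proof -
    have "(f has_real_derivative f' x) (at x)"
      using deriv[of x] that \<open>0 \<le> a\<close> at_within_interior[of x "{0..}"] by simp
    then show ?thesis using nonpos[of x] that \<open>0 \<le> a\<close> by auto
  qed
  have "continuous_on {0..} f"
    by (intro DERIV_continuous_on[where D=f']) (auto intro: deriv)
  then show "continuous_on {a..b} f"
    by (rule continuous_on_subset) (use \<open>0 \<le> a\<close> in auto)
qed

text \<open>\<open>\<phi>\<close> is an explicit antiderivative of a bound, so growth estimates need
  no integral in time. The bound is asked for only inside the interval, which suits bootstrap
  arguments.\<close>

lemma norm_diff_le_of_deriv_bound: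
  fixes f :: "real \<Rightarrow> 'a::real_normed_vector" and \<phi> :: "real \<Rightarrow> real"
  assumes f: "\<And>t. 0 \<le> t \<Longrightarrow> (f has_vector_derivative f' t) (at t within {0..})"
    and \<phi>: "\<And>t. 0 \<le> t \<Longrightarrow> (\<phi> has_real_derivative \<phi>' t) (at t within {0..})"
    and le: "\<And>t. a < t \<Longrightarrow> t < b \<Longrightarrow> norm (f' t) \<le> \<phi>' t" and "0 \<le> a" "a \<le> b"
  shows "norm (f b - f a) \<le> \<phi> b - \<phi> a"
proof (cases "a = b")
  case False
  show ?thesis
  proof (rule differentiable_bound_general)
    show "a < b" using False \<open>a \<le> b\<close> by simp
    have at: "at x within {0..} = at x" if "a < x" for x :: real
      using that \<open>0 \<le> a\<close> by (intro at_within_interior) auto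
    have "continuous_on {0..} f"
      by (rule continuous_on_vector_derivative) (auto intro: f)
    then show "continuous_on {a..b} f"
      by (rule continuous_on_subset) (use \<open>0 \<le> a\<close> in auto)
    have "continuous_on {0..} \<phi>"
      by (intro DERIV_continuous_on[where D=\<phi>']) (auto intro: \<phi>)
    then show "continuous_on {a..b} \<phi>"
      by (rule continuous_on_subset) (use \<open>0 \<le> a\<close> in auto)
    show "(f has_vector_derivative f' x) (at x)" if "a < x" for x
      using f[of x] that \<open>0 \<le> a\<close> at[OF that] by simp
    show "(\<phi> has_vector_derivative \<phi>' x) (at x)" if "a < x" for x
      using \<phi>[of x] that \<open>0 \<le> a\<close> at[OF that] by (simp add: has_real_derivative_iff_has_vector_derivative)
  qed (use le in auto)
qed simp

text \<open>Real-valued on purpose: the coefficients are real, so a complex mode splits into two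
  such solutions, and the energies are polynomials in \<open>w\<close> and
  \<open>w'\<close>.\<close>

definition mode_solution :: "real \<Rightarrow> real \<Rightarrow> (real \<Rightarrow> real) \<Rightarrow> (real \<Rightarrow> real) \<Rightarrow> bool" where
  "mode_solution \<mu> \<rho> w w' \<longleftrightarrow> (\<forall>t\<ge>0.
     (w has_real_derivative w' t) (at t within {0..}) \<and>
     (w' has_real_derivative - (\<rho>\<^sup>2 + \<mu> / (1 + t)\<^sup>2) * w t) (at t within {0..}))"

lemma mode_solution_D:
  assumes "mode_solution \<mu> \<rho> w w'" "0 \<le> t"
  shows "(w has_real_derivative w' t) (at t within {0..})"
    "(w' has_real_derivative - (\<rho>\<^sup>2 + \<mu> / (1 + t)\<^sup>2) * w t) (at t within {0..})"
  using assms by (auto simp: mode_solution_def)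

text \<open>The potential changes \<open>E\<close> at a rate of at most
  \<open>k / (1 + t)\<^sup>2\<close> times \<open>E\<close>, with total integral
  \<open>k / (1 + t0)\<close> from \<open>t0\<close> on. Since \<rho> (1 + t0) \<ge> 1 this is at
  most |\<mu>|; the square root of the energy halves the exponent.\<close>

lemma mode_late_energy:
  assumes sol: "mode_solution \<mu> \<rho> w w'" and \<rho>: "0 < \<rho>" and t: "0 \<le> t0" "t0 \<le> t" "1 \<le> \<rho> * (1 + t0)"
  shows "\<bar>w t\<bar> \<le> exp (\<bar>\<mu>\<bar> / 2) * (\<bar>w t0\<bar> + \<bar>w' t0\<bar> / \<rho>)"
proof -
  define E where "E t = \<rho>\<^sup>2 * (w t)\<^sup>2 + (w' t)\<^sup>2" for t
  \<comment> \<open>The rate comes from 2 \<rho> |w w'| \<le> E; \<open>exp (k / (1 + t))\<close> is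
    the integrating factor.\<close>
  define k where "k = \<bar>\<mu>\<bar> / \<rho>"
  have dE: "((\<lambda>t. E t * exp (k / (1 + t))) has_real_derivative
      (- 2 * \<mu> / (1 + t)\<^sup>2 * w t * w' t - k / (1 + t)\<^sup>2 * E t) * exp (k / (1 + t))) (at t within {0..})"
    if "0 \<le> t" for t
  proof -
    note D = mode_solution_D[OF sol that]
    have 1: "(E has_real_derivative - 2 * \<mu> / (1 + t)\<^sup>2 * w t * w' t) (at t within {0..})"
      unfolding E_def[abs_def] power2_eq_square[of "w _"] power2_eq_square[of "w' _"]
      by (rule DERIV_cong[OF DERIV_add[OF DERIV_cmult[OF DERIV_mult[OF D(1) D(1)]] DERIV_mult[OF D(2) D(2)]]])
         (simp add: algebra_simps)
    have 2: "((\<lambda>t. exp (k / (1 + t))) has_real_derivative exp (k / (1 + t)) * (- (k / (1 + t)\<^sup>2))) (at t within {0..})"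
      using that by (auto intro!: derivative_eq_intros simp: power2_eq_square)
    show ?thesis
      by (rule DERIV_cong[OF DERIV_mult[OF 1 2]]) (simp add: algebra_simps)
  qed
  have neg: "(- 2 * \<mu> / (1 + t)\<^sup>2 * w t * w' t - k / (1 + t)\<^sup>2 * E t) * exp (k / (1 + t)) \<le> 0" if "0 \<le> t" for t
  proof -
    have "2 * \<rho> * \<bar>w t * w' t\<bar> \<le> E t"
      using sum_squares_bound[of "\<rho> * \<bar>w t\<bar>" "\<bar>w' t\<bar>"] by (simp add: E_def power_mult_distrib abs_mult)
    then have "\<bar>\<mu>\<bar> / \<rho> * (2 * \<rho> * \<bar>w t * w' t\<bar>) \<le> k * E t"
      using \<rho> unfolding k_def by (intro mult_left_mono) auto
    then have "2 * \<bar>\<mu> * (w t * w' t)\<bar> \<le> k * E t"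
      using \<rho> by (simp add: abs_mult)
    then have "- 2 * \<mu> * w t * w' t - k * E t \<le> 0"
      using abs_ge_minus_self[of "\<mu> * (w t * w' t)"] by (simp add: mult.assoc)
    then have "(- 2 * \<mu> * w t * w' t - k * E t) / (1 + t)\<^sup>2 \<le> 0"
      by (intro divide_nonpos_nonneg) auto
    then show ?thesis
      by (intro mult_nonpos_nonneg) (auto simp: diff_divide_distrib)
  qed
  have "E t * exp (k / (1 + t)) \<le> E t0 * exp (k / (1 + t0))"
    by (rule nonincreasing_of_deriv_nonpos[OF dE neg t(1,2)])
  have E0: "0 \<le> E t" for t by (simp add: E_def)
  have "E t * 1 \<le> E t * exp (k / (1 + t))"
    using \<rho> t by (intro mult_left_mono E0) (auto simp: k_def)
  also have "\<dots> \<le> E t0 * exp (k / (1 + t0))" by fact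
  also have "\<dots> \<le> E t0 * exp \<bar>\<mu>\<bar>"
  proof (intro mult_left_mono E0)
    have "k / (1 + t0) = \<bar>\<mu>\<bar> / (\<rho> * (1 + t0))" by (simp add: k_def)
    also have "\<dots> \<le> \<bar>\<mu>\<bar> / 1" using t by (intro divide_left_mono) auto
    finally show "exp (k / (1 + t0)) \<le> exp \<bar>\<mu>\<bar>" by simp
  qed
  finally have "E t \<le> E t0 * exp \<bar>\<mu>\<bar>" by simp
  have "(\<rho> * \<bar>w t\<bar>)\<^sup>2 \<le> E t" by (simp add: E_def power_mult_distrib)
  also have "\<dots> \<le> E t0 * exp \<bar>\<mu>\<bar>" by fact
  also have "\<dots> \<le> (\<rho> * \<bar>w t0\<bar> + \<bar>w' t0\<bar>)\<^sup>2 * (exp (\<bar>\<mu>\<bar> / 2))\<^sup>2"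
  proof (intro mult_mono)
    show "E t0 \<le> (\<rho> * \<bar>w t0\<bar> + \<bar>w' t0\<bar>)\<^sup>2"
      using \<rho> by (simp add: E_def power2_sum power_mult_distrib)
    show "exp \<bar>\<mu>\<bar> \<le> (exp (\<bar>\<mu>\<bar> / 2))\<^sup>2" by (simp add: exp_double[symmetric])
  qed auto
  also have "\<dots> = (\<rho> * (exp (\<bar>\<mu>\<bar> / 2) * (\<bar>w t0\<bar> + \<bar>w' t0\<bar> / \<rho>)))\<^sup>2"
  proof -
    have "\<rho> * (exp (\<bar>\<mu>\<bar> / 2) * (\<bar>w t0\<bar> + \<bar>w' t0\<bar> / \<rho>)) = (\<rho> * \<bar>w t0\<bar> + \<bar>w' t0\<bar>) * exp (\<bar>\<mu>\<bar> / 2)"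
    proof -
      have "\<rho> * (e * (a + b / \<rho>)) = (\<rho> * a + b) * e" for a b e
        using \<rho> by (simp add: field_simps)
      then show ?thesis .
    qed
    then show ?thesis by (simp only: power_mult_distrib)
  qed
  finally have "\<rho> * \<bar>w t\<bar> \<le> \<rho> * (exp (\<bar>\<mu>\<bar> / 2) * (\<bar>w t0\<bar> + \<bar>w' t0\<bar> / \<rho>))"
    by (rule power2_le_imp_le) (use \<rho> in simp)
  then show ?thesis using \<rho> by simp
qed

text \<open>The substitution \<open>w = sqrt T * y\<close>, \<open>T = 1 + t\<close>, with \<open>p = T * dy/dt\<close>; in the time
  \<open>ln T\<close> the equation reads \<open>y'' = (1/4 - \<mu> - \<rho>\<^sup>2 T\<^sup>2) y\<close>, which has constant coefficients
  up to a term that is integrable as long as \<open>\<rho> T \<le> 1\<close>.\<close>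

definition mode_y :: "(real \<Rightarrow> real) \<Rightarrow> real \<Rightarrow> real" where
  "mode_y w t = w t / sqrt (1 + t)"

definition mode_p :: "(real \<Rightarrow> real) \<Rightarrow> (real \<Rightarrow> real) \<Rightarrow> real \<Rightarrow> real" where
  "mode_p w w' t = sqrt (1 + t) * w' t - w t / (2 * sqrt (1 + t))"

lemma sqrt_1_plus_deriv:
  "0 \<le> t \<Longrightarrow> ((\<lambda>t. sqrt (1 + t)) has_real_derivative 1 / (2 * sqrt (1 + t))) (at t within {0..})"
  by (auto intro!: derivative_eq_intros simp: field_simps)

lemma mode_y_deriv:
  assumes sol: "mode_solution \<mu> \<rho> w w'" and t: "0 \<le> t"
  shows "(mode_y w has_real_derivative mode_p w w' t / (1 + t)) (at t within {0..})"
proof -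
  define s where "s = sqrt (1 + t)"
  have s: "s > 0" "1 + t = s * s" using t by (auto simp: s_def)
  have "(mode_y w has_real_derivative (w' t * s - w t * (1 / (2 * s))) / (s * s)) (at t within {0..})"
    unfolding mode_y_def[abs_def] s_def
    by (rule DERIV_divide[OF mode_solution_D(1)[OF sol t] sqrt_1_plus_deriv[OF t]]) (use t in simp)
  also have "(w' t * s - w t * (1 / (2 * s))) / (s * s) = mode_p w w' t / (1 + t)"
    unfolding mode_p_def s_def[symmetric] s(2) using s(1) by (simp add: mult.commute)
  finally show ?thesis .
qed

lemma mode_p_deriv:
  assumes sol: "mode_solution \<mu> \<rho> w w'" and t: "0 \<le> t"
  shows "(mode_p w w' has_real_derivative (1/4 - \<mu> - \<rho>\<^sup>2 * (1 + t)\<^sup>2) * mode_y w t / (1 + t)) (at t within {0..})"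
proof -
  define s where "s = sqrt (1 + t)"
  have s: "s > 0" "1 + t = s * s" using t by (auto simp: s_def)
  have "mode_p w w' = (\<lambda>t. sqrt (1 + t) * w' t - mode_y w t / 2)"
    by (auto simp: mode_p_def mode_y_def fun_eq_iff)
  moreover have "((\<lambda>t. sqrt (1 + t) * w' t - mode_y w t / 2) has_real_derivative
     (1 / (2 * s) * w' t + (- (\<rho>\<^sup>2 + \<mu> / (1 + t)\<^sup>2) * w t) * s) - (mode_p w w' t / (1 + t)) / 2) (at t within {0..})"
    unfolding s_def
    by (intro DERIV_diff DERIV_mult DERIV_cdivide sqrt_1_plus_deriv t mode_y_deriv[OF sol t] mode_solution_D[OF sol t])
  moreover have "(1 / (2 * s) * w' t + (- (\<rho>\<^sup>2 + \<mu> / (1 + t)\<^sup>2) * w t) * s) - (mode_p w w' t / (1 + t)) / 2 =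
     (1/4 - \<mu> - \<rho>\<^sup>2 * (1 + t)\<^sup>2) * mode_y w t / (1 + t)"
    unfolding mode_y_def mode_p_def s_def[symmetric] s(2) using s(1)
    by (simp add: divide_simps power2_eq_square) (simp add: algebra_simps)
  ultimately show ?thesis by simp
qed

lemma mode_of_yp:
  assumes t: "0 \<le> t"
  shows "\<bar>w t\<bar> = sqrt (1 + t) * \<bar>mode_y w t\<bar>"
    "(1 + t) * \<bar>w' t\<bar> \<le> sqrt (1 + t) * (\<bar>mode_p w w' t\<bar> + \<bar>mode_y w t\<bar>)"
proof -
  define s where "s = sqrt (1 + t)"
  have s: "s > 0" "1 + t = s * s" using t by (auto simp: s_def)
  show "\<bar>w t\<bar> = sqrt (1 + t) * \<bar>mode_y w t\<bar>"
    using s(1) by (simp add: mode_y_def s_def[symmetric] abs_divide)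
  have "(1 + t) * w' t = s * (mode_p w w' t + mode_y w t / 2)"
    unfolding mode_y_def mode_p_def s_def[symmetric] s(2) using s(1) by (simp add: field_simps)
  then have "(1 + t) * \<bar>w' t\<bar> = s * \<bar>mode_p w w' t + mode_y w t / 2\<bar>"
    using s(1) t by (metis abs_mult abs_of_nonneg add_nonneg_nonneg less_imp_le zero_le_one)
  also have "\<dots> \<le> s * (\<bar>mode_p w w' t\<bar> + \<bar>mode_y w t\<bar>)"
    using s(1) by (intro mult_left_mono) auto
  finally show "(1 + t) * \<bar>w' t\<bar> \<le> sqrt (1 + t) * (\<bar>mode_p w w' t\<bar> + \<bar>mode_y w t\<bar>)"
    by (simp add: s_def)
qed

lemma mode_yp_0: "\<bar>mode_y w 0\<bar> \<le> \<bar>w 0\<bar> + \<bar>w' 0\<bar>" "\<bar>mode_p w w' 0\<bar> \<le> \<bar>w 0\<bar> + \<bar>w' 0\<bar>"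
  by (auto simp: mode_y_def mode_p_def)

text \<open>In the time ln (1 + t) the derivative of \<open>S\<close> is 4 \<sigma>^2 y p plus a
  term of size \<rho>^2 (1 + t)^2 / c times \<open>S\<close>. The hypotheses model c = |\<nu>| and
  \<sigma> = Re \<nu>: for imaginary \<nu> the first term vanishes, for real \<nu> it costs exactly
  the rate 2 \<sigma>. The second integrates to at most 1 / (2 c) while \<rho> (1 + t) \<le>
  1.\<close>

lemma mode_early_noncritical:
  assumes sol: "mode_solution \<mu> \<rho> w w'"
    and c: "0 < c" "\<sigma> = 0 \<or> \<sigma> = c" "1/4 - \<mu> + c\<^sup>2 = 2 * \<sigma>\<^sup>2"
    and t: "0 \<le> t" "\<rho> * (1 + t) \<le> 1" "0 < \<rho>"
  shows "(mode_p w w' t)\<^sup>2 + c\<^sup>2 * (mode_y w t)\<^sup>2 \<le>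
    (1 + t) powr (2 * \<sigma>) * exp (1 / (2 * c)) * ((mode_p w w' 0)\<^sup>2 + c\<^sup>2 * (mode_y w 0)\<^sup>2)"
proof -
  define p where "p = mode_p w w'"
  define y where "y = mode_y w"
  define S where "S t = (p t)\<^sup>2 + c\<^sup>2 * (y t)\<^sup>2" for t
  \<comment> \<open>The reciprocal of the expected growth: a power for the constant coefficients,
    and an exponential of the antiderivative of \<rho>^2 (1 + t) / c.\<close>
  define g where "g t = (1 + t) powr (- 2 * \<sigma>) * exp (- (\<rho>\<^sup>2 * (1 + t)\<^sup>2 / (2 * c)))" for t
  have S0: "0 \<le> S t" for t by (simp add: S_def)
  have g0: "0 \<le> g t" for t by (simp add: g_def)
  have dS: "(S has_real_derivative (2 * (1/4 - \<mu> + c\<^sup>2) * y t * p t - 2 * \<rho>\<^sup>2 * (1 + t)\<^sup>2 * y t * p t) / (1 + t)) (at t within {0..})"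
    if "0 \<le> t" for t
  proof -
    note D = mode_y_deriv[OF sol that, folded p_def y_def] mode_p_deriv[OF sol that, folded p_def y_def]
    have alg: "(1/4 - m - R * Q) * Y / T * P + (1/4 - m - R * Q) * Y / T * P + C * (P / T * Y + P / T * Y) =
        (2 * (1/4 - m + C) * Y * P - 2 * R * Q * Y * P) / T" for m R Q Y T P C :: real
      by (cases "T = 0") (auto simp: field_simps)
    show ?thesis
      unfolding S_def[abs_def] power2_eq_square[of "p _"] power2_eq_square[of "y _"]
      by (rule DERIV_cong[OF DERIV_add[OF DERIV_mult[OF D(2) D(2)] DERIV_cmult[OF DERIV_mult[OF D(1) D(1)]]]])
         (rule alg)
  qed
  have dg: "(g has_real_derivative g t * (- 2 * \<sigma> / (1 + t) - \<rho>\<^sup>2 * (1 + t) / c)) (at t within {0..})"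
    if "0 \<le> t" for t
  proof -
    have 1: "((\<lambda>t. (1 + t) powr (- 2 * \<sigma>)) has_real_derivative (1 + t) powr (- 2 * \<sigma>) * (- 2 * \<sigma> / (1 + t))) (at t within {0..})"
      using that by (auto intro!: derivative_eq_intros simp: powr_diff)
    have 2: "((\<lambda>t. exp (- (\<rho>\<^sup>2 * (1 + t)\<^sup>2 / (2 * c)))) has_real_derivative
        exp (- (\<rho>\<^sup>2 * (1 + t)\<^sup>2 / (2 * c))) * (- (\<rho>\<^sup>2 * (1 + t) / c))) (at t within {0..})"
    proof (rule DERIV_chain2[OF DERIV_exp])
      show "((\<lambda>t. - (\<rho>\<^sup>2 * (1 + t)\<^sup>2 / (2 * c))) has_real_derivative - (\<rho>\<^sup>2 * (1 + t) / c)) (at t within {0..})"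
        using c(1) by (auto intro!: derivative_eq_intros simp: field_simps)
    qed
    show ?thesis
      unfolding g_def[abs_def] by (rule DERIV_cong[OF DERIV_mult[OF 1 2]]) (simp add: algebra_simps)
  qed
  have "S t * g t \<le> S 0 * g 0"
  proof (rule nonincreasing_of_deriv_nonpos[OF DERIV_mult[OF dS dg] _ order_refl t(1)])
    fix t :: real assume t: "0 \<le> t"
    define m where "m = 2 * c * \<bar>y t * p t\<bar>"
    have m: "m \<le> S t" "0 \<le> m"
      using sum_squares_bound[of "c * \<bar>y t\<bar>" "\<bar>p t\<bar>"] c(1)
      by (auto simp: m_def S_def power_mult_distrib abs_mult)
    have yp: "y t * p t \<le> m / (2 * c)" "- (y t * p t) \<le> m / (2 * c)"
      using c(1) by (auto simp: m_def)
    have 1: "2 * (1/4 - \<mu> + c\<^sup>2) * y t * p t \<le> 2 * \<sigma> * S t"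
    proof -
      have "2 * (1/4 - \<mu> + c\<^sup>2) * y t * p t = 4 * \<sigma>\<^sup>2 * (y t * p t)" using c(3) by simp
      also have "\<dots> \<le> 4 * \<sigma>\<^sup>2 * (m / (2 * c))" by (intro mult_left_mono yp) auto
      \<comment> \<open>Both alternatives for \<sigma> enter: for \<sigma> = 0 both sides vanish,
        for \<sigma> = c one factor cancels.\<close>
      also have "\<dots> = 2 * \<sigma> * m" using c(1,2) by (auto simp: power2_eq_square)
      also have "\<dots> \<le> 2 * \<sigma> * S t" using m c by (intro mult_left_mono) auto
      finally show ?thesis .
    qed
    have 2: "- 2 * \<rho>\<^sup>2 * (1 + t)\<^sup>2 * y t * p t \<le> \<rho>\<^sup>2 * (1 + t)\<^sup>2 / c * S t"
    proof -
      have "- 2 * \<rho>\<^sup>2 * (1 + t)\<^sup>2 * y t * p t = 2 * \<rho>\<^sup>2 * (1 + t)\<^sup>2 * (- (y t * p t))" by simp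
      also have "\<dots> \<le> 2 * \<rho>\<^sup>2 * (1 + t)\<^sup>2 * (m / (2 * c))" by (intro mult_left_mono yp) auto
      also have "\<dots> = \<rho>\<^sup>2 * (1 + t)\<^sup>2 / c * m" by simp
      also have "\<dots> \<le> \<rho>\<^sup>2 * (1 + t)\<^sup>2 / c * S t" using m c by (intro mult_left_mono) auto
      finally show ?thesis .
    qed
    have "(2 * (1/4 - \<mu> + c\<^sup>2) * y t * p t - 2 * \<rho>\<^sup>2 * (1 + t)\<^sup>2 * y t * p t) / (1 + t)
       \<le> (2 * \<sigma> * S t + \<rho>\<^sup>2 * (1 + t)\<^sup>2 / c * S t) / (1 + t)"
      using 1 2 t by (intro divide_right_mono) auto
    also have "\<dots> = S t * (2 * \<sigma> / (1 + t) + \<rho>\<^sup>2 * (1 + t) / c)"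
      using t c(1) by (simp add: field_simps power2_eq_square)
    finally have *: "(2 * (1/4 - \<mu> + c\<^sup>2) * y t * p t - 2 * \<rho>\<^sup>2 * (1 + t)\<^sup>2 * y t * p t) / (1 + t)
       \<le> S t * (2 * \<sigma> / (1 + t) + \<rho>\<^sup>2 * (1 + t) / c)" .
    have "(2 * (1/4 - \<mu> + c\<^sup>2) * y t * p t - 2 * \<rho>\<^sup>2 * (1 + t)\<^sup>2 * y t * p t) / (1 + t) * g t +
       g t * (- 2 * \<sigma> / (1 + t) - \<rho>\<^sup>2 * (1 + t) / c) * S t
       = g t * ((2 * (1/4 - \<mu> + c\<^sup>2) * y t * p t - 2 * \<rho>\<^sup>2 * (1 + t)\<^sup>2 * y t * p t) / (1 + t)
          - S t * (2 * \<sigma> / (1 + t) + \<rho>\<^sup>2 * (1 + t) / c))"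
      by (simp add: algebra_simps)
    also have "\<dots> \<le> 0" using * g0 by (intro mult_nonneg_nonpos) auto
    finally show "(2 * (1/4 - \<mu> + c\<^sup>2) * y t * p t - 2 * \<rho>\<^sup>2 * (1 + t)\<^sup>2 * y t * p t) / (1 + t) * g t +
       g t * (- 2 * \<sigma> / (1 + t) - \<rho>\<^sup>2 * (1 + t) / c) * S t \<le> 0" .
  qed
  also have "S 0 * g 0 \<le> S 0 * 1"
    using c(1) by (intro mult_left_mono S0) (simp add: g_def)
  finally have *: "S t * g t \<le> S 0" by simp
  have "1 \<le> g t * ((1 + t) powr (2 * \<sigma>) * exp (1 / (2 * c)))"
  proof -
    have "(\<rho> * (1 + t))\<^sup>2 \<le> 1" using t by (intro power_le_one) auto
    then have "\<rho>\<^sup>2 * (1 + t)\<^sup>2 / (2 * c) \<le> 1 / (2 * c)"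
      using c(1) by (intro divide_right_mono) (auto simp: power_mult_distrib)
    moreover have "(1 + t) powr (- 2 * \<sigma>) * (1 + t) powr (2 * \<sigma>) = 1"
      using t by (simp add: powr_add[symmetric])
    ultimately show ?thesis
      unfolding g_def by (simp add: mult.commute mult.left_commute exp_add[symmetric] mult.assoc[symmetric])
  qed
  then have "S t * 1 \<le> S t * (g t * ((1 + t) powr (2 * \<sigma>) * exp (1 / (2 * c))))"
    by (intro mult_left_mono S0)
  also have "\<dots> = (S t * g t) * ((1 + t) powr (2 * \<sigma>) * exp (1 / (2 * c)))" by simp
  also have "\<dots> \<le> S 0 * ((1 + t) powr (2 * \<sigma>) * exp (1 / (2 * c)))"
    by (intro mult_right_mono *) auto
  finally show ?thesis by (simp add: S_def p_def y_def mult.commute)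
qed

text \<open>For \<mu> = 1/4 the constant part is y'' = 0, whose energy controls only
  \<open>p\<close>, and \<open>y\<close> may grow linearly in ln (1 + t). A bootstrap replaces the
  energy: with \<open>M\<close> the maximum of |y| / L, integrating the equation twice returns
  \<open>M\<close> with the factor 1/4.\<close>

lemma mode_early_critical:
  assumes sol: "mode_solution (1/4) \<rho> w w'" and t: "0 \<le> t" "\<rho> * (1 + t) \<le> 1" "0 < \<rho>"
  shows "\<bar>mode_y w t\<bar> \<le> 3 * (1 + ln (1 + t)) * (\<bar>mode_y w 0\<bar> + \<bar>mode_p w w' 0\<bar>)"
    and "\<bar>mode_p w w' t\<bar> \<le> 3 * (1 + ln (1 + t)) * (\<bar>mode_y w 0\<bar> + \<bar>mode_p w w' 0\<bar>)"
proof -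
  define p where "p = mode_p w w'"
  define y where "y = mode_y w"
  define L where "L s = 1 + ln (1 + s)" for s :: real
  have L1: "1 \<le> L s" if "0 \<le> s" for s using that by (simp add: L_def)
  have dy: "(y has_vector_derivative p s / (1 + s)) (at s within {0..})" if "0 \<le> s" for s
    unfolding y_def p_def using mode_y_deriv[OF sol that] by (simp add: has_real_derivative_iff_has_vector_derivative)
  have dp: "(p has_vector_derivative - \<rho>\<^sup>2 * (1 + s) * y s) (at s within {0..})" if "0 \<le> s" for s
  proof -
    have "(1/4 - 1/4 - \<rho>\<^sup>2 * (1 + s)\<^sup>2) * mode_y w s / (1 + s) = - \<rho>\<^sup>2 * (1 + s) * y s"
      using that by (simp add: y_def power2_eq_square)
    then show ?thesis
      using mode_p_deriv[OF sol that] unfolding p_def by (simp add: has_real_derivative_iff_has_vector_derivative)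
  qed
  have "continuous_on {0..} y"
    by (rule continuous_on_vector_derivative) (auto intro: dy)
  then have cont: "continuous_on {0..t} y" by (rule continuous_on_subset) auto
  have "continuous_on {0..t} (\<lambda>s. \<bar>y s\<bar> / L s)"
  proof -
    have "1 + ln (1 + s) \<noteq> 0" if "0 \<le> s" for s :: real
      using L1[OF that] unfolding L_def by linarith
    then show ?thesis
      unfolding L_def using cont by (intro continuous_intros) auto
  qed
  then obtain s where s: "s \<in> {0..t}" "\<And>r. r \<in> {0..t} \<Longrightarrow> \<bar>y r\<bar> / L r \<le> \<bar>y s\<bar> / L s"
    using continuous_attains_sup[of "{0..t}" "\<lambda>s. \<bar>y s\<bar> / L s"] t(1) by auto
  \<comment> \<open>The maximum is attained at \<open>s\<close>, so an estimate of
    \<open>y s\<close> closes the inequality for \<open>M\<close>.\<close>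
  define M where "M = \<bar>y s\<bar> / L s"
  have M0: "0 \<le> M" unfolding M_def using s L1[of s] by (intro divide_nonneg_nonneg) auto
  have yM: "\<bar>y r\<bar> \<le> M * L r" if "0 \<le> r" "r \<le> t" for r
    using s(2)[of r] that L1[of r] by (simp add: M_def[symmetric] pos_divide_le_eq)
  define q where "q r = \<rho>\<^sup>2 * (1 + r)\<^sup>2" for r
  have q1: "q r \<le> 1" if "0 \<le> r" "r \<le> t" for r
  proof -
    have "\<rho> * (1 + r) \<le> \<rho> * (1 + t)" using that t by (intro mult_left_mono) auto
    then have "\<rho> * (1 + r) \<le> 1" using t(2) by linarith
    then have "(\<rho> * (1 + r))\<^sup>2 \<le> 1" using t that by (intro power_le_one) auto
    then show ?thesis by (simp add: q_def power_mult_distrib)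
  qed
  have q0: "0 \<le> q r" for r by (simp add: q_def)
  have dL: "(L has_real_derivative 1 / (1 + r)) (at r within {0..})" if "0 \<le> r" for r
    unfolding L_def[abs_def] using that by (auto intro!: derivative_eq_intros)
  have dq: "(q has_real_derivative 2 * \<rho>\<^sup>2 * (1 + r)) (at r within {0..})" for r
    unfolding q_def[abs_def] by (auto intro!: derivative_eq_intros)
  have pM: "\<bar>p r\<bar> \<le> \<bar>p 0\<bar> + M * L r * q r / 2" if r: "0 \<le> r" "r \<le> t" for r
  proof -
    \<comment> \<open>The derivative of this majorant exceeds the bound by the nonnegative term that
      comes from differentiating \<open>L\<close>; the exact antiderivative of \<open>L\<close>
      times 1 + r is not computed.\<close>
    have "norm (p r - p 0) \<le> M * L r * q r / 2 - M * L 0 * q 0 / 2"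
    proof (rule norm_diff_le_of_deriv_bound[OF dp _ _ order_refl r(1)])
      show "((\<lambda>r. M * L r * q r / 2) has_real_derivative M * (1 / (1 + x) * q x + L x * (2 * \<rho>\<^sup>2 * (1 + x))) / 2) (at x within {0..})" if "0 \<le> x" for x
        by (rule DERIV_cong[OF DERIV_cdivide[OF DERIV_mult[OF DERIV_cmult[OF dL[OF that]] dq]]]) (simp add: algebra_simps)
      fix x assume x: "0 < x" "x < r"
      have "norm (- \<rho>\<^sup>2 * (1 + x) * y x) = \<rho>\<^sup>2 * (1 + x) * \<bar>y x\<bar>" using x by (simp add: abs_mult)
      also have "\<dots> \<le> \<rho>\<^sup>2 * (1 + x) * (M * L x)"
        using yM[of x] x r by (intro mult_left_mono) auto
      also have "\<dots> = M * (L x * (2 * \<rho>\<^sup>2 * (1 + x))) / 2" by simp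
      also have "\<dots> \<le> M * (1 / (1 + x) * q x + L x * (2 * \<rho>\<^sup>2 * (1 + x))) / 2"
        using M0 x q0[of x] by (intro divide_right_mono mult_left_mono) auto
      finally show "norm (- \<rho>\<^sup>2 * (1 + x) * y x) \<le> M * (1 / (1 + x) * q x + L x * (2 * \<rho>\<^sup>2 * (1 + x))) / 2" .
    qed
    moreover have "0 \<le> M * L 0 * q 0 / 2" using M0 q0[of 0] L1[of 0] by auto
    ultimately show ?thesis by simp
  qed
  have "norm (y s - y 0) \<le> (\<bar>p 0\<bar> * L s + M * L s * q s / 4) - (\<bar>p 0\<bar> * L 0 + M * L 0 * q 0 / 4)"
  proof (rule norm_diff_le_of_deriv_bound[OF dy _ _ order_refl])
    show "((\<lambda>r. \<bar>p 0\<bar> * L r + M * L r * q r / 4) has_real_derivative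
        \<bar>p 0\<bar> / (1 + x) + M * (1 / (1 + x) * q x + L x * (2 * \<rho>\<^sup>2 * (1 + x))) / 4) (at x within {0..})" if "0 \<le> x" for x
      by (rule DERIV_cong[OF DERIV_add[OF DERIV_cmult[OF dL[OF that]] DERIV_cdivide[OF DERIV_mult[OF DERIV_cmult[OF dL[OF that]] dq]]]]) (simp add: algebra_simps)
    fix x assume x: "0 < x" "x < s"
    have "norm (p x / (1 + x)) = \<bar>p x\<bar> / (1 + x)" using x by simp
    also have "\<dots> \<le> (\<bar>p 0\<bar> + M * L x * q x / 2) / (1 + x)"
      using pM[of x] x s by (intro divide_right_mono) auto
    also have "\<dots> = \<bar>p 0\<bar> / (1 + x) + M * (L x * (2 * \<rho>\<^sup>2 * (1 + x))) / 4"
      using x by (simp add: q_def field_simps power2_eq_square)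
    also have "\<dots> \<le> \<bar>p 0\<bar> / (1 + x) + M * (1 / (1 + x) * q x + L x * (2 * \<rho>\<^sup>2 * (1 + x))) / 4"
      using M0 x q0[of x] by (intro add_left_mono divide_right_mono mult_left_mono) auto
    finally show "norm (p x / (1 + x)) \<le> \<bar>p 0\<bar> / (1 + x) + M * (1 / (1 + x) * q x + L x * (2 * \<rho>\<^sup>2 * (1 + x))) / 4" .
  qed (use s in auto)
  moreover have "0 \<le> \<bar>p 0\<bar> * L 0 + M * L 0 * q 0 / 4" using M0 q0[of 0] L1[of 0] by auto
  moreover have "M * L s * q s / 4 \<le> M * L s * 1 / 4"
    using M0 q1[of s] s L1[of s] by (intro divide_right_mono mult_left_mono) auto
  moreover have "\<bar>y s\<bar> = M * L s" using L1[of s] s by (simp add: M_def)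
  moreover have "\<bar>y 0\<bar> * 1 \<le> \<bar>y 0\<bar> * L s" using L1[of s] s by (intro mult_left_mono) auto
  ultimately have "M * L s \<le> \<bar>y 0\<bar> * L s + \<bar>p 0\<bar> * L s + (M / 4) * L s"
    by (simp add: algebra_simps)
  then have "M * L s \<le> (\<bar>y 0\<bar> + \<bar>p 0\<bar> + M / 4) * L s" by (simp add: algebra_simps)
  \<comment> \<open>The 1/4 is 1/2 for each of the two integrations of \<rho>^2 (1 + t)^2 in ln (1 +
    t), combined with \<open>q s \<le> 1\<close>; it is absorbed on the left.\<close>
  then have "M \<le> \<bar>y 0\<bar> + \<bar>p 0\<bar> + M / 4"
    using L1[of s] s by (subst (asm) mult_le_cancel_right_pos) auto
  then have M: "M \<le> 2 * (\<bar>y 0\<bar> + \<bar>p 0\<bar>)"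
  proof -
    have "X \<le> 2 * S" if "X \<le> S + X / 4" "0 \<le> S" for X S :: real
      using that by (simp add: field_simps)
    from this[OF \<open>M \<le> \<bar>y 0\<bar> + \<bar>p 0\<bar> + M / 4\<close>] show ?thesis by simp
  qed
  have Lt: "1 \<le> L t" by (rule L1[OF t(1)])
  define Q where "Q = (\<bar>y 0\<bar> + \<bar>p 0\<bar>) * L t"
  have Q0: "0 \<le> Q" using Lt by (simp add: Q_def)
  have A: "M * L t \<le> 2 * Q"
    using mult_right_mono[OF M, of "L t"] Lt by (simp add: Q_def mult.assoc)
  have B: "\<bar>p 0\<bar> \<le> Q"
    using mult_left_mono[OF Lt, of "\<bar>y 0\<bar> + \<bar>p 0\<bar>"] by (simp add: Q_def)
  have C: "M * L t * q t / 2 \<le> M * L t * 1 / 2"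
    using M0 q1[of t] t Lt by (intro divide_right_mono mult_left_mono) auto
  have "\<bar>y t\<bar> \<le> 3 * Q" using yM[OF t(1) order_refl] A Q0 by linarith
  then show "\<bar>mode_y w t\<bar> \<le> 3 * (1 + ln (1 + t)) * (\<bar>mode_y w 0\<bar> + \<bar>mode_p w w' 0\<bar>)"
    unfolding y_def[symmetric] p_def[symmetric] L_def[symmetric] Q_def by (simp only: mult_ac)
  have "\<bar>p t\<bar> \<le> 3 * Q" using pM[OF t(1) order_refl] A B C Q0 by linarith
  then show "\<bar>mode_p w w' t\<bar> \<le> 3 * (1 + ln (1 + t)) * (\<bar>mode_y w 0\<bar> + \<bar>mode_p w w' 0\<bar>)"
    unfolding y_def[symmetric] p_def[symmetric] L_def[symmetric] Q_def by (simp only: mult_ac)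
qed

section \<open>Growth and limits of the modes\<close>

text \<open>The larger real part of the exponents 1/2 + \<nu> and 1/2 - \<nu> of the Euler equation
  to which a mode reduces at frequency 0.\<close>

definition growth_rate :: "real \<Rightarrow> real" where
  "growth_rate \<mu> = 1/2 + Re (nu \<mu>)"

lemma Re_nu_nonneg: "0 \<le> Re (nu \<mu>)"
  by (auto simp: nu_def)

lemma growth_rate_ge: "1/2 \<le> growth_rate \<mu>"
  using Re_nu_nonneg[of \<mu>] by (simp add: growth_rate_def)

lemma delta_cases: "delta \<mu> = 0 \<or> delta \<mu> = 1"
  by (simp add: delta_def)

lemma delta_nonneg: "0 \<le> delta \<mu>"
  by (simp add: delta_def)

lemma mode_early:
  "\<exists>K>0. \<forall>\<rho> w w' t. mode_solution \<mu> \<rho> w w' \<longrightarrow> 0 < \<rho> \<longrightarrow> 0 \<le> t \<longrightarrow> \<rho> * (1 + t) \<le> 1 \<longrightarrow>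
     \<bar>w t\<bar> \<le> K * (1 + t) powr growth_rate \<mu> * (1 + ln (1 + t)) powr delta \<mu> * (\<bar>w 0\<bar> + \<bar>w' 0\<bar>) \<and>
     (1 + t) * \<bar>w' t\<bar> \<le> K * (1 + t) powr growth_rate \<mu> * (1 + ln (1 + t)) powr delta \<mu> * (\<bar>w 0\<bar> + \<bar>w' 0\<bar>)"
proof (cases "\<mu> = 1/4")
  case True
  have gr: "growth_rate \<mu> = 1/2" "delta \<mu> = 1"
    using True by (auto simp: growth_rate_def nu_def delta_def)
  show ?thesis
  \<comment> \<open>12 = 3 * 2 * 2: the constant of the critical lemma, the passage from
    \<open>mode_y\<close>, \<open>mode_p\<close> at time 0 to the data, and the sum of two bounds
    for \<open>w'\<close>.\<close>
  proof (intro exI[of _ 12] conjI[of "(0::real) < 12"] allI impI)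
    fix \<rho> t :: real and w w' :: "real \<Rightarrow> real"
    assume sol: "mode_solution \<mu> \<rho> w w'" and \<rho>: "0 < \<rho>" and t: "0 \<le> t" "\<rho> * (1 + t) \<le> 1"
    define D where "D = \<bar>w 0\<bar> + \<bar>w' 0\<bar>"
    define L where "L = 1 + ln (1 + t)"
    have L: "1 \<le> L" using t by (simp add: L_def)
    have D: "\<bar>mode_y w 0\<bar> + \<bar>mode_p w w' 0\<bar> \<le> 2 * D" using mode_yp_0[of w w'] by (simp add: D_def)
    have "3 * L * (\<bar>mode_y w 0\<bar> + \<bar>mode_p w w' 0\<bar>) \<le> 3 * L * (2 * D)"
      using L D by (intro mult_left_mono) auto
    then have le: "3 * L * (\<bar>mode_y w 0\<bar> + \<bar>mode_p w w' 0\<bar>) \<le> 6 * L * D" by simp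
    have b: "\<bar>mode_y w t\<bar> \<le> 6 * L * D" "\<bar>mode_p w w' t\<bar> \<le> 6 * L * D"
      using mode_early_critical[of \<rho> w w' t, THEN order_trans[OF _ le[unfolded L_def]]] sol True \<rho> t unfolding L_def by auto
    have s: "0 < sqrt (1 + t)" "(1 + t) powr growth_rate \<mu> = sqrt (1 + t)" "L powr delta \<mu> = L"
      using t L by (auto simp: gr powr_half_sqrt)
    have LD: "0 \<le> L * D" using L by (simp add: D_def)
    have A1: "sqrt (1 + t) * \<bar>mode_y w t\<bar> \<le> sqrt (1 + t) * (12 * L * D)"
      using b s LD by (intro mult_left_mono) auto
    have A2: "sqrt (1 + t) * (\<bar>mode_p w w' t\<bar> + \<bar>mode_y w t\<bar>) \<le> sqrt (1 + t) * (12 * L * D)"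
      using b s by (intro mult_left_mono) auto
    have KB: "12 * (1 + t) powr growth_rate \<mu> * (1 + ln (1 + t)) powr delta \<mu> * D = sqrt (1 + t) * (12 * L * D)"
      unfolding L_def[symmetric] s(2,3) by simp
    show "\<bar>w t\<bar> \<le> 12 * (1 + t) powr growth_rate \<mu> * (1 + ln (1 + t)) powr delta \<mu> * (\<bar>w 0\<bar> + \<bar>w' 0\<bar>) \<and>
      (1 + t) * \<bar>w' t\<bar> \<le> 12 * (1 + t) powr growth_rate \<mu> * (1 + ln (1 + t)) powr delta \<mu> * (\<bar>w 0\<bar> + \<bar>w' 0\<bar>)"
      unfolding D_def[symmetric] KB
      using A1 order_trans[OF mode_of_yp(2)[OF t(1)] A2] mode_of_yp(1)[OF t(1), of w] by simp
  qed simp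
next
  case False
  \<comment> \<open>Nonzero because \<mu> \<noteq> 1/4; with \<sigma> it satisfies the algebraic
    hypothesis of \<open>mode_early_noncritical\<close>.\<close>
  define c where "c = cmod (nu \<mu>)"
  define \<sigma> where "\<sigma> = Re (nu \<mu>)"
  have c: "0 < c" and \<sigma>: "\<sigma> = 0 \<or> \<sigma> = c" and eq: "1/4 - \<mu> + c\<^sup>2 = 2 * \<sigma>\<^sup>2"
    using False by (auto simp: c_def \<sigma>_def nu_def norm_mult power_mult_distrib power_divide field_simps)
  have \<delta>: "delta \<mu> = 0" using False by (simp add: delta_def)
  \<comment> \<open>The factors are the square root of the exponential in the energy bound, the
    initial energy against the data, and the sum of the bounds \<open>B\<close> for \<open>p\<close>
    and \<open>B / c\<close> for \<open>y\<close>.\<close>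
  define K where "K = exp (1 / (4 * c)) * (1 + c) * (1 + 1 / c)"
  show ?thesis
  proof (intro exI[of _ K] conjI[of "0 < K"] allI impI)
    show "0 < K" using c by (auto simp: K_def intro!: mult_pos_pos add_pos_pos)
    fix \<rho> t :: real and w w' :: "real \<Rightarrow> real"
    assume sol: "mode_solution \<mu> \<rho> w w'" and \<rho>: "0 < \<rho>" and t: "0 \<le> t" "\<rho> * (1 + t) \<le> 1"
    define D where "D = \<bar>w 0\<bar> + \<bar>w' 0\<bar>"
    have D0: "0 \<le> D" by (simp add: D_def)
    define B where "B = (1 + t) powr \<sigma> * exp (1 / (4 * c)) * ((1 + c) * D)"
    have B0: "0 \<le> B" using c D0 by (simp add: B_def)
    have "(mode_p w w' 0)\<^sup>2 + c\<^sup>2 * (mode_y w 0)\<^sup>2 \<le> D\<^sup>2 + c\<^sup>2 * D\<^sup>2"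
    proof (intro add_mono mult_left_mono)
      show "(mode_p w w' 0)\<^sup>2 \<le> D\<^sup>2" "(mode_y w 0)\<^sup>2 \<le> D\<^sup>2"
        using mode_yp_0[of w w'] by (auto simp: D_def intro!: abs_le_square_iff[THEN iffD1])
    qed auto
    also have "\<dots> \<le> ((1 + c) * D)\<^sup>2"
      using c D0 by (simp add: power_mult_distrib power2_sum distrib_right)
    finally have init: "(mode_p w w' 0)\<^sup>2 + c\<^sup>2 * (mode_y w 0)\<^sup>2 \<le> ((1 + c) * D)\<^sup>2" .
    have "(mode_p w w' t)\<^sup>2 + c\<^sup>2 * (mode_y w t)\<^sup>2 \<le>
      (1 + t) powr (2 * \<sigma>) * exp (1 / (2 * c)) * ((mode_p w w' 0)\<^sup>2 + c\<^sup>2 * (mode_y w 0)\<^sup>2)"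
      by (rule mode_early_noncritical[OF sol c \<sigma> eq t \<rho>])
    also have "\<dots> \<le> (1 + t) powr (2 * \<sigma>) * exp (1 / (2 * c)) * ((1 + c) * D)\<^sup>2"
      by (intro mult_left_mono init) auto
    also have "\<dots> = B\<^sup>2"
    proof -
      have "(1 + t) powr (2 * \<sigma>) = ((1 + t) powr \<sigma>)\<^sup>2"
        by (simp add: power2_eq_square powr_add[symmetric])
      moreover have "exp (1 / (2 * c)) = (exp (1 / (4 * c)))\<^sup>2"
        by (simp add: exp_double[symmetric])
      ultimately show ?thesis by (simp only: B_def power_mult_distrib)
    qed
    finally have E: "(mode_p w w' t)\<^sup>2 + c\<^sup>2 * (mode_y w t)\<^sup>2 \<le> B\<^sup>2" .
    have p: "\<bar>mode_p w w' t\<bar> \<le> B"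
    proof (rule power2_le_imp_le[OF _ B0])
      have "0 \<le> c\<^sup>2 * (mode_y w t)\<^sup>2" by simp
      then show "\<bar>mode_p w w' t\<bar>\<^sup>2 \<le> B\<^sup>2" using E unfolding power2_abs by linarith
    qed
    have "c * \<bar>mode_y w t\<bar> \<le> B"
    proof (rule power2_le_imp_le[OF _ B0])
      have "0 \<le> (mode_p w w' t)\<^sup>2" by simp
      then show "(c * \<bar>mode_y w t\<bar>)\<^sup>2 \<le> B\<^sup>2" using E unfolding power_mult_distrib power2_abs by linarith
    qed
    then have y: "\<bar>mode_y w t\<bar> \<le> B / c" using c by (simp add: field_simps)
    have s: "0 < sqrt (1 + t)" using t by simp
    have gr: "(1 + t) powr growth_rate \<mu> = sqrt (1 + t) * (1 + t) powr \<sigma>"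
      using t by (simp add: growth_rate_def \<sigma>_def powr_add powr_half_sqrt)
    have L: "(1 + ln (1 + t)) powr delta \<mu> = 1"
    proof -
      have "0 \<le> ln (1 + t)" using t by (intro ln_ge_zero) simp
      then have "1 + ln (1 + t) \<noteq> 0" by linarith
      then show ?thesis by (simp add: \<delta>)
    qed
    have KB: "K * (1 + t) powr growth_rate \<mu> * (1 + ln (1 + t)) powr delta \<mu> * D = sqrt (1 + t) * (B + B / c)"
      unfolding gr L B_def K_def by (simp add: distrib_left distrib_right mult_ac add_divide_distrib)
    have "sqrt (1 + t) * \<bar>mode_y w t\<bar> \<le> sqrt (1 + t) * (B + B / c)"
      using y s B0 by (intro mult_left_mono) auto
    moreover have "sqrt (1 + t) * (\<bar>mode_p w w' t\<bar> + \<bar>mode_y w t\<bar>) \<le> sqrt (1 + t) * (B + B / c)"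
      using y p s by (intro mult_left_mono) auto
    ultimately show "\<bar>w t\<bar> \<le> K * (1 + t) powr growth_rate \<mu> * (1 + ln (1 + t)) powr delta \<mu> * (\<bar>w 0\<bar> + \<bar>w' 0\<bar>) \<and>
      (1 + t) * \<bar>w' t\<bar> \<le> K * (1 + t) powr growth_rate \<mu> * (1 + ln (1 + t)) powr delta \<mu> * (\<bar>w 0\<bar> + \<bar>w' 0\<bar>)"
      using mode_of_yp(1)[OF t(1), of w] mode_of_yp(2)[OF t(1), where w=w and w'=w'] unfolding D_def[symmetric] KB by auto
  qed
qed

lemma powr_inverse_base: "0 < \<rho> \<Longrightarrow> (1 / \<rho>) powr \<gamma> = \<rho> powr (-\<gamma>)" for \<rho> \<gamma> :: real
  by (simp add: powr_minus powr_divide inverse_eq_divide)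

text \<open>Before the turning time (1 + t)^\<gamma> \<le> \<rho>^(-\<gamma>), which needs \<gamma>
  \<ge> 0. Afterwards the value at 1 + t0 = 1/\<rho> is \<rho>^(-\<gamma>) (1 + t0)^(\<beta> -
  \<gamma>), where t0 may be replaced by t because \<gamma> \<le> \<beta>.\<close>

lemma mode_bound_low:
  "\<exists>K>0. \<forall>\<rho> w w' t \<gamma>. mode_solution \<mu> \<rho> w w' \<longrightarrow> 0 < \<rho> \<longrightarrow> \<rho> \<le> 1 \<longrightarrow> 0 \<le> t \<longrightarrow> 0 \<le> \<gamma> \<longrightarrow> \<gamma> \<le> growth_rate \<mu> \<longrightarrow>
     \<bar>w t\<bar> \<le> K * (\<rho> powr (-\<gamma>) * ((1 + t) powr (growth_rate \<mu> - \<gamma>) * (1 + ln (1 + t)) powr delta \<mu>)) * (\<bar>w 0\<bar> + \<bar>w' 0\<bar>)"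
proof -
  define \<beta> where "\<beta> = growth_rate \<mu>"
  obtain K where K: "K > 0" and early: "\<And>\<rho> w w' t. mode_solution \<mu> \<rho> w w' \<Longrightarrow> 0 < \<rho> \<Longrightarrow> 0 \<le> t \<Longrightarrow> \<rho> * (1 + t) \<le> 1 \<Longrightarrow>
     \<bar>w t\<bar> \<le> K * (1 + t) powr \<beta> * (1 + ln (1 + t)) powr delta \<mu> * (\<bar>w 0\<bar> + \<bar>w' 0\<bar>) \<and>
     (1 + t) * \<bar>w' t\<bar> \<le> K * (1 + t) powr \<beta> * (1 + ln (1 + t)) powr delta \<mu> * (\<bar>w 0\<bar> + \<bar>w' 0\<bar>)"
    using mode_early[of \<mu>] unfolding \<beta>_def by blast
  define e where "e = exp (\<bar>\<mu>\<bar> / 2)"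
  have e: "1 \<le> e" by (simp add: e_def)
  show ?thesis
  proof (intro exI[of _ "2 * e * K"] conjI[of "0 < 2 * e * K"] allI impI)
    show "0 < 2 * e * K" using e K by simp
    fix \<rho> t \<gamma> :: real and w w' :: "real \<Rightarrow> real"
    assume sol: "mode_solution \<mu> \<rho> w w'" and \<rho>: "0 < \<rho>" "\<rho> \<le> 1" and t: "0 \<le> t" and \<gamma>: "0 \<le> \<gamma>" "\<gamma> \<le> growth_rate \<mu>"
    define D where "D = \<bar>w 0\<bar> + \<bar>w' 0\<bar>"
    have D0: "0 \<le> D" by (simp add: D_def)
    define \<Lambda> where "\<Lambda> t = (1 + ln (1 + t)) powr delta \<mu>" for t
    have \<Lambda>0: "0 \<le> \<Lambda> t" for t by (simp add: \<Lambda>_def)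
    have "\<bar>w t\<bar> \<le> 2 * e * K * (\<rho> powr (-\<gamma>) * ((1 + t) powr (\<beta> - \<gamma>) * \<Lambda> t)) * D"
    proof (cases "\<rho> * (1 + t) \<le> 1")
      case True
      have "(1 + t) powr \<beta> = (1 + t) powr (\<beta> - \<gamma>) * (1 + t) powr \<gamma>"
        by (simp add: powr_add[symmetric])
      also have "\<dots> \<le> (1 + t) powr (\<beta> - \<gamma>) * (1 / \<rho>) powr \<gamma>"
        using True \<rho> t \<gamma> by (intro mult_left_mono powr_mono2) (auto simp: field_simps)
      also have "\<dots> = \<rho> powr (-\<gamma>) * (1 + t) powr (\<beta> - \<gamma>)"
        using \<rho> by (simp add: powr_inverse_base)
      finally have *: "(1 + t) powr \<beta> \<le> \<rho> powr (-\<gamma>) * (1 + t) powr (\<beta> - \<gamma>)" .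
      have "\<bar>w t\<bar> \<le> K * (1 + t) powr \<beta> * \<Lambda> t * D"
        using early[OF sol \<rho>(1) t True] by (simp add: \<Lambda>_def D_def)
      also have "\<dots> \<le> K * (\<rho> powr (-\<gamma>) * (1 + t) powr (\<beta> - \<gamma>)) * \<Lambda> t * D"
        using K * D0 \<Lambda>0 by (intro mult_right_mono mult_left_mono) auto
      also have "\<dots> = 1 * (K * (\<rho> powr (-\<gamma>) * ((1 + t) powr (\<beta> - \<gamma>) * \<Lambda> t)) * D)"
        by (simp add: mult_ac)
      also have "\<dots> \<le> (2 * e) * (K * (\<rho> powr (-\<gamma>) * ((1 + t) powr (\<beta> - \<gamma>) * \<Lambda> t)) * D)"
        using e K D0 \<Lambda>0[of t] by (intro mult_right_mono) auto
      finally show ?thesis by (simp add: mult_ac)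
    next
      case False
      \<comment> \<open>The turning time, nonnegative by \<rho> \<le> 1. As 1 / \<rho> = 1 + t0, the
        early bound of \<open>(1 + t0) * w' t0\<close> is exactly what
        \<open>mode_late_energy\<close> consumes.\<close>
      define t0 where "t0 = 1 / \<rho> - 1"
      have t0: "0 \<le> t0" "t0 \<le> t" "1 + t0 = 1 / \<rho>" "\<rho> * (1 + t0) = 1"
        using \<rho> False by (auto simp: t0_def field_simps)
      define X where "X = K * (1 + t0) powr \<beta> * \<Lambda> t0 * D"
      have "\<bar>w t0\<bar> \<le> X" "(1 + t0) * \<bar>w' t0\<bar> \<le> X"
        using early[OF sol \<rho>(1) t0(1)] t0(4) by (auto simp: \<Lambda>_def D_def X_def)
      then have "\<bar>w t0\<bar> + \<bar>w' t0\<bar> / \<rho> \<le> 2 * X"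
        unfolding t0(3) by simp
      then have "e * (\<bar>w t0\<bar> + \<bar>w' t0\<bar> / \<rho>) \<le> e * (2 * X)"
        using e by (intro mult_left_mono) auto
      moreover have "\<bar>w t\<bar> \<le> e * (\<bar>w t0\<bar> + \<bar>w' t0\<bar> / \<rho>)"
        unfolding e_def by (rule mode_late_energy[OF sol \<rho>(1) t0(1,2)]) (use t0(4) in simp)
      ultimately have "\<bar>w t\<bar> \<le> e * (2 * X)" by (rule order_trans[rotated])
      also have "X \<le> K * (\<rho> powr (-\<gamma>) * (1 + t) powr (\<beta> - \<gamma>)) * \<Lambda> t * D"
        unfolding X_def
      proof (intro mult_right_mono mult_mono mult_left_mono)
        have "(1 + t0) powr \<beta> = (1 / \<rho>) powr \<gamma> * (1 + t0) powr (\<beta> - \<gamma>)"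
          unfolding t0(3) by (simp add: powr_add[symmetric])
        also have "\<dots> \<le> (1 / \<rho>) powr \<gamma> * (1 + t) powr (\<beta> - \<gamma>)"
          using t0 \<gamma> \<rho> by (intro mult_left_mono powr_mono2) (auto simp: \<beta>_def)
        also have "(1 / \<rho>) powr \<gamma> = \<rho> powr (-\<gamma>)"
          using \<rho> by (simp add: powr_inverse_base)
        finally show "(1 + t0) powr \<beta> \<le> \<rho> powr (-\<gamma>) * (1 + t) powr (\<beta> - \<gamma>)" .
        show "\<Lambda> t0 \<le> \<Lambda> t"
          unfolding \<Lambda>_def using t0 \<rho> delta_nonneg
          by (intro powr_mono2 add_left_mono ln_mono add_nonneg_nonneg ln_ge_zero) auto
      qed (use K D0 \<Lambda>0 in auto)
      finally show ?thesis using e by (simp add: mult_ac)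
    qed
    then show "\<bar>w t\<bar> \<le> 2 * e * K * (\<rho> powr (-\<gamma>) * ((1 + t) powr (growth_rate \<mu> - \<gamma>) * (1 + ln (1 + t)) powr delta \<mu>)) * (\<bar>w 0\<bar> + \<bar>w' 0\<bar>)"
      by (simp add: \<beta>_def \<Lambda>_def D_def)
  qed
qed

text \<open>For \<rho> \<ge> 1 the turning time has already passed at t = 0.\<close>

lemma mode_bound_high:
  assumes "mode_solution \<mu> \<rho> w w'" "1 \<le> \<rho>" "0 \<le> t"
  shows "\<bar>w t\<bar> \<le> exp (\<bar>\<mu>\<bar> / 2) * (\<bar>w 0\<bar> + \<bar>w' 0\<bar>)"
proof -
  have "\<bar>w t\<bar> \<le> exp (\<bar>\<mu>\<bar> / 2) * (\<bar>w 0\<bar> + \<bar>w' 0\<bar> / \<rho>)"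
    using mode_late_energy[OF assms(1), of 0 t] assms by simp
  also have "\<dots> \<le> exp (\<bar>\<mu>\<bar> / 2) * (\<bar>w 0\<bar> + \<bar>w' 0\<bar> / 1)"
    using assms by (intro mult_left_mono add_left_mono divide_left_mono) auto
  finally show ?thesis by simp
qed

section \<open>Complex modes and the uniform growth bound\<close>

definition complex_mode :: "real \<Rightarrow> real \<Rightarrow> (real \<Rightarrow> complex) \<Rightarrow> (real \<Rightarrow> complex) \<Rightarrow> bool" where
  "complex_mode \<mu> \<rho> w w' \<longleftrightarrow> (\<forall>t\<ge>0.
     (w has_vector_derivative w' t) (at t within {0..}) \<and>
     (w' has_vector_derivative - of_real (\<rho>\<^sup>2) * w t - of_real (\<mu> / (1 + t)\<^sup>2) * w t) (at t within {0..}))"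

lemma complex_mode_D:
  assumes "complex_mode \<mu> \<rho> w w'" "0 \<le> t"
  shows "(w has_vector_derivative w' t) (at t within {0..})"
    "(w' has_vector_derivative - of_real (\<rho>\<^sup>2) * w t - of_real (\<mu> / (1 + t)\<^sup>2) * w t) (at t within {0..})"
  using assms by (auto simp: complex_mode_def)

lemma complex_mode_Re_Im:
  assumes sol: "complex_mode \<mu> \<rho> w w'"
  shows "mode_solution \<mu> \<rho> (\<lambda>t. Re (w t)) (\<lambda>t. Re (w' t))" "mode_solution \<mu> \<rho> (\<lambda>t. Im (w t)) (\<lambda>t. Im (w' t))"
proof -
  have re: "Re (- of_real (\<rho>\<^sup>2) * w t - of_real (\<mu> / (1 + t)\<^sup>2) * w t) = - (\<rho>\<^sup>2 + \<mu> / (1 + t)\<^sup>2) * Re (w t)"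
   and im: "Im (- of_real (\<rho>\<^sup>2) * w t - of_real (\<mu> / (1 + t)\<^sup>2) * w t) = - (\<rho>\<^sup>2 + \<mu> / (1 + t)\<^sup>2) * Im (w t)" for t
    by (simp_all only: minus_complex.simps uminus_complex.simps times_complex.simps Re_complex_of_real Im_complex_of_real) (simp_all add: algebra_simps)
  show "mode_solution \<mu> \<rho> (\<lambda>t. Re (w t)) (\<lambda>t. Re (w' t))"
    unfolding mode_solution_def has_real_derivative_iff_has_vector_derivative re[symmetric]
    using complex_mode_D[OF sol] bounded_linear.has_vector_derivative[OF bounded_linear_Re] by blast
  show "mode_solution \<mu> \<rho> (\<lambda>t. Im (w t)) (\<lambda>t. Im (w' t))"
    unfolding mode_solution_def has_real_derivative_iff_has_vector_derivative im[symmetric]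
    using complex_mode_D[OF sol] bounded_linear.has_vector_derivative[OF bounded_linear_Im] by blast
qed

lemma cmod_le_of_Re_Im_le:
  assumes "\<bar>Re z\<bar> \<le> X * (\<bar>Re a\<bar> + \<bar>Re b\<bar>)" "\<bar>Im z\<bar> \<le> X * (\<bar>Im a\<bar> + \<bar>Im b\<bar>)" "0 \<le> X"
  shows "cmod z \<le> 2 * X * (cmod a + cmod b)"
proof -
  have "cmod z \<le> X * (\<bar>Re a\<bar> + \<bar>Re b\<bar>) + X * (\<bar>Im a\<bar> + \<bar>Im b\<bar>)"
    using cmod_le[of z] assms by linarith
  also have "\<dots> = X * ((\<bar>Re a\<bar> + \<bar>Re b\<bar>) + (\<bar>Im a\<bar> + \<bar>Im b\<bar>))" by (simp add: algebra_simps)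
  also have "\<dots> \<le> X * (2 * (cmod a + cmod b))"
    using abs_Re_le_cmod[of a] abs_Re_le_cmod[of b] abs_Im_le_cmod[of a] abs_Im_le_cmod[of b]
    by (intro mult_left_mono assms) (simp add: add_mono)
  finally show ?thesis by (simp add: mult_ac)
qed

text \<open>One constant serves every frequency, solution and \<gamma>, so that \<gamma> may later
  depend on the case and on the region of frequencies.\<close>

definition mode_growth_bound :: "real \<Rightarrow> real \<Rightarrow> bool" where
  "mode_growth_bound \<mu> K \<longleftrightarrow> (\<forall>\<rho> w w' t. complex_mode \<mu> \<rho> w w' \<longrightarrow> 0 < \<rho> \<longrightarrow> 0 \<le> t \<longrightarrow>
     (\<rho> \<le> 1 \<longrightarrow> (\<forall>\<gamma>. 0 \<le> \<gamma> \<longrightarrow> \<gamma> \<le> growth_rate \<mu> \<longrightarrow>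
        cmod (w t) \<le> K * (\<rho> powr (-\<gamma>) * ((1 + t) powr (growth_rate \<mu> - \<gamma>) * (1 + ln (1 + t)) powr delta \<mu>)) * (cmod (w 0) + cmod (w' 0)))) \<and>
     (1 \<le> \<rho> \<longrightarrow> cmod (w t) \<le> K * (cmod (w 0) + cmod (w' 0))))"

lemma mode_growth_bound_exists: "\<exists>K>0. mode_growth_bound \<mu> K"
proof -
  obtain K where K: "K > 0" and low: "\<And>\<rho> w w' t \<gamma>. mode_solution \<mu> \<rho> w w' \<Longrightarrow> 0 < \<rho> \<Longrightarrow> \<rho> \<le> 1 \<Longrightarrow> 0 \<le> t \<Longrightarrow> 0 \<le> \<gamma> \<Longrightarrow> \<gamma> \<le> growth_rate \<mu> \<Longrightarrow>
     \<bar>w t\<bar> \<le> K * (\<rho> powr (-\<gamma>) * ((1 + t) powr (growth_rate \<mu> - \<gamma>) * (1 + ln (1 + t)) powr delta \<mu>)) * (\<bar>w 0\<bar> + \<bar>w' 0\<bar>)"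
    using mode_bound_low[of \<mu>] by blast
  define e where "e = exp (\<bar>\<mu>\<bar> / 2)"
  define K' where "K' = 2 * K + 2 * e"
  have e: "0 < e" by (simp add: e_def)
  show ?thesis unfolding mode_growth_bound_def
  proof (intro exI[of _ K'] conjI[of "0 < K'"] allI impI conjI)
    show "0 < K'" using K e by (simp add: K'_def)
    fix \<rho> t :: real and w w'
    assume sol: "complex_mode \<mu> \<rho> w w'" and \<rho>: "0 < \<rho>" and t: "0 \<le> t"
    note RI = complex_mode_Re_Im[OF sol]
    have D0: "0 \<le> cmod (w 0) + cmod (w' 0)" by simp
    {
      fix \<gamma> assume \<rho>1: "\<rho> \<le> 1" and \<gamma>: "0 \<le> \<gamma>" "\<gamma> \<le> growth_rate \<mu>"
      define X where "X = \<rho> powr (-\<gamma>) * ((1 + t) powr (growth_rate \<mu> - \<gamma>) * (1 + ln (1 + t)) powr delta \<mu>)"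
      have X: "0 \<le> X" by (simp add: X_def)
      have "cmod (w t) \<le> 2 * (K * X) * (cmod (w 0) + cmod (w' 0))"
        using low[OF RI(1) \<rho> \<rho>1 t \<gamma>] low[OF RI(2) \<rho> \<rho>1 t \<gamma>] K X
        by (intro cmod_le_of_Re_Im_le) (auto simp: X_def)
      also have "\<dots> \<le> K' * X * (cmod (w 0) + cmod (w' 0))"
        using K X e by (intro mult_right_mono D0) (simp add: K'_def distrib_right mult.assoc)
      finally show "cmod (w t) \<le> K' * X * (cmod (w 0) + cmod (w' 0))" .
    }
    {
      assume \<rho>1: "1 \<le> \<rho>"
      have "cmod (w t) \<le> 2 * e * (cmod (w 0) + cmod (w' 0))"
        using mode_bound_high[OF RI(1) \<rho>1 t] mode_bound_high[OF RI(2) \<rho>1 t] e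
        by (intro cmod_le_of_Re_Im_le) (auto simp: e_def)
      also have "\<dots> \<le> K' * (cmod (w 0) + cmod (w' 0))"
        using K by (intro mult_right_mono D0) (simp add: K'_def)
      finally show "cmod (w t) \<le> K' * (cmod (w 0) + cmod (w' 0))" .
    }
  qed
qed

section \<open>Limits of functions with integrable derivative\<close>

lemma powr_1_plus_deriv:
  "0 \<le> t \<Longrightarrow> ((\<lambda>t. (1 + t) powr a) has_real_derivative (1 + t) powr a * (a / (1 + t))) (at t within {0..})" for a t :: real
  by (auto intro!: derivative_eq_intros simp: powr_diff)

text \<open>\<kappa> < 1 makes the bound integrable at infinity, and its tail from \<open>t\<close>
  is the rate. A limit along the integers suffices because every time is compared with all later
  integers.\<close>

lemma limit_of_decaying_derivative:
  fixes Z :: "real \<Rightarrow> complex"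
  assumes Z: "\<And>t. 0 \<le> t \<Longrightarrow> (Z has_vector_derivative Z' t) (at t within {0..})"
    and bound: "\<And>t. 0 \<le> t \<Longrightarrow> cmod (Z' t) \<le> M * (1 + t) powr (\<kappa> - 2) * (1 + ln (1 + t)) powr \<delta>"
    and \<kappa>: "\<kappa> < 1" and \<delta>: "\<delta> = 0 \<or> \<delta> = 1" and M: "0 \<le> M"
  shows "convergent (\<lambda>n. Z (real n))"
    and "0 \<le> t \<Longrightarrow> cmod (Z t - lim (\<lambda>n. Z (real n))) \<le>
      M * (1 / (1 - \<kappa>) * (1 / (1 - \<kappa>) + 1)) * ((1 + t) powr (\<kappa> - 1) * (1 + ln (1 + t)) powr \<delta>)"
proof -
  \<comment> \<open>With (1 - \<kappa>) A = 1 the summand \<open>A\<close> in the logarithmic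
    antiderivative cancels the contribution of the derivative of \<open>L\<close>.\<close>
  define A where "A = 1 / (1 - \<kappa>)"
  have A: "0 < A" "(1 - \<kappa>) * A = 1" using \<kappa> by (auto simp: A_def)
  define L where "L t = 1 + ln (1 + t)" for t :: real
  have L: "1 \<le> L t" if "0 \<le> t" for t using that by (simp add: L_def)
  \<comment> \<open>Up to sign and a factor, an explicit antiderivative of the bound; it is nonincreasing and
    nonnegative, which yields both the convergence and the rate.\<close>
  define \<Psi> where "\<Psi> t = (1 + t) powr (\<kappa> - 1) * (if \<delta> = 0 then 1 else A + L t)" for t
  have \<Psi>0: "0 \<le> \<Psi> t" if "0 \<le> t" for t using A L[OF that] by (simp add: \<Psi>_def)
  have p: "(1 + t) powr (\<kappa> - 1) * (1 / (1 + t)) = (1 + t) powr (\<kappa> - 2)" if "0 \<le> t" for t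
  proof -
    have "(1 + t) powr (\<kappa> - 2) = (1 + t) powr ((\<kappa> - 1) - 1)" by simp
    also have "\<dots> = (1 + t) powr (\<kappa> - 1) * (1 / (1 + t))"
      using that by (subst powr_diff) simp
    finally show ?thesis by simp
  qed
  have d1: "((\<lambda>t. (1 + t) powr (\<kappa> - 1)) has_real_derivative - (1 - \<kappa>) * (1 + t) powr (\<kappa> - 2)) (at t within {0..})"
    if "0 \<le> t" for t
  proof -
    have "((\<lambda>t. (1 + t) powr (\<kappa> - 1)) has_real_derivative (1 + t) powr (\<kappa> - 1) * ((\<kappa> - 1) / (1 + t))) (at t within {0..})"
      by (rule powr_1_plus_deriv[OF that])
    moreover have "(1 + t) powr (\<kappa> - 1) * ((\<kappa> - 1) / (1 + t)) = - (1 - \<kappa>) * (1 + t) powr (\<kappa> - 2)"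
      unfolding p[OF that, symmetric] by simp
    ultimately show ?thesis by simp
  qed
  have dL: "((\<lambda>t. A + L t) has_real_derivative 1 / (1 + t)) (at t within {0..})" if "0 \<le> t" for t
    unfolding L_def using that by (auto intro!: derivative_eq_intros)
  have d\<Psi>: "((\<lambda>t. - (M * A) * \<Psi> t) has_real_derivative M * (1 + t) powr (\<kappa> - 2) * L t powr \<delta>) (at t within {0..})"
    if t: "0 \<le> t" for t
    using \<delta>
  proof
    assume "\<delta> = 0"
    have "((\<lambda>t. - (M * A) * (1 + t) powr (\<kappa> - 1)) has_real_derivative - (M * A) * (- (1 - \<kappa>) * (1 + t) powr (\<kappa> - 2))) (at t within {0..})"
      by (rule DERIV_cmult[OF d1[OF t]])
    moreover have "- (M * A) * (- (1 - \<kappa>) * (1 + t) powr (\<kappa> - 2)) = M * ((1 - \<kappa>) * A) * (1 + t) powr (\<kappa> - 2)"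
      by (simp only: mult_ac minus_mult_minus mult_minus_left mult_minus_right minus_minus)
    ultimately show ?thesis
      using \<open>\<delta> = 0\<close> L[OF t] by (simp add: \<Psi>_def A)
  next
    assume "\<delta> = 1"
    have "((\<lambda>t. - (M * A) * ((1 + t) powr (\<kappa> - 1) * (A + L t))) has_real_derivative
        - (M * A) * (- (1 - \<kappa>) * (1 + t) powr (\<kappa> - 2) * (A + L t) + 1 / (1 + t) * (1 + t) powr (\<kappa> - 1))) (at t within {0..})"
      by (rule DERIV_cmult[OF DERIV_mult[OF d1[OF t] dL[OF t]]])
    moreover have "- (M * A) * (- (1 - \<kappa>) * (1 + t) powr (\<kappa> - 2) * (A + L t) + 1 / (1 + t) * (1 + t) powr (\<kappa> - 1))
       = M * (1 + t) powr (\<kappa> - 2) * L t"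
    proof -
      have "- (M * A) * (- (1 - \<kappa>) * P * (A + l) + P) = M * P * l" for P l
      proof -
        have "- (M * A) * (- (1 - \<kappa>) * P * (A + l) + P) = M * P * (((1 - \<kappa>) * A) * (A + l) - A)"
          by (simp add: algebra_simps)
        then show ?thesis by (simp add: A)
      qed
      moreover have "1 / (1 + t) * (1 + t) powr (\<kappa> - 1) = (1 + t) powr (\<kappa> - 2)"
        using p[OF t] by (simp only: mult.commute)
      ultimately show ?thesis by (simp only:)
    qed
    ultimately show ?thesis
      using \<open>\<delta> = 1\<close> L[OF t] by (simp add: \<Psi>_def)
  qed
  have step: "cmod (Z b - Z a) \<le> M * A * (\<Psi> a - \<Psi> b)" if "0 \<le> a" "a \<le> b" for a b
  proof -
    have "cmod (Z b - Z a) \<le> - (M * A) * \<Psi> b - (- (M * A) * \<Psi> a)"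
      by (rule norm_diff_le_of_deriv_bound[OF Z d\<Psi> _ that]) (use bound that in \<open>auto simp: L_def\<close>)
    then show ?thesis by (simp add: algebra_simps)
  qed
  show conv: "convergent (\<lambda>n. Z (real n))"
  \<comment> \<open>For M = 0 the sequence is constant; otherwise one may divide by
    \<open>M * A\<close>, and the Cauchy property passes from the antiderivative to
    \<open>Z\<close>.\<close>
  proof (cases "M = 0")
    case True
    then have "Z (real n) = Z 0" for n using step[of 0 "real n"] by simp
    then show ?thesis by (simp add: convergent_const)
  next
    case False
    then have MA: "0 < M * A" using M A by simp
    have "decseq (\<lambda>n. \<Psi> (real n))"
    proof (rule decseq_SucI)
      fix n
      have "0 \<le> M * A * (\<Psi> (real n) - \<Psi> (real (Suc n)))"
        by (rule order_trans[OF norm_ge_zero step]) auto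
      then show "\<Psi> (real (Suc n)) \<le> \<Psi> (real n)" using MA by (simp add: zero_le_mult_iff)
    qed
    then obtain l where "(\<lambda>n. \<Psi> (real n)) \<longlonglongrightarrow> l"
      by (rule decseq_convergent[of _ 0]) (auto intro: \<Psi>0)
    then have "convergent (\<lambda>n. \<Psi> (real n))" by (rule convergentI)
    then have C: "Cauchy (\<lambda>n. \<Psi> (real n))" by (rule convergent_Cauchy)
    have "Cauchy (\<lambda>n. Z (real n))"
    proof (rule CauchyI')
      fix e :: real assume e: "0 < e"
      then obtain N where N: "\<And>m n. m \<ge> N \<Longrightarrow> n \<ge> N \<Longrightarrow> norm (\<Psi> (real m) - \<Psi> (real n)) < e / (M * A)"
        using CauchyD[OF C, of "e / (M * A)"] MA by auto
      show "\<exists>N. \<forall>m\<ge>N. \<forall>n>m. dist (Z (real m)) (Z (real n)) < e"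
      proof (intro exI[of _ N] allI impI)
        fix m n assume mn: "N \<le> m" "m < n"
        have "dist (Z (real m)) (Z (real n)) \<le> M * A * (\<Psi> (real m) - \<Psi> (real n))"
          using step[of "real m" "real n"] mn by (simp add: dist_norm norm_minus_commute)
        also have "\<dots> \<le> M * A * norm (\<Psi> (real m) - \<Psi> (real n))"
          using MA by (intro mult_left_mono) auto
        also have "\<dots> < M * A * (e / (M * A))"
          using MA N[of m n] mn by (intro mult_strict_left_mono) auto
        also have "M * A * (e / (M * A)) = e"
          using MA by (simp only: times_divide_eq_right nonzero_mult_div_cancel_left less_imp_neq[THEN not_sym] simp_thms)
        finally show "dist (Z (real m)) (Z (real n)) < e" .
      qed
    qed
    then show ?thesis by (rule Cauchy_convergent)
  qed
  assume t: "0 \<le> t"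
  have lim: "(\<lambda>n. Z (real n)) \<longlonglongrightarrow> lim (\<lambda>n. Z (real n))"
    using conv by (simp add: convergent_LIMSEQ_iff)
  have "cmod (Z t - lim (\<lambda>n. Z (real n))) \<le> M * A * \<Psi> t"
  proof (rule LIMSEQ_le_const2)
    show "(\<lambda>n. cmod (Z t - Z (real n))) \<longlonglongrightarrow> cmod (Z t - lim (\<lambda>n. Z (real n)))"
      by (intro tendsto_intros lim)
    obtain N where N: "t \<le> real N" using real_arch_simple by blast
    show "\<exists>N. \<forall>n\<ge>N. cmod (Z t - Z (real n)) \<le> M * A * \<Psi> t"
    proof (intro exI[of _ N] allI impI)
      fix n assume "N \<le> n"
      then have "t \<le> real n" using N by simp
      then have "cmod (Z t - Z (real n)) \<le> M * A * (\<Psi> t - \<Psi> (real n))"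
        using step[OF t, of "real n"] by (simp add: norm_minus_commute)
      also have "\<dots> \<le> M * A * \<Psi> t"
        using M A \<Psi>0[of "real n"] by (intro mult_left_mono) auto
      finally show "cmod (Z t - Z (real n)) \<le> M * A * \<Psi> t" .
    qed
  qed
  also have "\<dots> \<le> M * A * ((A + 1) * ((1 + t) powr (\<kappa> - 1) * L t powr \<delta>))"
  proof (intro mult_left_mono)
    \<comment> \<open>\<open>L t \<ge> 1\<close> absorbs the additive \<open>A\<close>; this
      produces the factor A + 1 of the constant.\<close>
    have "A + L t \<le> (A + 1) * L t" using A mult_left_mono[OF L[OF t], of A] by (simp add: distrib_right)
    then have "(if \<delta> = 0 then 1 else A + L t) \<le> (A + 1) * L t powr \<delta>"
      using \<delta> L[OF t] A by auto
    then have "\<Psi> t \<le> (1 + t) powr (\<kappa> - 1) * ((A + 1) * L t powr \<delta>)"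
      unfolding \<Psi>_def by (intro mult_left_mono) auto
    then show "\<Psi> t \<le> (A + 1) * ((1 + t) powr (\<kappa> - 1) * L t powr \<delta>)" by (simp add: mult_ac)
  qed (use M A in auto)
  finally show "cmod (Z t - lim (\<lambda>n. Z (real n))) \<le>
      M * (1 / (1 - \<kappa>) * (1 / (1 - \<kappa>) + 1)) * ((1 + t) powr (\<kappa> - 1) * (1 + ln (1 + t)) powr \<delta>)"
    by (simp add: A_def L_def mult_ac)
qed

section \<open>Low frequencies\<close>

lemma AE_norm_pos: "AE \<xi> in (lborel :: 'a::euclidean_space measure). 0 < norm \<xi>"
proof -
  have "AE \<xi> in (lborel :: 'a measure). \<xi> \<noteq> 0"
    by (rule AE_lborel_singleton)
  then show ?thesis by eventually_elim simp
qed

lemma nn_integral_sq_le_of_power_weight: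
  fixes U :: "'a::euclidean_space \<Rightarrow> real"
  assumes [measurable]: "U \<in> borel_measurable borel" "S \<in> sets borel" and U0: "\<And>\<xi>. 0 \<le> U \<xi>"
    and le: "AE \<xi> in lborel. \<xi> \<in> S \<longrightarrow> U \<xi> \<le> B * norm \<xi> powr (-\<gamma>)"
    and W: "(\<integral>\<^sup>+\<xi>. ennreal (norm \<xi> powr (-(2 * \<gamma>))) * indicator S \<xi> \<partial>lborel) \<le> ennreal W"
    and "0 \<le> W"
  shows "(\<integral>\<^sup>+\<xi>. ennreal ((U \<xi>)\<^sup>2) * indicator S \<xi> \<partial>lborel) \<le> ennreal (B\<^sup>2 * W)"
proof -
  have "(\<integral>\<^sup>+\<xi>. ennreal ((U \<xi>)\<^sup>2) * indicator S \<xi> \<partial>lborel) \<le>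
      (\<integral>\<^sup>+\<xi>. ennreal (B\<^sup>2) * (ennreal (norm \<xi> powr (-(2 * \<gamma>))) * indicator S \<xi>) \<partial>lborel)"
    using le
  proof (intro nn_integral_mono_AE, eventually_elim)
    case (elim \<xi>)
    show ?case
    proof (cases "\<xi> \<in> S")
      case True
      then have "(U \<xi>)\<^sup>2 \<le> (B * norm \<xi> powr (-\<gamma>))\<^sup>2"
        using elim U0 by (intro power_mono) auto
      also have "\<dots> = B\<^sup>2 * norm \<xi> powr (-(2 * \<gamma>))"
        by (simp add: power_mult_distrib power2_eq_square[of "norm \<xi> powr _"] powr_add[symmetric])
      finally have "ennreal ((U \<xi>)\<^sup>2) \<le> ennreal (B\<^sup>2 * norm \<xi> powr (-(2 * \<gamma>)))" by (rule ennreal_leI)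
      then show ?thesis using True by (simp add: ennreal_mult)
    qed simp
  qed
  also have "\<dots> = ennreal (B\<^sup>2) * (\<integral>\<^sup>+\<xi>. ennreal (norm \<xi> powr (-(2 * \<gamma>))) * indicator S \<xi> \<partial>lborel)"
    by (rule nn_integral_cmult) measurable
  also have "\<dots> \<le> ennreal (B\<^sup>2) * ennreal W" by (intro mult_left_mono W) simp
  also have "\<dots> = ennreal (B\<^sup>2 * W)" using \<open>0 \<le> W\<close> by (simp add: ennreal_mult)
  finally show ?thesis .
qed

text \<open>With A = 1 / (1 - \<kappa>) this is A (A + 1): \<open>A\<close> from integrating the
  power, A + 1 from absorbing the term beside the logarithm.\<close>

definition tail_const :: "real \<Rightarrow> real" where
  "tail_const \<kappa> = 1 / (1 - \<kappa>) * (1 / (1 - \<kappa>) + 1)"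

lemma tail_const_pos: "\<kappa> < 1 \<Longrightarrow> 0 < tail_const \<kappa>"
  unfolding tail_const_def by (intro mult_pos_pos add_pos_pos divide_pos_pos) auto

text \<open>\<gamma> is quantified inside the almost-everywhere statement, so one null set serves
  all \<gamma>. The condition \<open>growth_rate \<mu> - \<gamma> < 1\<close> is that of a
  convergent tail in time.\<close>

definition low_frequency_bound ::
  "real \<Rightarrow> real \<Rightarrow> real \<Rightarrow> ('a::euclidean_space \<Rightarrow> real) \<Rightarrow> ('a \<Rightarrow> complex) \<Rightarrow> ('a \<Rightarrow> complex) \<Rightarrow> bool" where
  "low_frequency_bound \<mu> M t U F0 F1 \<longleftrightarrow>
    (AE \<xi> in lborel. norm \<xi> \<le> 1 \<longrightarrow> (\<forall>\<gamma>. 0 \<le> \<gamma> \<longrightarrow> \<gamma> \<le> growth_rate \<mu> \<longrightarrow> growth_rate \<mu> - \<gamma> < 1 \<longrightarrow>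
       U \<xi> \<le> M * tail_const (growth_rate \<mu> - \<gamma>) * (norm \<xi> powr (-\<gamma>) *
         ((1 + t) powr (growth_rate \<mu> - \<gamma> - 1) * (1 + ln (1 + t)) powr delta \<mu>)) * (cmod (F0 \<xi>) + cmod (F1 \<xi>))))"

lemma low_frequency_boundD:
  assumes "low_frequency_bound \<mu> M t U F0 F1" "0 \<le> \<gamma>" "\<gamma> \<le> growth_rate \<mu>" "growth_rate \<mu> - \<gamma> < 1"
  shows "AE \<xi> in lborel. norm \<xi> \<le> 1 \<longrightarrow> U \<xi> \<le> M * tail_const (growth_rate \<mu> - \<gamma>) * (norm \<xi> powr (-\<gamma>) *
         ((1 + t) powr (growth_rate \<mu> - \<gamma> - 1) * (1 + ln (1 + t)) powr delta \<mu>)) * (cmod (F0 \<xi>) + cmod (F1 \<xi>))"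
  using assms unfolding low_frequency_bound_def by auto

text \<open>\<open>U\<close> is any function with the pointwise bound, which keeps the integration
  over frequencies apart from the wave equation. \<open>C\<close> is independent of the data, of
  \<open>M\<close> and of the time.\<close>

definition low_frequency_estimate :: "'a::euclidean_space itself \<Rightarrow> real \<Rightarrow> real \<Rightarrow> real \<Rightarrow> bool" where
  "low_frequency_estimate _ r \<mu> C \<longleftrightarrow> (\<forall>(f0 :: 'a \<Rightarrow> complex) f1 F0 F1 U M t.
    f0 \<in> Lp_space 2 \<longrightarrow> f0 \<in> Lp_space r \<longrightarrow> is_fourier_L2 f0 F0 \<longrightarrow>
    f1 \<in> Lp_space 2 \<longrightarrow> f1 \<in> Lp_space r \<longrightarrow> is_fourier_L2 f1 F1 \<longrightarrow>
    U \<in> borel_measurable borel \<longrightarrow> (\<forall>\<xi>. 0 \<le> U \<xi>) \<longrightarrow> 0 \<le> M \<longrightarrow> 0 \<le> t \<longrightarrow> low_frequency_bound \<mu> M t U F0 F1 \<longrightarrow>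
    (\<integral>\<^sup>+\<xi>. ennreal ((U \<xi>)\<^sup>2) * indicator (cball 0 1) \<xi> \<partial>lborel) \<le>
      ennreal (C * (M * (Lp_norm r f0 + Lp_norm r f1) * decay_rate DIM('a) r \<mu> t)\<^sup>2))"

lemma alpha_eq: "alpha d r \<mu> = growth_rate \<mu> - real d * (2 - r) / (2 * r)"
  by (simp add: alpha_def growth_rate_def)

section \<open>Data in L^r with r > 1\<close>

lemma low_frequency_estimate_gt_1:
  assumes r: "1 < r" "r < 2" and \<alpha>: "alpha DIM('a::euclidean_space) r \<mu> < 1"
  shows "\<exists>C>0. low_frequency_estimate TYPE('a) r \<mu> C"
proof -
  define \<beta> where "\<beta> = growth_rate \<mu>"
  define s where "s = real DIM('a) * (2 - r) / (2 * r)"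
  have s: "0 < s" using r by (simp add: s_def)
  have \<beta>: "0 < \<beta>" using growth_rate_ge[of \<mu>] by (simp add: \<beta>_def)
  have \<alpha>s: "alpha DIM('a) r \<mu> = \<beta> - s" by (simp add: alpha_eq \<beta>_def s_def)
  \<comment> \<open>Pitt's inequality allows \<gamma> up to \<open>s\<close>, the mode bound up to
    \<beta>. The exponent left is max(\<alpha>, 0) - 1, the rate in all cases with r > 1.\<close>
  define \<gamma> where "\<gamma> = min s \<beta>"
  have \<gamma>: "0 \<le> \<gamma>" "\<gamma> \<le> \<beta>" "\<gamma> \<le> s" "\<beta> - \<gamma> < 1" using s \<beta> \<alpha> by (auto simp: \<gamma>_def \<alpha>s)
  have dec: "decay_rate DIM('a) r \<mu> t = (1 + t) powr (\<beta> - \<gamma> - 1) * (1 + ln (1 + t)) powr delta \<mu>" for t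
    using r unfolding decay_rate_def \<alpha>s \<gamma>_def by auto
  define k where "k = tail_const (\<beta> - \<gamma>)"
  have k: "0 < k" unfolding k_def by (rule tail_const_pos[OF \<gamma>(4)])
  obtain C where C: "C > 0" and Pitt: "\<And>(f :: 'a \<Rightarrow> complex) F. f \<in> Lp_space 2 \<Longrightarrow> f \<in> Lp_space r \<Longrightarrow> is_fourier_L2 f F \<Longrightarrow>
    (\<integral>\<^sup>+\<xi>. ennreal (norm \<xi> powr (- (real DIM('a) * (2 - r) / r))) * ennreal ((cmod (F \<xi>))\<^sup>2) \<partial>lborel) \<le> ennreal (C * (Lp_norm r f)\<^sup>2)"
    using Pitt_inequality[OF r, where 'a='a] by blast
  have s2: "real DIM('a) * (2 - r) / r = 2 * s" by (simp add: s_def)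
  show ?thesis
    unfolding low_frequency_estimate_def
  proof (intro exI[of _ "2 * k\<^sup>2 * C"] conjI[of "0 < 2 * k\<^sup>2 * C"] allI impI)
    show "0 < 2 * k\<^sup>2 * C" using k C by simp
    fix f0 f1 F0 F1 :: "'a \<Rightarrow> complex" and U M t
    assume f0: "f0 \<in> Lp_space 2" "f0 \<in> Lp_space r" "is_fourier_L2 f0 F0"
      and f1: "f1 \<in> Lp_space 2" "f1 \<in> Lp_space r" "is_fourier_L2 f1 F1"
      and [measurable]: "U \<in> borel_measurable borel" and U0: "\<forall>\<xi>. 0 \<le> U \<xi>" and M: "0 \<le> M" and t: "0 \<le> t"
      and low: "low_frequency_bound \<mu> M t U F0 F1"
    note [measurable] = L2_measurable[OF is_fourier_L2_D(2)[OF f0(3)]] L2_measurable[OF is_fourier_L2_D(2)[OF f1(3)]]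
    define X where "X = M * k * decay_rate DIM('a) r \<mu> t"
    have X: "0 \<le> X" using M k by (simp add: X_def dec)
    have le: "AE \<xi> in lborel. norm \<xi> \<le> 1 \<longrightarrow> U \<xi> \<le> X * norm \<xi> powr (-\<gamma>) * (cmod (F0 \<xi>) + cmod (F1 \<xi>))"
      using low_frequency_boundD[OF low \<gamma>(1) \<gamma>(2,4)[unfolded \<beta>_def]]
      by eventually_elim (simp add: X_def dec k_def \<beta>_def mult_ac)
    let ?w = "\<lambda>\<xi>::'a. ennreal (norm \<xi> powr (-(2 * s)))"
    have "(\<integral>\<^sup>+\<xi>. ennreal ((U \<xi>)\<^sup>2) * indicator (cball 0 1) \<xi> \<partial>lborel) \<le>
       (\<integral>\<^sup>+\<xi>. ennreal (2 * X\<^sup>2) * (?w \<xi> * ennreal ((cmod (F0 \<xi>))\<^sup>2)) + ennreal (2 * X\<^sup>2) * (?w \<xi> * ennreal ((cmod (F1 \<xi>))\<^sup>2)) \<partial>lborel)"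
    proof (rule nn_integral_mono_AE)
      show "AE \<xi> in lborel. ennreal ((U \<xi>)\<^sup>2) * indicator (cball 0 1) \<xi> \<le>
         ennreal (2 * X\<^sup>2) * (?w \<xi> * ennreal ((cmod (F0 \<xi>))\<^sup>2)) + ennreal (2 * X\<^sup>2) * (?w \<xi> * ennreal ((cmod (F1 \<xi>))\<^sup>2))"
        using le AE_norm_pos[where 'a='a]
      proof eventually_elim
        case (elim \<xi>)
        show ?case
        proof (cases "norm \<xi> \<le> 1")
          case True
          \<comment> \<open>If \<alpha> < 0 then \<gamma> = \<beta> < s, and on the unit ball the
            weight is enlarged to the one of Pitt's inequality.\<close>
          have "norm \<xi> powr (-\<gamma>) \<le> norm \<xi> powr (-s)"
            using True elim(2) \<gamma>(3) by (intro powr_mono') auto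
          then have "X * norm \<xi> powr (-\<gamma>) * (cmod (F0 \<xi>) + cmod (F1 \<xi>)) \<le> X * norm \<xi> powr (-s) * (cmod (F0 \<xi>) + cmod (F1 \<xi>))"
            using X by (intro mult_right_mono mult_left_mono) auto
          then have "U \<xi> \<le> X * norm \<xi> powr (-s) * (cmod (F0 \<xi>) + cmod (F1 \<xi>))"
            using elim(1) True by linarith
          then have "(U \<xi>)\<^sup>2 \<le> (X * norm \<xi> powr (-s) * (cmod (F0 \<xi>) + cmod (F1 \<xi>)))\<^sup>2"
            using U0 by (intro power_mono) auto
          also have "\<dots> = X\<^sup>2 * norm \<xi> powr (-(2 * s)) * (cmod (F0 \<xi>) + cmod (F1 \<xi>))\<^sup>2"
            by (simp add: power_mult_distrib power2_eq_square[of "norm \<xi> powr _"] powr_add[symmetric])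
          also have "\<dots> \<le> X\<^sup>2 * norm \<xi> powr (-(2 * s)) * (2 * (cmod (F0 \<xi>))\<^sup>2 + 2 * (cmod (F1 \<xi>))\<^sup>2)"
            using sum_squares_bound[of "cmod (F0 \<xi>)" "cmod (F1 \<xi>)"] by (intro mult_left_mono) (auto simp: power2_sum)
          also have "\<dots> = 2 * X\<^sup>2 * (norm \<xi> powr (-(2 * s)) * (cmod (F0 \<xi>))\<^sup>2) + 2 * X\<^sup>2 * (norm \<xi> powr (-(2 * s)) * (cmod (F1 \<xi>))\<^sup>2)"
            by (simp add: algebra_simps)
          finally have "ennreal ((U \<xi>)\<^sup>2) \<le> ennreal (2 * X\<^sup>2 * (norm \<xi> powr (-(2 * s)) * (cmod (F0 \<xi>))\<^sup>2) + 2 * X\<^sup>2 * (norm \<xi> powr (-(2 * s)) * (cmod (F1 \<xi>))\<^sup>2))"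
            by (rule ennreal_leI)
          then show ?thesis using True by (simp add: ennreal_mult'' ennreal_plus indicator_def)
        qed simp
      qed
    qed
    also have "\<dots> = ennreal (2 * X\<^sup>2) * (\<integral>\<^sup>+\<xi>. ?w \<xi> * ennreal ((cmod (F0 \<xi>))\<^sup>2) \<partial>lborel) + ennreal (2 * X\<^sup>2) * (\<integral>\<^sup>+\<xi>. ?w \<xi> * ennreal ((cmod (F1 \<xi>))\<^sup>2) \<partial>lborel)"
      by (subst nn_integral_add) (auto simp: nn_integral_cmult)
    also have "\<dots> \<le> ennreal (2 * X\<^sup>2) * ennreal (C * (Lp_norm r f0)\<^sup>2) + ennreal (2 * X\<^sup>2) * ennreal (C * (Lp_norm r f1)\<^sup>2)"
      using Pitt[OF f0] Pitt[OF f1] unfolding s2 by (intro add_mono mult_left_mono) auto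
    also have "\<dots> = ennreal (2 * X\<^sup>2 * (C * (Lp_norm r f0)\<^sup>2) + 2 * X\<^sup>2 * (C * (Lp_norm r f1)\<^sup>2))"
      using C by (subst ennreal_mult_add_mult) auto
    also have "\<dots> \<le> ennreal (2 * k\<^sup>2 * C * (M * (Lp_norm r f0 + Lp_norm r f1) * decay_rate DIM('a) r \<mu> t)\<^sup>2)"
    proof (rule ennreal_leI)
      have "2 * X\<^sup>2 * (C * (Lp_norm r f0)\<^sup>2) + 2 * X\<^sup>2 * (C * (Lp_norm r f1)\<^sup>2) = 2 * X\<^sup>2 * C * ((Lp_norm r f0)\<^sup>2 + (Lp_norm r f1)\<^sup>2)"
        by (simp add: algebra_simps)
      also have "\<dots> \<le> 2 * X\<^sup>2 * C * (Lp_norm r f0 + Lp_norm r f1)\<^sup>2"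
        using C by (intro mult_left_mono) (auto simp: power2_sum)
      also have "\<dots> = 2 * k\<^sup>2 * C * (M * (Lp_norm r f0 + Lp_norm r f1) * decay_rate DIM('a) r \<mu> t)\<^sup>2"
        by (simp add: X_def power_mult_distrib mult_ac)
      finally show "2 * X\<^sup>2 * (C * (Lp_norm r f0)\<^sup>2) + 2 * X\<^sup>2 * (C * (Lp_norm r f1)\<^sup>2) \<le>
        2 * k\<^sup>2 * C * (M * (Lp_norm r f0 + Lp_norm r f1) * decay_rate DIM('a) r \<mu> t)\<^sup>2" .
    qed
    finally show "(\<integral>\<^sup>+\<xi>. ennreal ((U \<xi>)\<^sup>2) * indicator (cball 0 1) \<xi> \<partial>lborel) \<le>
      ennreal (2 * k\<^sup>2 * C * (M * (Lp_norm r f0 + Lp_norm r f1) * decay_rate DIM('a) r \<mu> t)\<^sup>2)" .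
  qed
qed

section \<open>Data in L^1\<close>

lemma low_frequency_bound_L1:
  fixes f0 f1 F0 F1 :: "'a::euclidean_space \<Rightarrow> complex"
  assumes f0: "f0 \<in> Lp_space 2" "f0 \<in> Lp_space 1" "is_fourier_L2 f0 F0"
    and f1: "f1 \<in> Lp_space 2" "f1 \<in> Lp_space 1" "is_fourier_L2 f1 F1"
    and low: "low_frequency_bound \<mu> M t U F0 F1" and M: "0 \<le> M"
    and \<gamma>: "0 \<le> \<gamma>" "\<gamma> \<le> growth_rate \<mu>" "growth_rate \<mu> - \<gamma> < 1"
  shows "AE \<xi> in lborel. norm \<xi> \<le> 1 \<longrightarrow>
    U \<xi> \<le> M * (fourier_const TYPE('a) * (Lp_norm 1 f0 + Lp_norm 1 f1)) * (1 + ln (1 + t)) powr delta \<mu> *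
      (tail_const (growth_rate \<mu> - \<gamma>) * (1 + t) powr (growth_rate \<mu> - \<gamma> - 1)) * norm \<xi> powr (-\<gamma>)"
  using low_frequency_boundD[OF low \<gamma>] is_fourier_L2_sup_bound[OF f0] is_fourier_L2_sup_bound[OF f1]
proof eventually_elim
  case (elim \<xi>)
  show ?case
  proof
    assume "norm \<xi> \<le> 1"
    let ?Y = "M * tail_const (growth_rate \<mu> - \<gamma>) * (norm \<xi> powr (-\<gamma>) *
         ((1 + t) powr (growth_rate \<mu> - \<gamma> - 1) * (1 + ln (1 + t)) powr delta \<mu>))"
    have "U \<xi> \<le> ?Y * (cmod (F0 \<xi>) + cmod (F1 \<xi>))" using elim(1) \<open>norm \<xi> \<le> 1\<close> by simp
    also have "\<dots> \<le> ?Y * (fourier_const TYPE('a) * Lp_norm 1 f0 + fourier_const TYPE('a) * Lp_norm 1 f1)"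
      using elim(2,3) M tail_const_pos[OF \<gamma>(3)] by (intro mult_left_mono add_mono) auto
    finally show "U \<xi> \<le> M * (fourier_const TYPE('a) * (Lp_norm 1 f0 + Lp_norm 1 f1)) * (1 + ln (1 + t)) powr delta \<mu> *
      (tail_const (growth_rate \<mu> - \<gamma>) * (1 + t) powr (growth_rate \<mu> - \<gamma> - 1)) * norm \<xi> powr (-\<gamma>)"
      by (simp only: distrib_left[symmetric] mult_ac)
  qed
qed

text \<open>With bounded transforms only integrals of |\<xi>|^(-2 \<gamma>) remain. For \<beta> <
  d/2 the choice \<gamma> = \<beta> is integrable over the unit ball and leaves no growth. Otherwise
  the ball is cut at |\<xi>| = 1 / (1 + t), and both parts scale like (1 + t)^(2 \<beta> - d - 2)
  apart from logarithms.\<close>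

lemma low_frequency_estimate_eq_1:
  assumes \<alpha>: "alpha DIM('a::euclidean_space) 1 \<mu> < 1"
  shows "\<exists>C>0. low_frequency_estimate TYPE('a) 1 \<mu> C"
proof -
  define \<beta> where "\<beta> = growth_rate \<mu>"
  define d where "d = real DIM('a)"
  define V where "V = unit_ball_vol d"
  define c where "c = fourier_const TYPE('a)"
  have d: "0 < d" by (simp add: d_def)
  have V: "0 < V" by (simp add: V_def d_def)
  have c: "0 < c" by (simp add: c_def)
  have \<beta>: "0 < \<beta>" using growth_rate_ge[of \<mu>] by (simp add: \<beta>_def)
  have \<alpha>d: "alpha DIM('a) 1 \<mu> = \<beta> - d / 2" by (simp add: alpha_eq \<beta>_def d_def)
  define k0 where "k0 = tail_const 0"
  have k0: "0 < k0" unfolding k0_def by (rule tail_const_pos) simp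
  show ?thesis
  proof (cases "\<beta> < d / 2")
    case True
    define W where "W = V * (2 * \<beta> / (d - 2 * \<beta>) + 1)"
    have W: "0 < W" using True V \<beta> by (auto simp: W_def intro!: mult_pos_pos add_nonneg_pos)
    show ?thesis
      unfolding low_frequency_estimate_def
    proof (intro exI[of _ "(c * k0)\<^sup>2 * W"] conjI[of "0 < (c * k0)\<^sup>2 * W"] allI impI)
      show "0 < (c * k0)\<^sup>2 * W" using c k0 W by simp
      fix f0 f1 F0 F1 :: "'a \<Rightarrow> complex" and U M t
      assume f0: "f0 \<in> Lp_space 2" "f0 \<in> Lp_space 1" "is_fourier_L2 f0 F0"
        and f1: "f1 \<in> Lp_space 2" "f1 \<in> Lp_space 1" "is_fourier_L2 f1 F1"
        and U: "U \<in> borel_measurable borel" "\<forall>\<xi>. 0 \<le> U \<xi>" and M: "0 \<le> M" and t: "0 \<le> t"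
        and low: "low_frequency_bound \<mu> M t U F0 F1"
      define L where "L = (1 + ln (1 + t)) powr delta \<mu>"
      define N where "N = Lp_norm 1 f0 + Lp_norm 1 f1"
      have "AE \<xi> in lborel. norm \<xi> \<le> 1 \<longrightarrow> U \<xi> \<le> M * (c * N) * L * (k0 * (1 + t) powr (-1)) * norm \<xi> powr (-\<beta>)"
        using low_frequency_bound_L1[OF f0 f1 low M, of \<beta>] \<beta> by (simp add: \<beta>_def k0_def c_def N_def L_def)
      then have "(\<integral>\<^sup>+\<xi>. ennreal ((U \<xi>)\<^sup>2) * indicator (cball 0 1) \<xi> \<partial>lborel) \<le> ennreal ((M * (c * N) * L * (k0 * (1 + t) powr (-1)))\<^sup>2 * W)"
      proof (intro nn_integral_sq_le_of_power_weight)
        show "(\<integral>\<^sup>+\<xi>. ennreal (norm \<xi> powr (- (2 * \<beta>))) * indicator (cball (0::'a) 1) \<xi> \<partial>lborel) \<le> ennreal W"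
          using nn_integral_norm_powr_ball[of "2 * \<beta>" 1, where 'a='a] True \<beta> by (simp add: W_def V_def d_def)
      qed (use U W in auto)
      also have "(M * (c * N) * L * (k0 * (1 + t) powr (-1)))\<^sup>2 * W = (c * k0)\<^sup>2 * W * (M * N * decay_rate DIM('a) 1 \<mu> t)\<^sup>2"
      proof -
        have "decay_rate DIM('a) 1 \<mu> t = (1 + t) powr (-1) * L"
          using True unfolding decay_rate_def \<alpha>d L_def by simp
        then show ?thesis by (simp only: power_mult_distrib mult_ac)
      qed
      finally show "(\<integral>\<^sup>+\<xi>. ennreal ((U \<xi>)\<^sup>2) * indicator (cball 0 1) \<xi> \<partial>lborel) \<le>
        ennreal ((c * k0)\<^sup>2 * W * (M * (Lp_norm 1 f0 + Lp_norm 1 f1) * decay_rate DIM('a) 1 \<mu> t)\<^sup>2)"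
        by (simp add: N_def)
    qed
  next
    case False
    \<comment> \<open>The midpoint between max(0, \<beta> - 1) and d/2: above \<beta> - 1 for a
      convergent tail in time, below d/2 for integrability at the origin. The interval is nonempty
      because \<alpha> = \<beta> - d/2 < 1.\<close>
    define \<gamma> where "\<gamma> = (max 0 (\<beta> - 1) + d / 2) / 2"
    have \<gamma>: "0 < \<gamma>" "\<gamma> < d / 2" "\<gamma> \<le> \<beta>" "\<beta> - \<gamma> < 1"
    proof -
      define m where "m = max 0 (\<beta> - 1)"
      have m: "0 \<le> m" "\<beta> - 1 \<le> m" "m < d / 2" using d \<alpha> unfolding m_def \<alpha>d max_less_iff_conj by auto
      have "\<gamma> = (m + d / 2) / 2" by (simp add: \<gamma>_def m_def)
      then have "m < \<gamma>" "\<gamma> < d / 2" using m by auto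
      then show "0 < \<gamma>" "\<gamma> < d / 2" "\<gamma> \<le> \<beta>" "\<beta> - \<gamma> < 1" using m False by linarith+
    qed
    define k1 where "k1 = tail_const (\<beta> - \<gamma>)"
    have k1: "0 < k1" unfolding k1_def by (rule tail_const_pos[OF \<gamma>(4)])
    define W1 where "W1 = V * (2 * \<gamma> / (d - 2 * \<gamma>) + 1)"
    have W1: "0 < W1" using \<gamma> V by (auto simp: W1_def intro!: mult_pos_pos add_nonneg_pos)
    \<comment> \<open>At \<beta> = d/2 the annulus gives 1 + d ln T, at most (1 + d)(1 + ln T); for
      larger \<beta> the integral over the whole exterior converges.\<close>
    define W2 where "W2 = (if \<beta> = d / 2 then V * (1 + d) else 2 * \<beta> * V / (2 * \<beta> - d))"
    have W2: "0 < W2" using False V d \<beta> by (auto simp: W2_def intro!: mult_pos_pos divide_pos_pos)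
    \<comment> \<open>The exponent of the extra logarithm in the squared estimate; half of it is the
      1/2 in the decay rate.\<close>
    define e where "e = (if \<beta> = d / 2 then 1 else 0 :: real)"
    define C where "C = c\<^sup>2 * (k1\<^sup>2 * W1 + k0\<^sup>2 * W2)"
    have C: "0 < C" using c k0 k1 W1 W2 by (auto simp: C_def intro!: mult_pos_pos add_pos_pos)
    show ?thesis
      unfolding low_frequency_estimate_def
    proof (intro exI[of _ C] conjI[of "0 < C"] allI impI)
      show "0 < C" by fact
      fix f0 f1 F0 F1 :: "'a \<Rightarrow> complex" and U M t
      assume f0: "f0 \<in> Lp_space 2" "f0 \<in> Lp_space 1" "is_fourier_L2 f0 F0"
        and f1: "f1 \<in> Lp_space 2" "f1 \<in> Lp_space 1" "is_fourier_L2 f1 F1"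
        and U: "U \<in> borel_measurable borel" "\<forall>\<xi>. 0 \<le> U \<xi>" and M: "0 \<le> M" and t: "0 \<le> t"
        and low: "low_frequency_bound \<mu> M t U F0 F1"
      note [measurable] = U(1)
      have [measurable]: "cball (0::'a) \<rho> \<in> sets borel" for \<rho> by simp
      define T where "T = 1 + t"
      have T: "1 \<le> T" using t by (simp add: T_def)
      define l where "l = 1 + ln T"
      have l: "1 \<le> l" using T by (simp add: l_def)
      define L where "L = l powr delta \<mu>"
      define N where "N = Lp_norm 1 f0 + Lp_norm 1 f1"
      define X where "X = M * (c * N) * L"
      have dec: "(decay_rate DIM('a) 1 \<mu> t)\<^sup>2 = (T powr (\<beta> - d/2 - 1) * L)\<^sup>2 * l powr e"
      proof (cases "\<beta> = d / 2")
        case True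
        have "(l powr (1/2 + delta \<mu>))\<^sup>2 = L\<^sup>2 * l powr 1"
          unfolding L_def power2_eq_square powr_add[symmetric] by (simp add: algebra_simps)
        moreover have "decay_rate DIM('a) 1 \<mu> t = T powr (\<beta> - d/2 - 1) * l powr (1/2 + delta \<mu>)"
        proof -
          have b: "\<beta> - d/2 - 1 = -1" using True by simp
          show ?thesis
            using True unfolding decay_rate_def \<alpha>d T_def[symmetric] l_def[symmetric] b by simp
        qed
        moreover have "e = 1" using True by (simp add: e_def)
        ultimately show ?thesis by (simp only: power_mult_distrib mult.assoc)
      next
        case b: False
        show ?thesis
          using b False l unfolding decay_rate_def \<alpha>d T_def[symmetric] l_def[symmetric] e_def L_def[symmetric] by auto
      qed
      have Tp: "(T powr (\<beta> - d/2 - 1))\<^sup>2 = T powr (2 * \<beta> - d - 2)"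
        unfolding power2_eq_square powr_add[symmetric] by (simp add: algebra_simps)
      have le1: "AE \<xi> in lborel. norm \<xi> \<le> 1 \<longrightarrow> U \<xi> \<le> X * (k1 * T powr (\<beta> - \<gamma> - 1)) * norm \<xi> powr (-\<gamma>)"
        using low_frequency_bound_L1[OF f0 f1 low M, of \<gamma>] \<gamma> by (simp add: \<beta>_def k1_def c_def N_def L_def X_def T_def l_def)
      have le0: "AE \<xi> in lborel. norm \<xi> \<le> 1 \<longrightarrow> U \<xi> \<le> X * (k0 * T powr (-1)) * norm \<xi> powr (-\<beta>)"
        using low_frequency_bound_L1[OF f0 f1 low M, of \<beta>] \<beta> by (simp add: \<beta>_def k0_def c_def N_def L_def X_def T_def l_def)
      have inner: "(\<integral>\<^sup>+\<xi>. ennreal ((U \<xi>)\<^sup>2) * indicator (cball 0 (1/T)) \<xi> \<partial>lborel) \<le>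
          ennreal ((X * (k1 * T powr (\<beta> - \<gamma> - 1)))\<^sup>2 * (W1 * (1/T) powr (d - 2 * \<gamma>)))"
      proof (intro nn_integral_sq_le_of_power_weight)
        show "AE \<xi> in lborel. \<xi> \<in> cball 0 (1/T) \<longrightarrow> U \<xi> \<le> X * (k1 * T powr (\<beta> - \<gamma> - 1)) * norm \<xi> powr (-\<gamma>)"
          using le1
        proof eventually_elim
          case (elim \<xi>)
          have "1 / T \<le> 1" using T by simp
          then show ?case using elim by (auto intro: order_trans)
        qed
        show "(\<integral>\<^sup>+\<xi>. ennreal (norm \<xi> powr (- (2 * \<gamma>))) * indicator (cball (0::'a) (1/T)) \<xi> \<partial>lborel) \<le> ennreal (W1 * (1/T) powr (d - 2 * \<gamma>))"
          using nn_integral_norm_powr_ball[of "2 * \<gamma>" "1/T", where 'a='a] \<gamma> T by (simp add: W1_def V_def d_def)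
      qed (use U W1 in auto)
      \<comment> \<open>The rate contributes T^(2 (\<beta> - \<gamma> - 1)) and the ball T^(2
        \<gamma> - d), so \<gamma> cancels.\<close>
      have inner_eq: "(X * (k1 * T powr (\<beta> - \<gamma> - 1)))\<^sup>2 * (W1 * (1/T) powr (d - 2 * \<gamma>)) = X\<^sup>2 * k1\<^sup>2 * W1 * T powr (2 * \<beta> - d - 2)"
      proof -
        have "(T powr (\<beta> - \<gamma> - 1))\<^sup>2 * (1/T) powr (d - 2 * \<gamma>) = T powr (2 * \<beta> - d - 2)"
          using T unfolding power2_eq_square by (simp add: powr_inverse_base powr_add[symmetric]) (simp add: algebra_simps)
        then show ?thesis by (simp add: power_mult_distrib mult_ac)
      qed
      have outer: "(\<integral>\<^sup>+\<xi>. ennreal ((U \<xi>)\<^sup>2) * indicator (cball 0 1 - cball 0 (1/T)) \<xi> \<partial>lborel) \<le>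
          ennreal ((X * (k0 * T powr (-1)))\<^sup>2 * (W2 * (T powr (2 * \<beta> - d) * l powr e)))"
      proof (intro nn_integral_sq_le_of_power_weight)
        show "AE \<xi> in lborel. \<xi> \<in> cball 0 1 - cball 0 (1/T) \<longrightarrow> U \<xi> \<le> X * (k0 * T powr (-1)) * norm \<xi> powr (-\<beta>)"
          using le0 by eventually_elim auto
        show "(\<integral>\<^sup>+\<xi>. ennreal (norm \<xi> powr (- (2 * \<beta>))) * indicator (cball (0::'a) 1 - cball 0 (1/T)) \<xi> \<partial>lborel)
            \<le> ennreal (W2 * (T powr (2 * \<beta> - d) * l powr e))"
        proof (cases "\<beta> = d / 2")
          case True
          have "(\<integral>\<^sup>+\<xi>. ennreal (norm \<xi> powr (- (2 * \<beta>))) * indicator (cball (0::'a) 1 - cball 0 (1/T)) \<xi> \<partial>lborel) \<le> ennreal (V * (1 + d * ln (1 / (1 / T))))"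
          proof -
            have "2 * \<beta> = d" using True by simp
            then show ?thesis
              using nn_integral_norm_powr_annulus[of "1/T", where 'a='a] T by (simp add: V_def d_def)
          qed
          also have "\<dots> \<le> ennreal (V * ((1 + d) * l))"
          proof (intro ennreal_leI mult_left_mono)
            have "0 \<le> ln T" using T by simp
            then show "1 + d * ln (1 / (1 / T)) \<le> (1 + d) * l" using d by (simp add: l_def algebra_simps)
          qed (use V in simp)
          finally show ?thesis using True T l by (simp add: W2_def e_def mult_ac)
        next
          case b: False
          have "(\<integral>\<^sup>+\<xi>. ennreal (norm \<xi> powr (- (2 * \<beta>))) * indicator (cball (0::'a) 1 - cball 0 (1/T)) \<xi> \<partial>lborel)
            \<le> (\<integral>\<^sup>+\<xi>. ennreal (norm \<xi> powr (- (2 * \<beta>))) * indicator (- cball (0::'a) (1/T)) \<xi> \<partial>lborel)"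
            by (intro nn_integral_mono) (auto simp: indicator_def)
          also have "\<dots> \<le> ennreal (2 * \<beta> * V / (2 * \<beta> - d) * (1/T) powr (d - 2 * \<beta>))"
            unfolding V_def d_def by (rule nn_integral_norm_powr_outside) (use T b False in \<open>auto simp: d_def\<close>)
          also have "(1/T) powr (d - 2 * \<beta>) = T powr (2 * \<beta> - d)" using T by (simp add: powr_inverse_base)
          finally show ?thesis using b l by (simp add: W2_def e_def)
        qed
      qed (use U W2 l in auto)
      have outer_eq: "(X * (k0 * T powr (-1)))\<^sup>2 * (W2 * (T powr (2 * \<beta> - d) * l powr e)) = X\<^sup>2 * k0\<^sup>2 * W2 * (T powr (2 * \<beta> - d - 2) * l powr e)"
      proof -
        have eq: "T powr (2 * \<beta> - d - 2) = (T powr (-1))\<^sup>2 * T powr (2 * \<beta> - d)"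
          unfolding power2_eq_square powr_add[symmetric] by simp
        show ?thesis unfolding eq by (simp only: power_mult_distrib mult_ac)
      qed
      have "(\<integral>\<^sup>+\<xi>. ennreal ((U \<xi>)\<^sup>2) * indicator (cball 0 1) \<xi> \<partial>lborel) \<le>
        (\<integral>\<^sup>+\<xi>. ennreal ((U \<xi>)\<^sup>2) * indicator (cball 0 (1/T)) \<xi> + ennreal ((U \<xi>)\<^sup>2) * indicator (cball 0 1 - cball 0 (1/T)) \<xi> \<partial>lborel)"
        by (intro nn_integral_mono) (auto simp: indicator_def)
      also have "\<dots> = (\<integral>\<^sup>+\<xi>. ennreal ((U \<xi>)\<^sup>2) * indicator (cball 0 (1/T)) \<xi> \<partial>lborel) + (\<integral>\<^sup>+\<xi>. ennreal ((U \<xi>)\<^sup>2) * indicator (cball 0 1 - cball 0 (1/T)) \<xi> \<partial>lborel)"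
        by (rule nn_integral_add) measurable
      also have "\<dots> \<le> ennreal (X\<^sup>2 * k1\<^sup>2 * W1 * T powr (2 * \<beta> - d - 2)) + ennreal (X\<^sup>2 * k0\<^sup>2 * W2 * (T powr (2 * \<beta> - d - 2) * l powr e))"
        using inner outer unfolding inner_eq outer_eq by (rule add_mono)
      also have "\<dots> = ennreal (X\<^sup>2 * k1\<^sup>2 * W1 * T powr (2 * \<beta> - d - 2) + X\<^sup>2 * k0\<^sup>2 * W2 * (T powr (2 * \<beta> - d - 2) * l powr e))"
        using W1 W2 by (subst ennreal_plus) auto
      also have "\<dots> \<le> ennreal (C * (M * N * decay_rate DIM('a) 1 \<mu> t)\<^sup>2)"
      proof (rule ennreal_leI)
        have "1 \<le> l powr e" using l by (simp add: e_def)
        then have "X\<^sup>2 * k1\<^sup>2 * W1 * T powr (2 * \<beta> - d - 2) * 1 \<le> X\<^sup>2 * k1\<^sup>2 * W1 * T powr (2 * \<beta> - d - 2) * l powr e"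
          using W1 by (intro mult_left_mono) auto
        then have "X\<^sup>2 * k1\<^sup>2 * W1 * T powr (2 * \<beta> - d - 2) + X\<^sup>2 * k0\<^sup>2 * W2 * (T powr (2 * \<beta> - d - 2) * l powr e)
           \<le> X\<^sup>2 * (k1\<^sup>2 * W1 + k0\<^sup>2 * W2) * (T powr (2 * \<beta> - d - 2) * l powr e)"
          by (simp add: algebra_simps)
        also have "\<dots> = C * (M * N * decay_rate DIM('a) 1 \<mu> t)\<^sup>2"
          unfolding power_mult_distrib dec Tp[symmetric] by (simp add: X_def C_def power_mult_distrib mult_ac)
        finally show "X\<^sup>2 * k1\<^sup>2 * W1 * T powr (2 * \<beta> - d - 2) + X\<^sup>2 * k0\<^sup>2 * W2 * (T powr (2 * \<beta> - d - 2) * l powr e)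
          \<le> C * (M * N * decay_rate DIM('a) 1 \<mu> t)\<^sup>2" .
      qed
      finally show "(\<integral>\<^sup>+\<xi>. ennreal ((U \<xi>)\<^sup>2) * indicator (cball 0 1) \<xi> \<partial>lborel) \<le>
        ennreal (C * (M * (Lp_norm 1 f0 + Lp_norm 1 f1) * decay_rate DIM('a) 1 \<mu> t)\<^sup>2)"
        by (simp add: N_def)
    qed
  qed
qed

section \<open>Identification of the modes and their profiles\<close>

lemma low_frequency_estimate_exists:
  assumes r: "1 \<le> r" "r < 2" and \<alpha>: "alpha DIM('a::euclidean_space) r \<mu> < 1"
  shows "\<exists>C>0. low_frequency_estimate TYPE('a) r \<mu> C"
proof (cases "r = 1")
  case True
  show ?thesis using low_frequency_estimate_eq_1[of \<mu>, where 'a='a] \<alpha> unfolding True by blast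
next
  case False
  then have "1 < r" using r by simp
  then show ?thesis by (rule low_frequency_estimate_gt_1[OF _ r(2) \<alpha>])
qed

text \<open>High frequencies decay like 1 / (1 + t) in every case, and this absorbs them into the
  rate. In the last case of the definition \<alpha> is not negative, so the exponent is at least
  -1.\<close>

lemma decay_rate_ge:
  assumes "0 \<le> t"
  shows "(1 + t) powr (-1) \<le> decay_rate d r \<mu> t"
proof -
  define l where "l = 1 + ln (1 + t)"
  have l: "1 \<le> l" using assms by (simp add: l_def)
  have ge1: "1 \<le> l powr a" if "0 \<le> a" for a
    using l that by (simp add: ge_one_powr_ge_zero)
  have le: "(1 + t) powr (-1) \<le> (1 + t) powr b * l powr a" if "0 \<le> a" "-1 \<le> b" for a b
  proof -
    have "(1 + t) powr (-1) * 1 \<le> (1 + t) powr b * l powr a"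
      using ge1[OF that(1)] assms that(2) by (intro mult_mono powr_mono) auto
    then show ?thesis by simp
  qed
  consider "alpha d r \<mu> < 0 \<or> (alpha d r \<mu> = 0 \<and> r > 1)"
    | "\<not> (alpha d r \<mu> < 0 \<or> (alpha d r \<mu> = 0 \<and> r > 1))" "alpha d r \<mu> = 0 \<and> r = 1"
    | "\<not> (alpha d r \<mu> < 0 \<or> (alpha d r \<mu> = 0 \<and> r > 1))" "\<not> (alpha d r \<mu> = 0 \<and> r = 1)" by blast
  then show ?thesis
  proof cases
    case 1
    then show ?thesis unfolding decay_rate_def l_def[symmetric] by (simp only: if_True le delta_nonneg order_refl)
  next
    case 2
    have "(1 + t) powr (-1) \<le> (1 + t) powr (-1) * l powr (1/2 + delta \<mu>)"
      using delta_nonneg[of \<mu>] by (intro le) auto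
    then show ?thesis unfolding decay_rate_def l_def[symmetric] if_not_P[OF 2(1)] if_P[OF 2(2)] .
  next
    case 3
    have "(1 + t) powr (-1) \<le> (1 + t) powr (alpha d r \<mu> - 1) * l powr delta \<mu>"
      using 3 by (intro le delta_nonneg) auto
    then show ?thesis unfolding decay_rate_def l_def[symmetric] if_not_P[OF 3(1)] if_not_P[OF 3(2)] .
  qed
qed

lemma Lp_norm_2_le_of_ennreal:
  assumes h: "h \<in> borel_measurable borel" and le: "AE x in lborel. cmod (h x) \<le> U x"
    and q: "(\<integral>\<^sup>+x. ennreal ((U x)\<^sup>2) \<partial>lborel) \<le> ennreal q" "0 \<le> q"
  shows "h \<in> Lp_space 2" "(Lp_norm 2 h)\<^sup>2 \<le> q"
proof -
  have "sq_mass h \<le> (\<integral>\<^sup>+x. ennreal ((U x)\<^sup>2) \<partial>lborel)"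
    unfolding sq_mass_def
  proof (rule nn_integral_mono_AE)
    show "AE x in lborel. ennreal ((cmod (h x))\<^sup>2) \<le> ennreal ((U x)\<^sup>2)"
      using le by eventually_elim (auto intro!: ennreal_leI power_mono)
  qed
  also note q(1)
  finally have m: "sq_mass h \<le> ennreal q" .
  show *: "h \<in> Lp_space 2"
    using le_less_trans[OF m] h by (simp add: L2_iff)
  show "(Lp_norm 2 h)\<^sup>2 \<le> q"
    using m q(2) unfolding sq_mass_eq[OF *] by simp
qed

lemma high_frequency_estimate:
  fixes F0 F1 :: "'a::euclidean_space \<Rightarrow> complex"
  assumes F: "F0 \<in> Lp_space 2" "F1 \<in> Lp_space 2"
    and [measurable]: "U \<in> borel_measurable borel" and U0: "\<And>\<xi>. 0 \<le> U \<xi>" and M: "0 \<le> M"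
    and le: "AE \<xi> in lborel. 1 \<le> norm \<xi> \<longrightarrow> U \<xi> \<le> M * (cmod (F0 \<xi>) + cmod (F1 \<xi>))"
  shows "(\<integral>\<^sup>+\<xi>. ennreal ((U \<xi>)\<^sup>2) * indicator (- cball 0 1) \<xi> \<partial>lborel) \<le> ennreal (2 * (M * (Lp_norm 2 F0 + Lp_norm 2 F1))\<^sup>2)"
proof -
  note [measurable] = L2_measurable[OF F(1)] L2_measurable[OF F(2)]
  have "(\<integral>\<^sup>+\<xi>. ennreal ((U \<xi>)\<^sup>2) * indicator (- cball 0 1) \<xi> \<partial>lborel) \<le>
    (\<integral>\<^sup>+\<xi>. ennreal (2 * M\<^sup>2) * ennreal ((cmod (F0 \<xi>))\<^sup>2) + ennreal (2 * M\<^sup>2) * ennreal ((cmod (F1 \<xi>))\<^sup>2) \<partial>lborel)"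
  proof (rule nn_integral_mono_AE)
    show "AE \<xi> in lborel. ennreal ((U \<xi>)\<^sup>2) * indicator (- cball 0 1) \<xi> \<le>
      ennreal (2 * M\<^sup>2) * ennreal ((cmod (F0 \<xi>))\<^sup>2) + ennreal (2 * M\<^sup>2) * ennreal ((cmod (F1 \<xi>))\<^sup>2)"
      using le
    proof eventually_elim
      case (elim \<xi>)
      show ?case
      proof (cases "1 < norm \<xi>")
        case True
        then have "(U \<xi>)\<^sup>2 \<le> (M * (cmod (F0 \<xi>) + cmod (F1 \<xi>)))\<^sup>2"
          using elim U0 by (intro power_mono) auto
        also have "\<dots> \<le> M\<^sup>2 * (2 * (cmod (F0 \<xi>))\<^sup>2 + 2 * (cmod (F1 \<xi>))\<^sup>2)"
          unfolding power_mult_distrib using sum_squares_bound[of "cmod (F0 \<xi>)" "cmod (F1 \<xi>)"]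
          by (intro mult_left_mono) (auto simp: power2_sum)
        also have "\<dots> = 2 * M\<^sup>2 * (cmod (F0 \<xi>))\<^sup>2 + 2 * M\<^sup>2 * (cmod (F1 \<xi>))\<^sup>2"
          by (simp add: algebra_simps)
        finally have "ennreal ((U \<xi>)\<^sup>2) \<le> ennreal (2 * M\<^sup>2 * (cmod (F0 \<xi>))\<^sup>2 + 2 * M\<^sup>2 * (cmod (F1 \<xi>))\<^sup>2)"
          by (rule ennreal_leI)
        also have "\<dots> = ennreal (2 * M\<^sup>2) * ennreal ((cmod (F0 \<xi>))\<^sup>2) + ennreal (2 * M\<^sup>2) * ennreal ((cmod (F1 \<xi>))\<^sup>2)"
          by (subst ennreal_mult_add_mult) auto
        finally show ?thesis using True by simp
      qed simp
    qed
  qed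
  also have "\<dots> = ennreal (2 * M\<^sup>2) * sq_mass F0 + ennreal (2 * M\<^sup>2) * sq_mass F1"
    unfolding sq_mass_def by (subst nn_integral_add) (auto simp: nn_integral_cmult)
  also have "\<dots> = ennreal (2 * M\<^sup>2 * (Lp_norm 2 F0)\<^sup>2 + 2 * M\<^sup>2 * (Lp_norm 2 F1)\<^sup>2)"
    unfolding sq_mass_eq[OF F(1)] sq_mass_eq[OF F(2)] by (subst ennreal_mult_add_mult) auto
  also have "\<dots> \<le> ennreal (2 * (M * (Lp_norm 2 F0 + Lp_norm 2 F1))\<^sup>2)"
  proof (rule ennreal_leI)
    have "2 * M\<^sup>2 * (Lp_norm 2 F0)\<^sup>2 + 2 * M\<^sup>2 * (Lp_norm 2 F1)\<^sup>2 = 2 * M\<^sup>2 * ((Lp_norm 2 F0)\<^sup>2 + (Lp_norm 2 F1)\<^sup>2)"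
      by (simp add: algebra_simps)
    also have "\<dots> \<le> 2 * M\<^sup>2 * (Lp_norm 2 F0 + Lp_norm 2 F1)\<^sup>2"
      by (intro mult_left_mono) (auto simp: power2_sum)
    finally show "2 * M\<^sup>2 * (Lp_norm 2 F0)\<^sup>2 + 2 * M\<^sup>2 * (Lp_norm 2 F1)\<^sup>2 \<le> 2 * (M * (Lp_norm 2 F0 + Lp_norm 2 F1))\<^sup>2"
      by (simp add: power_mult_distrib)
  qed
  finally show ?thesis .
qed

lemma L2_limit_eq_pointwise_limit:
  fixes H P :: "'a::euclidean_space \<Rightarrow> complex"
  assumes Q: "\<And>n. Q n \<in> Lp_space 2" and H: "H \<in> Lp_space 2"
    and lim: "(\<lambda>n. Lp_norm 2 (\<lambda>\<xi>. Q n \<xi> - H \<xi>)) \<longlonglongrightarrow> 0"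
    and pw: "AE \<xi> in lborel. (\<lambda>n. Q n \<xi>) \<longlonglongrightarrow> P \<xi>"
  shows "AE \<xi> in lborel. P \<xi> = H \<xi>"
proof -
  note [measurable] = L2_measurable[OF Q] L2_measurable[OF H]
  have "(\<integral>\<^sup>+\<xi>. liminf (\<lambda>n. ennreal ((cmod (Q n \<xi> - H \<xi>))\<^sup>2)) \<partial>lborel) \<le>
     liminf (\<lambda>n. \<integral>\<^sup>+\<xi>. ennreal ((cmod (Q n \<xi> - H \<xi>))\<^sup>2) \<partial>lborel)"
    by (rule nn_integral_liminf) auto
  also have "\<dots> = 0"
  proof -
    have "(\<lambda>n. sq_mass (\<lambda>\<xi>. Q n \<xi> - H \<xi>)) \<longlonglongrightarrow> 0"
      using lim by (subst sq_mass_tendsto_iff) (auto intro!: L2_diff Q H)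
    then show ?thesis
      unfolding sq_mass_def by (intro lim_imp_Liminf) auto
  qed
  finally have "AE \<xi> in lborel. liminf (\<lambda>n. ennreal ((cmod (Q n \<xi> - H \<xi>))\<^sup>2)) = 0"
    by (subst (asm) le_zero_eq, subst (asm) nn_integral_0_iff_AE) auto
  with pw show ?thesis
  proof eventually_elim
    case (elim \<xi>)
    have "(\<lambda>n. ennreal ((cmod (Q n \<xi> - H \<xi>))\<^sup>2)) \<longlonglongrightarrow> ennreal ((cmod (P \<xi> - H \<xi>))\<^sup>2)"
      by (intro tendsto_ennrealI tendsto_intros elim)
    then have "liminf (\<lambda>n. ennreal ((cmod (Q n \<xi> - H \<xi>))\<^sup>2)) = ennreal ((cmod (P \<xi> - H \<xi>))\<^sup>2)"
      by (intro lim_imp_Liminf) auto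
    then show ?case using elim(2) by simp
  qed
qed

text \<open>Both derivatives are limits of the same difference quotients.\<close>

lemma fourier_time_derivative:
  fixes v vt :: "real \<Rightarrow> 'a::euclidean_space \<Rightarrow> complex"
  assumes v: "\<And>t. 0 \<le> t \<Longrightarrow> v t \<in> Lp_space 2" and vt: "\<And>t. 0 \<le> t \<Longrightarrow> vt t \<in> Lp_space 2"
    and D: "curve_has_derivative (Lp_norm 2) v vt"
    and w: "\<And>t. 0 \<le> t \<Longrightarrow> AE \<xi> in lborel. w t \<xi> = fourier_L2 (v t) \<xi>"
    and w': "AE \<xi> in lborel. \<forall>t\<ge>0. ((\<lambda>s. w s \<xi>) has_vector_derivative w' t \<xi>) (at t within {0..})"
    and t: "0 \<le> t"
  shows "AE \<xi> in lborel. w' t \<xi> = fourier_L2 (vt t) \<xi>"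
proof -
  \<comment> \<open>From the right, so that t = 0 is covered by derivatives within the half-line;
    along a sequence, so that only countably many null sets arise.\<close>
  define s where "s n = t + 1 / real (Suc n)" for n
  have s: "0 \<le> s n" "s n \<noteq> t" "t < s n" for n using t by (auto simp: s_def)
  have s_lim: "filterlim s (at t within {0..}) sequentially"
  proof -
    have "(\<lambda>n. t + 1 / real (Suc n)) \<longlonglongrightarrow> t + 0"
      by (intro tendsto_intros LIMSEQ_Suc lim_1_over_n)
    then show ?thesis
      using s unfolding filterlim_at by (auto simp: s_def[abs_def])
  qed
  define q where "q n x = (1 / of_real (s n - t)) * (v (s n) x - v t x)" for n x
  define Q where "Q n \<xi> = (1 / of_real (s n - t)) * (fourier_L2 (v (s n)) \<xi> - fourier_L2 (v t) \<xi>)" for n \<xi>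
  have qQ: "is_fourier_L2 (q n) (Q n)" for n
    unfolding q_def Q_def
    by (intro is_fourier_L2_scale is_fourier_L2_diff is_fourier_L2_fourier_L2 v s t)
  have H: "is_fourier_L2 (vt t) (fourier_L2 (vt t))" by (rule is_fourier_L2_fourier_L2[OF vt[OF t]])
  have "((\<lambda>s. Lp_norm 2 (\<lambda>x. (v s x - v t x) / of_real (s - t) - vt t x)) \<longlongrightarrow> 0) (at t within {0..})"
    using D t unfolding curve_has_derivative_def by blast
  from filterlim_compose[OF this s_lim]
  have "(\<lambda>n. Lp_norm 2 (\<lambda>x. q n x - vt t x)) \<longlonglongrightarrow> 0" by (simp add: q_def)
  then have lim: "(\<lambda>n. Lp_norm 2 (\<lambda>\<xi>. Q n \<xi> - fourier_L2 (vt t) \<xi>)) \<longlonglongrightarrow> 0"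
    unfolding is_fourier_L2_dist[OF qQ H] .
  have "AE \<xi> in lborel. \<forall>n. w (s n) \<xi> = fourier_L2 (v (s n)) \<xi>"
    unfolding AE_all_countable using w s by blast
  with w[OF t] w' have "AE \<xi> in lborel. (\<lambda>n. Q n \<xi>) \<longlonglongrightarrow> w' t \<xi>"
  proof eventually_elim
    case (elim \<xi>)
    have "((\<lambda>s. w s \<xi>) has_vector_derivative w' t \<xi>) (at t within {0..})" using elim(2) t by blast
    then have "((\<lambda>y. (1 / norm (y - t)) *\<^sub>R (w y \<xi> - (w t \<xi> + (y - t) *\<^sub>R w' t \<xi>))) \<longlongrightarrow> 0) (at t within {0..})"
      unfolding has_vector_derivative_def has_derivative_within by simp
    from filterlim_compose[OF this s_lim]
    have "(\<lambda>n. (1 / norm (s n - t)) *\<^sub>R (w (s n) \<xi> - (w t \<xi> + (s n - t) *\<^sub>R w' t \<xi>))) \<longlonglongrightarrow> 0" .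
    moreover have "(1 / norm (s n - t)) *\<^sub>R (w (s n) \<xi> - (w t \<xi> + (s n - t) *\<^sub>R w' t \<xi>)) = Q n \<xi> - w' t \<xi>" for n
    proof -
      have "(1 / norm h) *\<^sub>R (a - (b + h *\<^sub>R c)) = (1 / of_real h) * (a - b) - c" if "0 < h" for h and a b c :: complex
        using that by (simp add: scaleR_conv_of_real field_simps)
      from this[of "s n - t"] show ?thesis using s(3)[of n] elim(1,3) by (simp add: Q_def)
    qed
    ultimately show ?case by (simp add: LIM_zero_iff)
  qed
  from L2_limit_eq_pointwise_limit[OF is_fourier_L2_D(2)[OF qQ] is_fourier_L2_D(2)[OF H] lim this]
  show ?thesis .
qed

lemma H1_space_L2: "f \<in> H1_space \<Longrightarrow> f \<in> Lp_space 2"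
  by (simp add: H1_space_def)

lemma Lp_norm_2_mono:
  assumes "f \<in> Lp_space 2" "g \<in> Lp_space 2" "\<And>x. cmod (f x) \<le> cmod (g x)"
  shows "Lp_norm 2 f \<le> Lp_norm 2 g"
  unfolding Lp_norm_2
  by (intro real_sqrt_le_mono integral_mono L2_sq_integrable assms power_mono) auto

lemma H1_norm_ge:
  assumes f: "f \<in> H1_space"
  shows "Lp_norm 2 f \<le> H1_norm f" and "(\<lambda>\<xi>. of_real (norm \<xi>) * fourier_L2 f \<xi>) \<in> Lp_space 2"
proof -
  note F = is_fourier_L2_fourier_L2[OF H1_space_L2[OF f]]
  note FL = is_fourier_L2_D(2)[OF F]
  note [measurable] = L2_measurable[OF FL]
  have G: "(\<lambda>\<xi>. of_real (sqrt (1 + (norm \<xi>)\<^sup>2)) * fourier_L2 f \<xi>) \<in> Lp_space 2"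
    using f by (simp add: H1_space_def)
  have 1: "1 \<le> sqrt (1 + (norm \<xi>)\<^sup>2)" for \<xi> :: 'a by simp
  have 2: "norm \<xi> \<le> sqrt (1 + (norm \<xi>)\<^sup>2)" for \<xi> :: 'a by (rule real_le_rsqrt) simp
  have "Lp_norm 2 (fourier_L2 f) \<le> H1_norm f"
    unfolding H1_norm_def
  proof (rule Lp_norm_2_mono[OF FL G])
    show "cmod (fourier_L2 f \<xi>) \<le> cmod (of_real (sqrt (1 + (norm \<xi>)\<^sup>2)) * fourier_L2 f \<xi>)" for \<xi>
      using mult_right_mono[OF 1[of \<xi>], of "cmod (fourier_L2 f \<xi>)"] by (simp add: norm_mult)
  qed
  then show "Lp_norm 2 f \<le> H1_norm f" by (simp add: is_fourier_L2_norm[OF F])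
  show "(\<lambda>\<xi>. of_real (norm \<xi>) * fourier_L2 f \<xi>) \<in> Lp_space 2"
  proof (rule L2_dominated[OF G])
    show "cmod (of_real (norm \<xi>) * fourier_L2 f \<xi>) \<le> cmod (of_real (sqrt (1 + (norm \<xi>)\<^sup>2)) * fourier_L2 f \<xi>)" for \<xi>
      using mult_right_mono[OF 2[of \<xi>], of "cmod (fourier_L2 f \<xi>)"] by (simp add: norm_mult)
  qed measurable
qed

text \<open>The coordinates of \<open>(\<rho> a, b)\<close> in the frame that the free flow rotates; the scattering state
  is their limit.\<close>

definition profile1 :: "real \<Rightarrow> real \<Rightarrow> complex \<Rightarrow> complex \<Rightarrow> complex" where
  "profile1 \<rho> t a b = of_real (\<rho> * cos (\<rho> * t)) * a - of_real (sin (\<rho> * t)) * b"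

definition profile2 :: "real \<Rightarrow> real \<Rightarrow> complex \<Rightarrow> complex \<Rightarrow> complex" where
  "profile2 \<rho> t a b = of_real (\<rho> * sin (\<rho> * t)) * a + of_real (cos (\<rho> * t)) * b"

definition wave_profile1 :: "(real \<Rightarrow> 'a::euclidean_space \<Rightarrow> complex) \<Rightarrow> (real \<Rightarrow> 'a \<Rightarrow> complex) \<Rightarrow> real \<Rightarrow> 'a \<Rightarrow> complex" where
  "wave_profile1 v vt t \<xi> = profile1 (norm \<xi>) t (fourier_L2 (v t) \<xi>) (fourier_L2 (vt t) \<xi>)"

definition wave_profile2 :: "(real \<Rightarrow> 'a::euclidean_space \<Rightarrow> complex) \<Rightarrow> (real \<Rightarrow> 'a \<Rightarrow> complex) \<Rightarrow> real \<Rightarrow> 'a \<Rightarrow> complex" where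
  "wave_profile2 v vt t \<xi> = profile2 (norm \<xi>) t (fourier_L2 (v t) \<xi>) (fourier_L2 (vt t) \<xi>)"

text \<open>Only the chosen transforms at time \<open>t\<close> and at integer times occur. Thus the
  limit is measurable in the frequency, and the modes \<open>w\<close> can be identified with these
  transforms off one null set.\<close>

definition profile_error :: "(real \<Rightarrow> 'a::euclidean_space \<Rightarrow> complex) \<Rightarrow> (real \<Rightarrow> 'a \<Rightarrow> complex) \<Rightarrow> real \<Rightarrow> 'a \<Rightarrow> real" where
  "profile_error v vt t \<xi> =
    cmod (wave_profile1 v vt t \<xi> - lim (\<lambda>n. wave_profile1 v vt (real n) \<xi>)) +
    cmod (wave_profile2 v vt t \<xi> - lim (\<lambda>n. wave_profile2 v vt (real n) \<xi>))"

text \<open>Undoing the rotation recovers the two energy components from the profiles.\<close>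

lemma profile_rotate:
  "of_real (cos (\<rho> * t)) * profile1 \<rho> t a b + of_real (sin (\<rho> * t)) * profile2 \<rho> t a b = of_real \<rho> * a"
  "- of_real (sin (\<rho> * t)) * profile1 \<rho> t a b + of_real (cos (\<rho> * t)) * profile2 \<rho> t a b = b"
proof -
  have sc: "complex_of_real (cos (\<rho> * t)) * of_real (cos (\<rho> * t)) + of_real (sin (\<rho> * t)) * of_real (sin (\<rho> * t)) = 1"
    using arg_cong[OF sin_cos_squared_add3[of "\<rho> * t"], of complex_of_real] by (simp only: of_real_add of_real_mult of_real_1)
  have "c * (r * c * a - s * b) + s * (r * s * a + c * b) = (c * c + s * s) * (r * a)"
    "- s * (r * c * a - s * b) + c * (r * s * a + c * b) = (c * c + s * s) * b" for c s r :: complex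
    by (simp_all add: algebra_simps)
  from this[where c="of_real (cos (\<rho> * t))" and r="of_real \<rho>" and s="of_real (sin (\<rho> * t))"]
  show "of_real (cos (\<rho> * t)) * profile1 \<rho> t a b + of_real (sin (\<rho> * t)) * profile2 \<rho> t a b = of_real \<rho> * a"
    "- of_real (sin (\<rho> * t)) * profile1 \<rho> t a b + of_real (cos (\<rho> * t)) * profile2 \<rho> t a b = b"
    unfolding profile1_def profile2_def of_real_mult sc by simp_all
qed

text \<open>The free part of the equation cancels and only the potential acts. The factor |\<mu>| of
  the final estimate originates here.\<close>

lemma profile_deriv:
  assumes sol: "complex_mode \<mu> \<rho> w w'" and t: "0 \<le> t"
  shows "((\<lambda>t. profile1 \<rho> t (w t) (w' t)) has_vector_derivative of_real (\<mu> / (1 + t)\<^sup>2 * sin (\<rho> * t)) * w t) (at t within {0..})"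
    and "((\<lambda>t. profile2 \<rho> t (w t) (w' t)) has_vector_derivative of_real (- (\<mu> / (1 + t)\<^sup>2) * cos (\<rho> * t)) * w t) (at t within {0..})"
proof -
  note D = complex_mode_D[OF sol t]
  define m where "m = complex_of_real (\<mu> / (1 + t)\<^sup>2)"
  have c: "((\<lambda>t. \<rho> * cos (\<rho> * t)) has_real_derivative - (\<rho> * \<rho> * sin (\<rho> * t))) (at t within {0..})"
    and c1: "((\<lambda>t. cos (\<rho> * t)) has_real_derivative - (\<rho> * sin (\<rho> * t))) (at t within {0..})"
    and s: "((\<lambda>t. \<rho> * sin (\<rho> * t)) has_real_derivative \<rho> * \<rho> * cos (\<rho> * t)) (at t within {0..})"
    and s1: "((\<lambda>t. sin (\<rho> * t)) has_real_derivative \<rho> * cos (\<rho> * t)) (at t within {0..})"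
    by (auto intro!: derivative_eq_intros)
  have "((\<lambda>t. (\<rho> * cos (\<rho> * t)) *\<^sub>R w t - sin (\<rho> * t) *\<^sub>R w' t) has_vector_derivative
     ((\<rho> * cos (\<rho> * t)) *\<^sub>R w' t + (- (\<rho> * \<rho> * sin (\<rho> * t))) *\<^sub>R w t) -
     (sin (\<rho> * t) *\<^sub>R (- of_real (\<rho>\<^sup>2) * w t - of_real (\<mu> / (1 + t)\<^sup>2) * w t) + (\<rho> * cos (\<rho> * t)) *\<^sub>R w' t)) (at t within {0..})"
    by (intro has_vector_derivative_diff has_vector_derivative_scaleR c s1 D)
  also have "((\<rho> * cos (\<rho> * t)) *\<^sub>R w' t + (- (\<rho> * \<rho> * sin (\<rho> * t))) *\<^sub>R w t) -
     (sin (\<rho> * t) *\<^sub>R (- of_real (\<rho>\<^sup>2) * w t - of_real (\<mu> / (1 + t)\<^sup>2) * w t) + (\<rho> * cos (\<rho> * t)) *\<^sub>R w' t)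
     = of_real (\<mu> / (1 + t)\<^sup>2 * sin (\<rho> * t)) * w t"
    unfolding of_real_mult m_def[symmetric] scaleR_conv_of_real power2_eq_square by (simp add: algebra_simps)
  finally show "((\<lambda>t. profile1 \<rho> t (w t) (w' t)) has_vector_derivative of_real (\<mu> / (1 + t)\<^sup>2 * sin (\<rho> * t)) * w t) (at t within {0..})"
    unfolding profile1_def scaleR_conv_of_real .
  have "((\<lambda>t. (\<rho> * sin (\<rho> * t)) *\<^sub>R w t + cos (\<rho> * t) *\<^sub>R w' t) has_vector_derivative
     ((\<rho> * sin (\<rho> * t)) *\<^sub>R w' t + (\<rho> * \<rho> * cos (\<rho> * t)) *\<^sub>R w t) +
     (cos (\<rho> * t) *\<^sub>R (- of_real (\<rho>\<^sup>2) * w t - of_real (\<mu> / (1 + t)\<^sup>2) * w t) + (- (\<rho> * sin (\<rho> * t))) *\<^sub>R w' t)) (at t within {0..})"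
    by (intro has_vector_derivative_add has_vector_derivative_scaleR s c1 D)
  also have "((\<rho> * sin (\<rho> * t)) *\<^sub>R w' t + (\<rho> * \<rho> * cos (\<rho> * t)) *\<^sub>R w t) +
     (cos (\<rho> * t) *\<^sub>R (- of_real (\<rho>\<^sup>2) * w t - of_real (\<mu> / (1 + t)\<^sup>2) * w t) + (- (\<rho> * sin (\<rho> * t))) *\<^sub>R w' t)
     = of_real (- (\<mu> / (1 + t)\<^sup>2) * cos (\<rho> * t)) * w t"
    unfolding of_real_mult of_real_minus m_def[symmetric] scaleR_conv_of_real power2_eq_square by (simp add: algebra_simps)
  finally show "((\<lambda>t. profile2 \<rho> t (w t) (w' t)) has_vector_derivative of_real (- (\<mu> / (1 + t)\<^sup>2) * cos (\<rho> * t)) * w t) (at t within {0..})"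
    unfolding profile2_def scaleR_conv_of_real .
qed

lemma profile_limit:
  assumes sol: "complex_mode \<mu> \<rho> w w'" and B: "0 \<le> B" and \<kappa>: "\<kappa> < 1"
    and bound: "\<And>t. 0 \<le> t \<Longrightarrow> cmod (w t) \<le> B * ((1 + t) powr \<kappa> * (1 + ln (1 + t)) powr \<delta>)"
    and \<delta>: "\<delta> = 0 \<or> \<delta> = 1" and t: "0 \<le> t"
  shows "cmod (profile1 \<rho> t (w t) (w' t) - lim (\<lambda>n. profile1 \<rho> (real n) (w (real n)) (w' (real n)))) \<le>
      \<bar>\<mu>\<bar> * B * tail_const \<kappa> * ((1 + t) powr (\<kappa> - 1) * (1 + ln (1 + t)) powr \<delta>)" (is ?le1)
    and "cmod (profile2 \<rho> t (w t) (w' t) - lim (\<lambda>n. profile2 \<rho> (real n) (w (real n)) (w' (real n)))) \<le>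
      \<bar>\<mu>\<bar> * B * tail_const \<kappa> * ((1 + t) powr (\<kappa> - 1) * (1 + ln (1 + t)) powr \<delta>)" (is ?le2)
proof -
  have *: "cmod (of_real (\<mu> / (1 + s)\<^sup>2 * x) * w s) \<le> (\<bar>\<mu>\<bar> * B) * (1 + s) powr (\<kappa> - 2) * (1 + ln (1 + s)) powr \<delta>"
    if s: "0 \<le> s" and x: "\<bar>x\<bar> \<le> 1" for s x
  proof -
    have "cmod (of_real (\<mu> / (1 + s)\<^sup>2 * x) * w s) = \<bar>\<mu>\<bar> / (1 + s)\<^sup>2 * \<bar>x\<bar> * cmod (w s)"
      by (simp only: norm_mult norm_of_real abs_mult abs_divide) simp
    also have "\<dots> \<le> \<bar>\<mu>\<bar> / (1 + s)\<^sup>2 * 1 * (B * ((1 + s) powr \<kappa> * (1 + ln (1 + s)) powr \<delta>))"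
      using s x by (intro mult_mono bound) auto
    also have "(1 + s) powr (\<kappa> - 2) = (1 + s) powr \<kappa> / (1 + s)\<^sup>2"
      using s by (simp add: powr_diff)
    then have "\<bar>\<mu>\<bar> / (1 + s)\<^sup>2 * 1 * (B * ((1 + s) powr \<kappa> * (1 + ln (1 + s)) powr \<delta>)) =
        (\<bar>\<mu>\<bar> * B) * (1 + s) powr (\<kappa> - 2) * (1 + ln (1 + s)) powr \<delta>"
      by simp
    finally show ?thesis .
  qed
  have **: "cmod (of_real (- (\<mu> / (1 + s)\<^sup>2) * x) * w s) \<le> (\<bar>\<mu>\<bar> * B) * (1 + s) powr (\<kappa> - 2) * (1 + ln (1 + s)) powr \<delta>"
    if s: "0 \<le> s" and x: "\<bar>x\<bar> \<le> 1" for s x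
    using *[of s "- x"] that by simp
  have M: "0 \<le> \<bar>\<mu>\<bar> * B" using B by simp
  show ?le1
    unfolding tail_const_def
    by (rule limit_of_decaying_derivative(2)[OF profile_deriv(1)[OF sol] * \<kappa> \<delta> M t]) auto
  show ?le2
    unfolding tail_const_def
    by (rule limit_of_decaying_derivative(2)[OF profile_deriv(2)[OF sol] ** \<kappa> \<delta> M t]) auto
qed

section \<open>The scattering state\<close>

lemma L2_cong_AE:
  assumes "g \<in> Lp_space 2" "f \<in> borel_measurable borel" "AE x in lborel. f x = g x"
  shows "f \<in> Lp_space 2"
proof -
  have "sq_mass f = sq_mass g" by (rule sq_mass_cong_AE) (use assms(3) in auto)
  then show ?thesis using assms by (simp add: L2_iff)
qed

lemma profile_measurable [measurable]:
  fixes f g :: "'a::euclidean_space \<Rightarrow> complex"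
  assumes [measurable]: "f \<in> borel_measurable borel" "g \<in> borel_measurable borel"
  shows "(\<lambda>\<xi>. profile1 (norm \<xi>) t (f \<xi>) (g \<xi>)) \<in> borel_measurable borel"
    "(\<lambda>\<xi>. profile2 (norm \<xi>) t (f \<xi>) (g \<xi>)) \<in> borel_measurable borel"
  unfolding profile1_def profile2_def by measurable

text \<open>The definition of a solution links only \<open>w\<close> to a transform, namely that of
  \<open>v\<close>. The corresponding link between \<open>w'\<close> and \<open>vt\<close> has to be
  derived, at each time outside a null set.\<close>

lemma wave_solution_modes:
  fixes v vt :: "real \<Rightarrow> 'a::euclidean_space \<Rightarrow> complex"
  assumes sol: "is_wave_solution \<mu> v0 v1 v vt"
  obtains w w' where
    "AE \<xi> in lborel. complex_mode \<mu> (norm \<xi>) (\<lambda>t. w t \<xi>) (\<lambda>t. w' t \<xi>) \<and> w 0 \<xi> = fourier_L2 v0 \<xi> \<and> w' 0 \<xi> = fourier_L2 v1 \<xi>"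
    "\<And>t. 0 \<le> t \<Longrightarrow> AE \<xi> in lborel. w t \<xi> = fourier_L2 (v t) \<xi>"
    "\<And>t. 0 \<le> t \<Longrightarrow> AE \<xi> in lborel. w' t \<xi> = fourier_L2 (vt t) \<xi>"
proof -
  from sol obtain w w' where w: "\<forall>t\<ge>0. AE \<xi> in lborel. w t \<xi> = fourier_L2 (v t) \<xi>"
    and ode: "AE \<xi> in lborel.
           w 0 \<xi> = fourier_L2 v0 \<xi> \<and> w' 0 \<xi> = fourier_L2 v1 \<xi> \<and>
           (\<forall>t\<ge>0.
              ((\<lambda>s. w s \<xi>) has_vector_derivative w' t \<xi>) (at t within {0..}) \<and>
              ((\<lambda>s. w' s \<xi>) has_vector_derivative
                 (- of_real ((norm \<xi>)\<^sup>2) * w t \<xi> - of_real (\<mu> / (1 + t)\<^sup>2) * w t \<xi>))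
                 (at t within {0..}))"
    unfolding is_wave_solution_def by blast
  have vL: "v t \<in> Lp_space 2" "vt t \<in> Lp_space 2" if "0 \<le> t" for t
    using sol that unfolding is_wave_solution_def by (auto intro: H1_space_L2)
  have D: "curve_has_derivative (Lp_norm 2) v vt"
    using sol unfolding is_wave_solution_def by blast
  show thesis
  proof (rule that)
    show "AE \<xi> in lborel. complex_mode \<mu> (norm \<xi>) (\<lambda>t. w t \<xi>) (\<lambda>t. w' t \<xi>) \<and> w 0 \<xi> = fourier_L2 v0 \<xi> \<and> w' 0 \<xi> = fourier_L2 v1 \<xi>"
      using ode by eventually_elim (auto simp: complex_mode_def)
    show "AE \<xi> in lborel. w t \<xi> = fourier_L2 (v t) \<xi>" if "0 \<le> t" for t
      using w that by blast
    have "AE \<xi> in lborel. \<forall>t\<ge>0. ((\<lambda>s. w s \<xi>) has_vector_derivative w' t \<xi>) (at t within {0..})"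
      using ode by eventually_elim blast
    then show "AE \<xi> in lborel. w' t \<xi> = fourier_L2 (vt t) \<xi>" if "0 \<le> t" for t
      using w that by (intro fourier_time_derivative[OF vL(1) vL(2) D]) auto
  qed
qed

text \<open>Each of the two profiles contributes once, whence the factor 2. At low frequencies
  \<gamma> stays free; at high ones the modes are bounded, so \<kappa> = 0 without a
  logarithm.\<close>

lemma profile_difference_bound:
  fixes v vt :: "real \<Rightarrow> 'a::euclidean_space \<Rightarrow> complex"
  assumes sol: "is_wave_solution \<mu> v0 v1 v vt" and t: "0 \<le> t"
    and K: "0 < K" and bounds: "mode_growth_bound \<mu> K"
  shows "low_frequency_bound \<mu> (2 * \<bar>\<mu>\<bar> * K) t (profile_error v vt t) (fourier_L2 v0) (fourier_L2 v1)"
    and "AE \<xi> in lborel. 1 \<le> norm \<xi> \<longrightarrow> profile_error v vt t \<xi> \<le>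
      2 * \<bar>\<mu>\<bar> * K * tail_const 0 * (1 + t) powr (-1) * (cmod (fourier_L2 v0 \<xi>) + cmod (fourier_L2 v1 \<xi>))"
proof -
  note bounds = bounds[unfolded mode_growth_bound_def, rule_format, THEN conjunct1, rule_format]
    bounds[unfolded mode_growth_bound_def, rule_format, THEN conjunct2, rule_format]
  obtain w w' where mode: "AE \<xi> in lborel. complex_mode \<mu> (norm \<xi>) (\<lambda>t. w t \<xi>) (\<lambda>t. w' t \<xi>) \<and> w 0 \<xi> = fourier_L2 v0 \<xi> \<and> w' 0 \<xi> = fourier_L2 v1 \<xi>"
    and w: "\<And>t. 0 \<le> t \<Longrightarrow> AE \<xi> in lborel. w t \<xi> = fourier_L2 (v t) \<xi>"
    and w': "\<And>t. 0 \<le> t \<Longrightarrow> AE \<xi> in lborel. w' t \<xi> = fourier_L2 (vt t) \<xi>"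
    using wave_solution_modes[OF sol] by blast
  \<comment> \<open>One null set for all integer times, the times that enter the limit.\<close>
  have "AE \<xi> in lborel. \<forall>n. w (real n) \<xi> = fourier_L2 (v (real n)) \<xi>" "AE \<xi> in lborel. \<forall>n. w' (real n) \<xi> = fourier_L2 (vt (real n)) \<xi>"
    unfolding AE_all_countable using w w' by auto
  with w[OF t] w'[OF t] have prof: "AE \<xi> in lborel. profile_error v vt t \<xi> =
     cmod (profile1 (norm \<xi>) t (w t \<xi>) (w' t \<xi>) - lim (\<lambda>n. profile1 (norm \<xi>) (real n) (w (real n) \<xi>) (w' (real n) \<xi>))) +
     cmod (profile2 (norm \<xi>) t (w t \<xi>) (w' t \<xi>) - lim (\<lambda>n. profile2 (norm \<xi>) (real n) (w (real n) \<xi>) (w' (real n) \<xi>)))"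
    by eventually_elim (simp add: profile_error_def wave_profile1_def wave_profile2_def)
  show "low_frequency_bound \<mu> (2 * \<bar>\<mu>\<bar> * K) t (profile_error v vt t) (fourier_L2 v0) (fourier_L2 v1)"
    unfolding low_frequency_bound_def
    using mode prof AE_norm_pos[where 'a='a]
  proof eventually_elim
    case (elim \<xi>)
    show ?case
    proof (intro impI allI)
      fix \<gamma> assume \<rho>: "norm \<xi> \<le> 1" and \<gamma>: "0 \<le> \<gamma>" "\<gamma> \<le> growth_rate \<mu>" "growth_rate \<mu> - \<gamma> < 1"
      let ?D = "cmod (fourier_L2 v0 \<xi>) + cmod (fourier_L2 v1 \<xi>)"
      define B where "B = K * norm \<xi> powr (-\<gamma>) * ?D"
      have B: "0 \<le> B" using K by (simp add: B_def)
      have m: "complex_mode \<mu> (norm \<xi>) (\<lambda>t. w t \<xi>) (\<lambda>t. w' t \<xi>)" using elim(1) by blast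
      have b: "cmod (w s \<xi>) \<le> B * ((1 + s) powr (growth_rate \<mu> - \<gamma>) * (1 + ln (1 + s)) powr delta \<mu>)" if "0 \<le> s" for s
        using bounds(1)[OF m elim(3) that \<rho> \<gamma>(1,2)] elim(1) by (simp add: B_def mult_ac)
      show "profile_error v vt t \<xi> \<le> 2 * \<bar>\<mu>\<bar> * K * tail_const (growth_rate \<mu> - \<gamma>) * (norm \<xi> powr (-\<gamma>) *
         ((1 + t) powr (growth_rate \<mu> - \<gamma> - 1) * (1 + ln (1 + t)) powr delta \<mu>)) * ?D"
        using profile_limit[OF m B \<gamma>(3) b delta_cases t] unfolding elim(2)
        by (simp add: B_def mult_ac)
    qed
  qed
  show "AE \<xi> in lborel. 1 \<le> norm \<xi> \<longrightarrow> profile_error v vt t \<xi> \<le> 2 * \<bar>\<mu>\<bar> * K * tail_const 0 * (1 + t) powr (-1) * (cmod (fourier_L2 v0 \<xi>) + cmod (fourier_L2 v1 \<xi>))"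
    using mode prof AE_norm_pos[where 'a='a]
  proof eventually_elim
    case (elim \<xi>)
    show ?case
    proof
      assume \<rho>: "1 \<le> norm \<xi>"
      let ?D = "cmod (fourier_L2 v0 \<xi>) + cmod (fourier_L2 v1 \<xi>)"
      have B: "0 \<le> K * ?D" using K by simp
      have m: "complex_mode \<mu> (norm \<xi>) (\<lambda>t. w t \<xi>) (\<lambda>t. w' t \<xi>)" using elim(1) by blast
      have one: "(1 + ln (1 + s)) powr 0 = 1" if "0 \<le> s" for s :: real
      proof -
        have "0 \<le> ln (1 + s)" using that by simp
        then have "1 + ln (1 + s) \<noteq> 0" by linarith
        then show ?thesis by simp
      qed
      have b: "cmod (w s \<xi>) \<le> K * ?D * ((1 + s) powr 0 * (1 + ln (1 + s)) powr 0)" if "0 \<le> s" for s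
        using bounds(2)[OF m elim(3) that \<rho>] elim(1) that one[OF that] by simp
      have "profile_error v vt t \<xi> \<le> \<bar>\<mu>\<bar> * (K * ?D) * tail_const 0 * ((1 + t) powr (0 - 1) * (1 + ln (1 + t)) powr 0) +
         \<bar>\<mu>\<bar> * (K * ?D) * tail_const 0 * ((1 + t) powr (0 - 1) * (1 + ln (1 + t)) powr 0)"
        unfolding elim(2) by (intro add_mono profile_limit[OF m B _ b _ t]) auto
      also have "\<dots> = 2 * \<bar>\<mu>\<bar> * K * tail_const 0 * (1 + t) powr (-1) * ?D"
      proof -
        have "X * (K * D) * k * (P * 1) + X * (K * D) * k * (P * 1) = 2 * X * K * k * P * D" for X D k P :: real
          by simp
        then show ?thesis unfolding one[OF t] diff_0 .
      qed
      finally show "profile_error v vt t \<xi> \<le> 2 * \<bar>\<mu>\<bar> * K * tail_const 0 * (1 + t) powr (-1) * ?D" .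
    qed
  qed
qed

lemma profile_integral_estimate:
  assumes r: "1 \<le> r" "r < 2" and \<alpha>: "alpha DIM('a) r \<mu> < 1"
  shows "\<exists>Q>0. \<forall>(v0 :: 'a::euclidean_space \<Rightarrow> complex) v1 v vt t. (v0, v1) \<in> Sigma_space r \<longrightarrow> is_wave_solution \<mu> v0 v1 v vt \<longrightarrow> 0 \<le> t \<longrightarrow>
    (\<integral>\<^sup>+\<xi>. ennreal ((profile_error v vt t \<xi>)\<^sup>2) \<partial>lborel)
      \<le> ennreal (Q * (\<bar>\<mu>\<bar> * Sigma_norm r (v0, v1) * decay_rate DIM('a) r \<mu> t)\<^sup>2)"
proof -
  obtain K where K: "K > 0" and bounds: "mode_growth_bound \<mu> K"
    using mode_growth_bound_exists by blast
  obtain C where C: "C > 0" and low: "low_frequency_estimate TYPE('a) r \<mu> C"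
    using low_frequency_estimate_exists[OF r \<alpha>] by blast
  note low = low[unfolded low_frequency_estimate_def, rule_format]
  define k0 where "k0 = tail_const 0"
  have k0: "0 < k0" unfolding k0_def by (rule tail_const_pos) simp
  \<comment> \<open>The low frequencies enter with M = 2 |\<mu>| K, the high ones with the tail
    constant at \<kappa> = 0 in addition; |\<mu>|, the data norm and the rate are split off into
    \<open>E\<close>.\<close>
  define Q where "Q = C * (2 * K)\<^sup>2 + 2 * (2 * K * k0)\<^sup>2"
  have Q: "0 < Q" using C K k0 by (auto simp: Q_def intro!: add_pos_pos mult_pos_pos)
  show ?thesis
  proof (intro exI[of _ Q] conjI[of "0 < Q"] allI impI)
    show "0 < Q" by fact
    fix v0 v1 :: "'a \<Rightarrow> complex" and v vt and t :: real
    assume data: "(v0, v1) \<in> Sigma_space r" and sol: "is_wave_solution \<mu> v0 v1 v vt" and t: "0 \<le> t"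
    have v0: "v0 \<in> H1_space" "v0 \<in> Lp_space 2" "v0 \<in> Lp_space r" and v1: "v1 \<in> Lp_space 2" "v1 \<in> Lp_space r"
      using data by (auto simp: Sigma_space_def H1_space_L2)
    have vL: "v s \<in> Lp_space 2" "vt s \<in> Lp_space 2" if "0 \<le> s" for s
      using sol that unfolding is_wave_solution_def by (auto intro: H1_space_L2)
    have vF: "fourier_L2 (v s) \<in> borel_measurable borel" "fourier_L2 (vt s) \<in> borel_measurable borel" if "0 \<le> s" for s
      using vL[OF that] by (auto intro!: L2_measurable is_fourier_L2_D(2)[OF is_fourier_L2_fourier_L2])
    have [measurable]: "fourier_L2 (v t) \<in> borel_measurable borel" "fourier_L2 (vt t) \<in> borel_measurable borel"
      "\<And>n::nat. fourier_L2 (v (real n)) \<in> borel_measurable borel" "\<And>n::nat. fourier_L2 (vt (real n)) \<in> borel_measurable borel"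
      using t by (auto intro!: vF)
    define U where "U = profile_error v vt t"
    have Um[measurable]: "U \<in> borel_measurable borel" unfolding U_def profile_error_def[abs_def] wave_profile1_def wave_profile2_def by measurable
    have U0: "0 \<le> U \<xi>" for \<xi> by (simp add: U_def profile_error_def)
    note PD = profile_difference_bound[OF sol t K bounds, folded U_def]
    note F0 = is_fourier_L2_fourier_L2[OF v0(2)] and F1 = is_fourier_L2_fourier_L2[OF v1(1)]
    define \<Sigma> where "\<Sigma> = Sigma_norm r (v0, v1)"
    define E where "E = \<bar>\<mu>\<bar> * \<Sigma> * decay_rate DIM('a) r \<mu> t"
    have dec: "(1 + t) powr (-1) \<le> decay_rate DIM('a) r \<mu> t" by (rule decay_rate_ge[OF t])
    have dec0: "0 \<le> decay_rate DIM('a) r \<mu> t" by (rule order_trans[OF _ dec]) simp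
    have H1: "Lp_norm 2 v0 \<le> H1_norm v0" "0 \<le> H1_norm v0"
      using H1_norm_ge(1)[OF v0(1)] by (auto simp: H1_norm_def)
    have S: "Lp_norm r v0 + Lp_norm r v1 \<le> \<Sigma>" "Lp_norm 2 v0 + Lp_norm 2 v1 \<le> \<Sigma>" "0 \<le> \<Sigma>"
      using H1 Lp_norm_nonneg[of r v0] Lp_norm_nonneg[of r v1] Lp_norm_nonneg[of 2 v1]
      unfolding \<Sigma>_def Sigma_norm_def fst_conv snd_conv by linarith+
    have cb[measurable]: "cball (0::'a) 1 \<in> sets borel" by simp
    have "(\<integral>\<^sup>+\<xi>. ennreal ((U \<xi>)\<^sup>2) \<partial>lborel) = (\<integral>\<^sup>+\<xi>. ennreal ((U \<xi>)\<^sup>2) * indicator (cball 0 1) \<xi> + ennreal ((U \<xi>)\<^sup>2) * indicator (- cball 0 1) \<xi> \<partial>lborel)"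
      by (intro nn_integral_cong) (auto simp: indicator_def)
    also have "\<dots> = (\<integral>\<^sup>+\<xi>. ennreal ((U \<xi>)\<^sup>2) * indicator (cball 0 1) \<xi> \<partial>lborel) + (\<integral>\<^sup>+\<xi>. ennreal ((U \<xi>)\<^sup>2) * indicator (- cball 0 1) \<xi> \<partial>lborel)"
      by (rule nn_integral_add) measurable
    also have "\<dots> \<le> ennreal (C * (2 * K)\<^sup>2 * E\<^sup>2) + ennreal (2 * (2 * K * k0)\<^sup>2 * E\<^sup>2)"
    proof (rule add_mono)
      have "(\<integral>\<^sup>+\<xi>. ennreal ((U \<xi>)\<^sup>2) * indicator (cball 0 1) \<xi> \<partial>lborel) \<le>
         ennreal (C * (2 * \<bar>\<mu>\<bar> * K * (Lp_norm r v0 + Lp_norm r v1) * decay_rate DIM('a) r \<mu> t)\<^sup>2)"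
        using K U0 by (intro low[OF v0(2,3) F0 v1 F1 Um _ _ t PD(1)]) auto
      also have "\<dots> \<le> ennreal (C * (2 * K)\<^sup>2 * E\<^sup>2)"
      proof (rule ennreal_leI)
        have "2 * \<bar>\<mu>\<bar> * K * (Lp_norm r v0 + Lp_norm r v1) * decay_rate DIM('a) r \<mu> t \<le> 2 * \<bar>\<mu>\<bar> * K * \<Sigma> * decay_rate DIM('a) r \<mu> t"
          using K S(1) dec0 by (intro mult_right_mono mult_left_mono) auto
        also have "\<dots> = 2 * K * E" by (simp add: E_def)
        finally have "(2 * \<bar>\<mu>\<bar> * K * (Lp_norm r v0 + Lp_norm r v1) * decay_rate DIM('a) r \<mu> t)\<^sup>2 \<le> (2 * K * E)\<^sup>2"
          using K dec0 by (intro power_mono) auto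
        then show "C * (2 * \<bar>\<mu>\<bar> * K * (Lp_norm r v0 + Lp_norm r v1) * decay_rate DIM('a) r \<mu> t)\<^sup>2 \<le> C * (2 * K)\<^sup>2 * E\<^sup>2"
          using C by (simp only: power_mult_distrib[symmetric] mult.assoc[of C]) (simp add: mult_left_mono)
      qed
      finally show "(\<integral>\<^sup>+\<xi>. ennreal ((U \<xi>)\<^sup>2) * indicator (cball 0 1) \<xi> \<partial>lborel) \<le> ennreal (C * (2 * K)\<^sup>2 * E\<^sup>2)" .
    next
      define M where "M = 2 * \<bar>\<mu>\<bar> * K * k0 * (1 + t) powr (-1)"
      have M: "0 \<le> M" using K k0 by (simp add: M_def)
      have "(\<integral>\<^sup>+\<xi>. ennreal ((U \<xi>)\<^sup>2) * indicator (- cball 0 1) \<xi> \<partial>lborel) \<le> ennreal (2 * (M * (Lp_norm 2 (fourier_L2 v0) + Lp_norm 2 (fourier_L2 v1)))\<^sup>2)"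
        using PD(2) unfolding k0_def[symmetric] M_def[symmetric]
        by (intro high_frequency_estimate is_fourier_L2_D(2)[OF F0] is_fourier_L2_D(2)[OF F1] Um U0 M)
      also have "\<dots> \<le> ennreal (2 * (2 * K * k0)\<^sup>2 * E\<^sup>2)"
      proof (rule ennreal_leI)
        have "M * (Lp_norm 2 (fourier_L2 v0) + Lp_norm 2 (fourier_L2 v1)) \<le> (2 * \<bar>\<mu>\<bar> * K * k0 * decay_rate DIM('a) r \<mu> t) * \<Sigma>"
          unfolding is_fourier_L2_norm[OF F0] is_fourier_L2_norm[OF F1] M_def
          using S(2) dec dec0 K k0 by (intro mult_mono mult_left_mono) auto
        also have "\<dots> = 2 * K * k0 * E" by (simp add: E_def)
        finally have "(M * (Lp_norm 2 (fourier_L2 v0) + Lp_norm 2 (fourier_L2 v1)))\<^sup>2 \<le> (2 * K * k0 * E)\<^sup>2"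
          using M by (intro power_mono) auto
        then show "2 * (M * (Lp_norm 2 (fourier_L2 v0) + Lp_norm 2 (fourier_L2 v1)))\<^sup>2 \<le> 2 * (2 * K * k0)\<^sup>2 * E\<^sup>2"
          by (simp only: power_mult_distrib[symmetric] mult.assoc[of 2 "(_)\<^sup>2"])
      qed
      finally show "(\<integral>\<^sup>+\<xi>. ennreal ((U \<xi>)\<^sup>2) * indicator (- cball 0 1) \<xi> \<partial>lborel) \<le> ennreal (2 * (2 * K * k0)\<^sup>2 * E\<^sup>2)" .
    qed
    also have "\<dots> = ennreal (Q * E\<^sup>2)"
      using C by (subst ennreal_plus[symmetric]) (auto simp: Q_def distrib_right)
    finally show "(\<integral>\<^sup>+\<xi>. ennreal ((profile_error v vt t \<xi>)\<^sup>2) \<partial>lborel)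
      \<le> ennreal (Q * (\<bar>\<mu>\<bar> * Sigma_norm r (v0, v1) * decay_rate DIM('a) r \<mu> t)\<^sup>2)"
      unfolding U_def E_def \<Sigma>_def .
  qed
qed

theorem wave_scattering:
  assumes r: "1 \<le> r" "r < 2" and \<alpha>: "alpha DIM('a) r \<mu> < 1"
  shows "\<exists>C>0. \<forall>(v0 :: 'a::euclidean_space \<Rightarrow> complex) v1 v vt.
    (v0, v1) \<in> Sigma_space r \<longrightarrow> is_wave_solution \<mu> v0 v1 v vt \<longrightarrow>
    (\<exists>vp \<in> energy_space. \<forall>t\<ge>0.
       energy_norm (energy_diff (embed_energy (v t, vt t)) (free_wave t vp))
         \<le> C * \<bar>\<mu>\<bar> * Sigma_norm r (v0, v1) * decay_rate DIM('a) r \<mu> t)"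
proof -
  obtain Q where Q: "Q > 0" and est: "\<And>(v0 :: 'a \<Rightarrow> complex) v1 v vt t. (v0, v1) \<in> Sigma_space r \<Longrightarrow> is_wave_solution \<mu> v0 v1 v vt \<Longrightarrow> 0 \<le> t \<Longrightarrow>
    (\<integral>\<^sup>+\<xi>. ennreal ((profile_error v vt t \<xi>)\<^sup>2) \<partial>lborel)
      \<le> ennreal (Q * (\<bar>\<mu>\<bar> * Sigma_norm r (v0, v1) * decay_rate DIM('a) r \<mu> t)\<^sup>2)"
    using profile_integral_estimate[OF r \<alpha>] by blast
  show ?thesis
  \<comment> \<open>The errors of position and velocity each have squared norm at most
    \<open>q t\<close>.\<close>
  proof (intro exI[of _ "sqrt (2 * Q)"] conjI[of "0 < sqrt (2 * Q)"] allI impI)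
    show "0 < sqrt (2 * Q)" using Q by simp
    fix v0 v1 :: "'a \<Rightarrow> complex" and v vt
    assume data: "(v0, v1) \<in> Sigma_space r" and sol: "is_wave_solution \<mu> v0 v1 v vt"
    have vH: "v s \<in> H1_space" and vL: "v s \<in> Lp_space 2" "vt s \<in> Lp_space 2" if "0 \<le> s" for s
      using sol that unfolding is_wave_solution_def by (auto intro: H1_space_L2)
    define G where "G t = fourier_L2 (v t)" for t
    define H where "H t = fourier_L2 (vt t)" for t
    have H: "is_fourier_L2 (vt s) (H s)" if "0 \<le> s" for s
      unfolding H_def by (rule is_fourier_L2_fourier_L2[OF vL(2)[OF that]])
    have GH: "G s \<in> borel_measurable borel" "H s \<in> borel_measurable borel" if "0 \<le> s" for s
      using vL[OF that] unfolding G_def H_def by (auto intro!: L2_measurable is_fourier_L2_D(2)[OF is_fourier_L2_fourier_L2])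
    have [measurable]: "\<And>n::nat. G (real n) \<in> borel_measurable borel" "\<And>n::nat. H (real n) \<in> borel_measurable borel"
      by (auto intro!: GH)
    define z1 where "z1 = wave_profile1 v vt"
    define z2 where "z2 = wave_profile2 v vt"
    have z: "z1 t \<xi> = profile1 (norm \<xi>) t (G t \<xi>) (H t \<xi>)" "z2 t \<xi> = profile2 (norm \<xi>) t (G t \<xi>) (H t \<xi>)" for t \<xi>
      by (simp_all add: z1_def z2_def wave_profile1_def wave_profile2_def G_def H_def)
    have zm: "z1 s \<in> borel_measurable borel" "z2 s \<in> borel_measurable borel" if "0 \<le> s" for s
      unfolding z[abs_def] by (intro profile_measurable GH that)+
    define Z1 where "Z1 \<xi> = lim (\<lambda>n. z1 (real n) \<xi>)" for \<xi>
    define Z2 where "Z2 \<xi> = lim (\<lambda>n. z2 (real n) \<xi>)" for \<xi>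
    have Zm[measurable]: "Z1 \<in> borel_measurable borel" "Z2 \<in> borel_measurable borel"
      unfolding Z1_def[abs_def] Z2_def[abs_def] z by measurable
    define U where "U = profile_error v vt"
    have U: "U t \<xi> = cmod (z1 t \<xi> - Z1 \<xi>) + cmod (z2 t \<xi> - Z2 \<xi>)" for t \<xi>
      by (simp add: U_def profile_error_def Z1_def Z2_def z1_def z2_def)
    define q where "q t = Q * (\<bar>\<mu>\<bar> * Sigma_norm r (v0, v1) * decay_rate DIM('a) r \<mu> t)\<^sup>2" for t
    have q0: "0 \<le> q t" for t using Q by (simp add: q_def)
    have Uq: "(\<integral>\<^sup>+\<xi>. ennreal ((U t \<xi>)\<^sup>2) \<partial>lborel) \<le> ennreal (q t)" if "0 \<le> t" for t
      using est[OF data sol that] unfolding U_def q_def .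
    \<comment> \<open>The error estimate at t = 0, together with the finite energy of the solution
      there, shows that the limits are square integrable.\<close>
    have "(\<lambda>\<xi>. z1 0 \<xi> - Z1 \<xi>) \<in> Lp_space 2" "(\<lambda>\<xi>. z2 0 \<xi> - Z2 \<xi>) \<in> Lp_space 2"
      by (rule Lp_norm_2_le_of_ennreal(1)[OF _ _ Uq[of 0] q0]; use zm[of 0] in \<open>auto simp: U\<close>)+
    moreover have "z1 0 \<in> Lp_space 2" "z2 0 \<in> Lp_space 2"
      using H1_norm_ge(2)[OF vH[of 0]] is_fourier_L2_D(2)[OF H[of 0]]
      by (auto simp: z[abs_def] profile1_def profile2_def G_def)
    ultimately have Z: "Z1 \<in> Lp_space 2" "Z2 \<in> Lp_space 2"
      using L2_diff[of "z1 0" "\<lambda>\<xi>. z1 0 \<xi> - Z1 \<xi>"] L2_diff[of "z2 0" "\<lambda>\<xi>. z2 0 \<xi> - Z2 \<xi>"] by simp_all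
    \<comment> \<open>The first profile carries a factor |\<xi>|, and dividing by it gives the
      Fourier-side first component; division by zero at the origin affects only a null set.\<close>
    define F where "F \<xi> = Z1 \<xi> / of_real (norm \<xi>)" for \<xi>
    define g where "g = inv_fourier_L2 Z2"
    have gZ: "is_fourier_L2 g Z2" unfolding g_def by (rule is_fourier_L2_inv_fourier_L2[OF Z(2)])
    note gL = is_fourier_L2_D(1)[OF gZ]
    have gAE: "AE \<xi> in lborel. fourier_L2 g \<xi> = Z2 \<xi>"
      by (rule is_fourier_L2_unique_AE[OF is_fourier_L2_fourier_L2[OF gL] gZ])
    have Fm[measurable]: "F \<in> borel_measurable borel" "fourier_L2 g \<in> borel_measurable borel"
      using L2_measurable[OF is_fourier_L2_D(2)[OF is_fourier_L2_fourier_L2[OF gL]]] unfolding F_def[abs_def] by measurable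
    have "F \<in> Hdot1_space"
      unfolding Hdot1_space_def
      by (auto simp: F_def norm_mult norm_divide intro!: L2_dominated[OF Z(1)])
    then have vp: "(F, g) \<in> energy_space" using gL by (simp add: energy_space_def)
    show "\<exists>vp \<in> energy_space. \<forall>t\<ge>0. energy_norm (energy_diff (embed_energy (v t, vt t)) (free_wave t vp))
         \<le> sqrt (2 * Q) * \<bar>\<mu>\<bar> * Sigma_norm r (v0, v1) * decay_rate DIM('a) r \<mu> t"
    proof (intro bexI[OF _ vp] allI impI)
      fix t :: real assume t: "0 \<le> t"
      note [measurable] = GH[OF t] zm[OF t]
      \<comment> \<open>\<open>X\<close> is the free velocity on the Fourier side, \<open>P\<close>
        the position error weighted by |\<xi>|. Almost everywhere they are rotated combinations of
        the limits and of the profile errors, respectively.\<close>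
      define X where "X \<xi> = - of_real (norm \<xi> * sin (t * norm \<xi>)) * F \<xi> + of_real (cos (t * norm \<xi>)) * fourier_L2 g \<xi>" for \<xi>
      define P where "P \<xi> = of_real (norm \<xi>) * (G t \<xi> - (of_real (cos (t * norm \<xi>)) * F \<xi> + of_real (sin (t * norm \<xi>) / norm \<xi>) * fourier_L2 g \<xi>))" for \<xi>
      have [measurable]: "X \<in> borel_measurable borel" "P \<in> borel_measurable borel"
        unfolding X_def[abs_def] P_def[abs_def] by measurable
      \<comment> \<open>Only almost everywhere, because \<open>fourier_L2 g\<close> is a chosen
        representative and \<open>F\<close> involves division by |\<xi>|.\<close>
      have X_AE: "AE \<xi> in lborel. X \<xi> = - of_real (sin (norm \<xi> * t)) * Z1 \<xi> + of_real (cos (norm \<xi> * t)) * Z2 \<xi>"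
        using gAE AE_norm_pos[where 'a='a] by eventually_elim (simp add: X_def F_def mult.commute)
      have P_AE: "AE \<xi> in lborel. P \<xi> = of_real (cos (norm \<xi> * t)) * (z1 t \<xi> - Z1 \<xi>) + of_real (sin (norm \<xi> * t)) * (z2 t \<xi> - Z2 \<xi>)"
        using gAE AE_norm_pos[where 'a='a]
      proof eventually_elim
        case (elim \<xi>)
        have "of_real (norm \<xi>) * G t \<xi> = of_real (cos (norm \<xi> * t)) * z1 t \<xi> + of_real (sin (norm \<xi> * t)) * z2 t \<xi>"
          unfolding z profile_rotate(1) ..
        moreover have "of_real (norm \<xi>) * (of_real (cos (t * norm \<xi>)) * F \<xi> + of_real (sin (t * norm \<xi>) / norm \<xi>) * fourier_L2 g \<xi>) =
           of_real (cos (norm \<xi> * t)) * Z1 \<xi> + of_real (sin (norm \<xi> * t)) * Z2 \<xi>"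
          using elim by (simp add: F_def field_simps)
        ultimately show ?case by (simp only: P_def right_diff_distrib) (simp add: algebra_simps)
      qed
      have XL: "X \<in> Lp_space 2"
      proof (rule L2_cong_AE[OF _ _ X_AE])
        have "(\<lambda>\<xi>. - of_real (sin (norm \<xi> * t)) * Z1 \<xi>) \<in> Lp_space 2"
          by (rule L2_dominated[OF Z(1)]) (auto simp: norm_mult intro!: mult_left_le_one_le)
        moreover have "(\<lambda>\<xi>. of_real (cos (norm \<xi> * t)) * Z2 \<xi>) \<in> Lp_space 2"
          by (rule L2_dominated[OF Z(2)]) (auto simp: norm_mult intro!: mult_left_le_one_le)
        ultimately show "(\<lambda>\<xi>. - of_real (sin (norm \<xi> * t)) * Z1 \<xi> + of_real (cos (norm \<xi> * t)) * Z2 \<xi>) \<in> Lp_space 2"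
          by (rule L2_add)
      qed measurable
      have rot: "cmod (of_real x * a + of_real y * b) \<le> cmod a + cmod b" if "\<bar>x\<bar> \<le> 1" "\<bar>y\<bar> \<le> 1" for x y a b
      proof -
        have "cmod (of_real x * a + of_real y * b) \<le> \<bar>x\<bar> * cmod a + \<bar>y\<bar> * cmod b"
          using norm_triangle_ineq[of "of_real x * a" "of_real y * b"] by (simp add: norm_mult)
        also have "\<dots> \<le> 1 * cmod a + 1 * cmod b" using that by (intro add_mono mult_right_mono) auto
        finally show ?thesis by simp
      qed
      have P: "(Lp_norm 2 P)\<^sup>2 \<le> q t"
      proof (rule Lp_norm_2_le_of_ennreal(2)[OF _ _ Uq[OF t] q0])
        show "AE \<xi> in lborel. cmod (P \<xi>) \<le> U t \<xi>"
          using P_AE by eventually_elim (auto simp: U intro!: rot)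
      qed measurable
      have V: "(Lp_norm 2 (\<lambda>\<xi>. H t \<xi> - X \<xi>))\<^sup>2 \<le> q t"
      proof (rule Lp_norm_2_le_of_ennreal(2)[OF _ _ Uq[OF t] q0])
        show "AE \<xi> in lborel. cmod (H t \<xi> - X \<xi>) \<le> U t \<xi>"
          using X_AE
        proof eventually_elim
          case (elim \<xi>)
          have h: "H t \<xi> = - of_real (sin (norm \<xi> * t)) * z1 t \<xi> + of_real (cos (norm \<xi> * t)) * z2 t \<xi>"
            unfolding z profile_rotate(2) ..
          have "H t \<xi> - X \<xi> = of_real (- sin (norm \<xi> * t)) * (z1 t \<xi> - Z1 \<xi>) + of_real (cos (norm \<xi> * t)) * (z2 t \<xi> - Z2 \<xi>)"
            unfolding h elim by (simp add: algebra_simps)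
          then show ?case unfolding U by (simp only:) (intro rot, auto)
        qed
      qed measurable
      \<comment> \<open>Velocities are compared in x, where \<open>free_wave\<close> uses a chosen
        inverse transform; the isometry moves the difference to the Fourier side for any
        choice.\<close>
      have iso: "Lp_norm 2 (\<lambda>x. vt t x - inv_fourier_L2 X x) = Lp_norm 2 (\<lambda>\<xi>. H t \<xi> - X \<xi>)"
        by (rule is_fourier_L2_dist[OF H[OF t] is_fourier_L2_inv_fourier_L2[OF XL], symmetric])
      have "energy_norm (energy_diff (embed_energy (v t, vt t)) (free_wave t (F, g))) =
         sqrt ((Lp_norm 2 P)\<^sup>2 + (Lp_norm 2 (\<lambda>\<xi>. H t \<xi> - X \<xi>))\<^sup>2)"
        unfolding iso[symmetric]
        by (simp add: energy_norm_def energy_diff_def embed_energy_def free_wave_def Hdot1_norm_def P_def[abs_def] X_def[abs_def] G_def)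
      also have "\<dots> \<le> sqrt (q t + q t)" using P V by (intro real_sqrt_le_mono add_mono)
      also have "\<dots> = sqrt (2 * Q) * \<bar>\<bar>\<mu>\<bar> * Sigma_norm r (v0, v1) * decay_rate DIM('a) r \<mu> t\<bar>"
        by (simp add: q_def real_sqrt_mult)
      also have "\<bar>\<bar>\<mu>\<bar> * Sigma_norm r (v0, v1) * decay_rate DIM('a) r \<mu> t\<bar> = \<bar>\<mu>\<bar> * Sigma_norm r (v0, v1) * decay_rate DIM('a) r \<mu> t"
      proof -
        have "0 \<le> decay_rate DIM('a) r \<mu> t"
          by (rule order_trans[OF _ decay_rate_ge[OF t]]) simp
        moreover have "0 \<le> Sigma_norm r (v0, v1)" by (simp add: Sigma_norm_def H1_norm_def)
        ultimately show ?thesis by simp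
      qed
      finally show "energy_norm (energy_diff (embed_energy (v t, vt t)) (free_wave t (F, g))) \<le>
         sqrt (2 * Q) * \<bar>\<mu>\<bar> * Sigma_norm r (v0, v1) * decay_rate DIM('a) r \<mu> t"
        by (simp only: mult.assoc)
    qed
  qed
qed

theorem theorem1p1:
  fixes \<mu> r :: real
  assumes "1 \<le> r" and "r < 2"
    and "alpha CARD('n::finite) r \<mu> < 1"
  shows "\<exists>C>0. \<forall>(v0 :: real ^ 'n \<Rightarrow> complex) v1 v vt.
    (v0, v1) \<in> Sigma_space r \<longrightarrow> is_wave_solution \<mu> v0 v1 v vt \<longrightarrow>
    (\<exists>vp \<in> energy_space. \<forall>t\<ge>0.
       energy_norm (energy_diff (embed_energy (v t, vt t)) (free_wave t vp))
         \<le> C * \<bar>\<mu>\<bar> * Sigma_norm r (v0, v1) * decay_rate CARD('n) r \<mu> t)"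
  using wave_scattering[OF assms(1,2), of \<mu>, where 'a="real ^ 'n"] assms(3) by simp

end
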